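(* Let $\mathbf{X}$ be a positively omnioriented $4$-dimensional primitive quasitoric orbifold, and let $\mu$ be a torus invariant metric on $\mathbf{X}$ of the form described in the context (standard in the coordinates $z_1(v),z_2(v)$ near each vertex $v$). Then there exists a torus invariant almost complex structure $J$ on $\mathbf{X}$ such that $J$ is orthogonal with respect to $\mu$.
   Context: **Quasitoric orbifolds.** Let $N=\mathbb{Z}^2$, $T_N=(N\otimes\mathbb{R})/N$. Let $P\subset\mathbb{R}^2$ be a $2$-dimensional convex polytope with edges $E_1,\dots,E_\ell$. A characteristic function $\Lambda$ assigns to each edge $E_i$ a vector $\lambda_i=\Lambda(E_i)\in N$ such that $\lambda_i,\lambda_j$ are linearly independent whenever $E_i,E_j$ meet at a vertex. All $\lambda_i$ are assumed to be primitive vectors (the orbifold is then called primitive). For a face $F$ of $P$ let $N(F)$ be the submodule of $N$ generated by the $\lambda_i$ with $F\subset E_i$, let $T_{N(F)}=(N(F)\otimes\mathbb{R})/N(F)$, and let $T(N(F))$ be the image of the natural homomorphism $T_{N(F)}\to T_N$. For $p\in P$ let $F(p)$ be the face whose relative interior contains $p$. Put $X=P\times T_N/\sim$, where $(p,t)\sim(q,s)$ iff $p=q$ and $s^{-1}t\in T(N(F(p)))$. $T_N$ acts on $X$ through the second factor; let $\pi:X\to P$ be the orbit map. For a vertex $v$ of $P$ the point $\pi^{-1}(v)$ is also denoted $v$. **Orbifold structure.** For a vertex $v$ let $U_v$ be the complement in $P$ of all edges not containing $v$, and $X_v=\pi^{-1}(U_v)$. Put $\widetilde X_v=U_v\times T_{N(v)}/\sim_v$,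 where $(p,t)\sim_v(q,s)$ iff $p=q$ and $s^{-1}t\in T_{N(F(p))}\subset T_{N(v)}$. The finite group $G_v=N/N(v)=\ker(T_{N(v)}\to T_N)$ acts on $\widetilde X_v$, and $T_{N(v)}\to T_N$ induces $\xi_v:\widetilde X_v\to X_v\cong\widetilde X_v/G_v$. Let the edges at $v$ be $E_1,E_2$, ordered clockwise (the clockwise angle from $E_1$ to $E_2$ is less than $180^\circ$); let $p_i(v)$ be an affine function vanishing on $E_i$ and positive on the interior of $P$, and $q_1(v),q_2(v)$ the angular coordinates with respect to the basis $\lambda_1,\lambda_2$ of $N\otimes\mathbb{R}$. The functions $z_i(v)=\sqrt{p_i(v)}\,e^{2\pi\sqrt{-1}q_i(v)}$, $i=1,2$, identify $\widetilde X_v$ with an open subset of $\mathbb{C}^2$ and define its smooth structure. The charts $(\widetilde X_v,G_v,\xi_v)$ define the orbifold $\mathbf{X}$ with underlying space $X$, called the $4$-dimensional primitive quasitoric orbifold with model $(P,\Lambda)$. Let $X_{reg}$ be the set of points with trivial local group (it contains all points other than the vertices). **Omniorientation.** $\mathbf{X}$ is oriented via the standard orientations of $P\subset\mathbb{R}^2$ and $T_N$. An omniorientation is then determined by a choice of sign of each characteristic vector $\lambda_i$; it is positive if at every vertex the matrix of the two adjacent characteristic vectors, taken in the clockwise order of the adjacent edges, has positive determinant. **Torus invariance.** A metric, or an almost complex structure, on $\mathbf{X}$ is called torus invariant if it is $T_{N(v)}$-invariant in some neighborhood of each vertex $v$ (i.e. on the chart) and $T_N$-invariant on $X_{reg}$.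 **The metric $\mu$.** Choose an open cover of $P$ such that each vertex has a neighborhood contained in exactly one member of the cover, and pull it back by $\pi$ to a cover of $X$. On the member $W_v\subset X_v$ corresponding to a vertex $v$ take the standard (Euclidean) metric with respect to the coordinates $z_1(v),z_2(v)$ on the chart; on the remaining members take any $T_N$-invariant metric. The metric $\mu$ is obtained by gluing these by a $T_N$-invariant smooth partition of unity (pulled back from $P$) subordinate to the cover. *)

theory Defs
  imports "HOL-Analysis.Analysis" "HOL-Algebra.Coset"
begin

section \<open>Smooth maps\<close>

text \<open>Meant for an open set \<open>S\<close> only.\<close>

fun Ck_on :: "nat \<Rightarrow> 'a::euclidean_space set \<Rightarrow> ('a \<Rightarrow> 'b::real_normed_vector) \<Rightarrow> bool" where
  "Ck_on 0 S f \<longleftrightarrow> continuous_on S f"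
| "Ck_on (Suc n) S f \<longleftrightarrow>
     (\<forall>x\<in>S. f differentiable (at x)) \<and> (\<forall>a. Ck_on n S (\<lambda>x. frechet_derivative f (at x) a))"

definition smooth_on :: "'a::euclidean_space set \<Rightarrow> ('a \<Rightarrow> 'b::real_normed_vector) \<Rightarrow> bool" where
  "smooth_on S f \<longleftrightarrow> (\<forall>n. Ck_on n S f)"

definition open_embedding_on :: "'a::euclidean_space set \<Rightarrow> ('a \<Rightarrow> 'a) \<Rightarrow> bool" where
  "open_embedding_on S \<phi> \<longleftrightarrow> open S \<and> open (\<phi> ` S) \<and> smooth_on S \<phi> \<and>
     (\<exists>\<psi>. smooth_on (\<phi> ` S) \<psi> \<and> (\<forall>z\<in>S. \<psi> (\<phi> z) = z))"


section \<open>Lattices and tori\<close>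

definition std_lattice :: "(real^2) set" where
  "std_lattice = {x. \<forall>i. x $ i \<in> \<int>}"

definition int_span :: "(real^2) set \<Rightarrow> (real^2) set" where
  "int_span S = module.span (\<lambda>(k::int) x. of_int k *\<^sub>R x) S"

definition primitive_vector :: "real^2 \<Rightarrow> bool" where
  "primitive_vector x \<longleftrightarrow> x \<in> std_lattice \<and> x \<noteq> 0 \<and>
     (\<forall>(k::int) y. y \<in> std_lattice \<and> x = of_int k *\<^sub>R y \<longrightarrow> \<bar>k\<bar> = 1)"

definition vec_group :: "(real^2) set \<Rightarrow> (real^2) monoid" where
  "vec_group V = \<lparr>carrier = V, monoid.mult = (+), one = 0\<rparr>"

text \<open>For a subgroup \<open>L\<close> of the standard lattice, \<open>L \<otimes> \<real>\<close> is realised as the real span of \<open>L\<close>;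
  the elements of the torus \<open>(L \<otimes> \<real>) / L\<close> are the cosets of \<open>L\<close> in it.\<close>

definition torus :: "(real^2) set \<Rightarrow> (real^2) set monoid" where
  "torus L = vec_group (span L) Mod L"

text \<open>The homomorphism \<open>x + L \<mapsto> x + M\<close> from \<open>torus L\<close> to \<open>torus M\<close>, for \<open>L \<subseteq> M\<close>.\<close>

definition torus_hom :: "(real^2) set \<Rightarrow> (real^2) set \<Rightarrow> (real^2) set" where
  "torus_hom M t = M <#>\<^bsub>vec_group UNIV\<^esub> t"


section \<open>Primitive quasitoric orbifolds\<close>

type_synonym C2 = "complex \<times> complex"

text \<open>Equivalence classes in \<open>P \<times> T\<close>, where \<open>T\<close> is a torus as above.\<close>

type_synonym orbit_class = "((real^2) \<times> (real^2) set) set"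

type_synonym metric_family = "real^2 \<Rightarrow> C2 \<Rightarrow> C2 \<Rightarrow> C2 \<Rightarrow> real"
type_synonym acs_family = "real^2 \<Rightarrow> C2 \<Rightarrow> C2 \<Rightarrow> C2"
type_synonym chart_map_pred = "real^2 \<Rightarrow> real^2 \<Rightarrow> (C2 \<Rightarrow> C2) \<Rightarrow> C2 \<Rightarrow> bool"

text \<open>A tensor field on the orbifold is a family of tensor fields, one for each vertex \<open>v\<close>, on the
  image in \<open>C2\<close> of the chart at \<open>v\<close>; every tangent space is identified with \<open>C2\<close>. The next two
  definitions say that such a family is preserved at the point \<open>z\<close> of the chart at \<open>v\<close> by the map
  \<open>\<phi>\<close> into the chart at \<open>w\<close>.\<close>

definition preserves_metric :: "metric_family \<Rightarrow> chart_map_pred" where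
  "preserves_metric g v w \<phi> z \<longleftrightarrow> (\<forall>a b.
     g w (\<phi> z) (frechet_derivative \<phi> (at z) a) (frechet_derivative \<phi> (at z) b) = g v z a b)"

definition preserves_acs :: "acs_family \<Rightarrow> chart_map_pred" where
  "preserves_acs J v w \<phi> z \<longleftrightarrow> (\<forall>a.
     frechet_derivative \<phi> (at z) (J v z a) = J w (\<phi> z) (frechet_derivative \<phi> (at z) a))"

text \<open>\<open>x - v\<close> and \<open>y - v\<close> are linearly independent and the clockwise angle from the first to the
  second is less than 180 degrees iff the determinant below is negative.\<close>

definition clockwise_edges :: "(real^2) set \<Rightarrow> real^2 \<Rightarrow> (real^2) set \<Rightarrow> (real^2) set \<Rightarrow> bool" where
  "clockwise_edges P v E E' \<longleftrightarrow> E edge_of P \<and> E' edge_of P \<and> v \<in> E \<and> v \<in> E' \<and>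
     (\<forall>x\<in>E - {v}. \<forall>y\<in>E' - {v}. det (vector [x - v, y - v] :: real^2^2) < 0)"

text \<open>The signs of the characteristic vectors are part of \<open>\<Lambda>\<close>, so \<open>\<Lambda>\<close> also carries the
  omniorientation. \<open>h v E\<close> is the chosen affine function for the edge \<open>E\<close> at the vertex \<open>v\<close>; the
  metric that is standard in the chart at \<open>v\<close> depends on this choice.\<close>

locale primitive_quasitoric =
  fixes P :: "(real^2) set"
    and \<Lambda> :: "(real^2) set \<Rightarrow> real^2"
    and h :: "real^2 \<Rightarrow> (real^2) set \<Rightarrow> real^2 \<Rightarrow> real"
  assumes polytope: "polytope P"
    and dim2: "aff_dim P = 2"
    and primitive: "\<And>E. E edge_of P \<Longrightarrow> primitive_vector (\<Lambda> E)"
    and indep: "\<And>v E E'. v extreme_point_of P \<Longrightarrow> E edge_of P \<Longrightarrow> E' edge_of P \<Longrightarrow> E \<noteq> E' \<Longrightarrow>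
           v \<in> E \<Longrightarrow> v \<in> E' \<Longrightarrow> \<Lambda> E \<noteq> \<Lambda> E' \<and> independent {\<Lambda> E, \<Lambda> E'}"
    and affine: "\<And>v E. v extreme_point_of P \<Longrightarrow> E edge_of P \<Longrightarrow> v \<in> E \<Longrightarrow>
           (\<exists>a c. \<forall>p. h v E p = a \<bullet> p + c) \<and> (\<forall>p\<in>E. h v E p = 0) \<and> (\<forall>p\<in>interior P. h v E p > 0)"
begin

definition positively_omnioriented :: bool where
  "positively_omnioriented \<longleftrightarrow> (\<forall>v E E'. v extreme_point_of P \<and> clockwise_edges P v E E' \<longrightarrow>
     det (vector [\<Lambda> E, \<Lambda> E'] :: real^2^2) > 0)"

definition face_at :: "real^2 \<Rightarrow> (real^2) set" where
  "face_at p = (THE F. F face_of P \<and> p \<in> rel_interior F)"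

definition face_lattice :: "(real^2) set \<Rightarrow> (real^2) set" where
  "face_lattice F = int_span {\<Lambda> E |E. E edge_of P \<and> F \<subseteq> E}"

subsection \<open>The space and its charts\<close>

text \<open>For \<open>M = std_lattice\<close> this is the relation defining the orbifold, for \<open>M = N(v)\<close> the one
  defining the chart at the vertex \<open>v\<close>.\<close>

definition orbit_rel :: "(real^2) set \<Rightarrow> (real^2) set \<Rightarrow>
    (((real^2) \<times> (real^2) set) \<times> ((real^2) \<times> (real^2) set)) set" where
  "orbit_rel U M = {((p, t), (q, s)). p \<in> U \<and> q = p \<and> t \<in> carrier (torus M) \<and> s \<in> carrier (torus M) \<and>
     inv\<^bsub>torus M\<^esub> s \<otimes>\<^bsub>torus M\<^esub> t \<in> torus_hom M ` carrier (torus (face_lattice (face_at p)))}"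

definition orbit_space :: "(real^2) set \<Rightarrow> (real^2) set \<Rightarrow> orbit_class set" where
  "orbit_space U M = (U \<times> carrier (torus M)) // orbit_rel U M"

definition act :: "(real^2) set \<Rightarrow> (real^2) set \<Rightarrow> orbit_class \<Rightarrow> orbit_class" where
  "act M t c = (\<lambda>(p, s). (p, t \<otimes>\<^bsub>torus M\<^esub> s)) ` c"

definition base :: "orbit_class \<Rightarrow> real^2" where
  "base c = (THE p. \<exists>t. (p, t) \<in> c)"

definition X :: "orbit_class set" where
  "X = orbit_space P std_lattice"

definition U :: "real^2 \<Rightarrow> (real^2) set" where
  "U v = P - \<Union>{E. E edge_of P \<and> v \<notin> E}"

definition Nv :: "real^2 \<Rightarrow> (real^2) set" where
  "Nv v = face_lattice {v}"

definition Xt :: "real^2 \<Rightarrow> orbit_class set" where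
  "Xt v = orbit_space (U v) (Nv v)"

definition G :: "real^2 \<Rightarrow> (real^2) set set" where
  "G v = kernel (torus (Nv v)) (torus std_lattice) (torus_hom std_lattice)"

text \<open>The map induced by the surjection from \<open>torus (Nv v)\<close> to \<open>torus std_lattice\<close>; the image of a
  class is again a full class.\<close>

definition \<xi> :: "orbit_class \<Rightarrow> orbit_class" where
  "\<xi> c = (\<lambda>(p, t). (p, torus_hom std_lattice t)) ` c"

definition X_reg :: "orbit_class set" where
  "X_reg = {x \<in> X. \<forall>v c. v extreme_point_of P \<and> c \<in> Xt v \<and> \<xi> c = x \<longrightarrow>
     (\<forall>g\<in>G v. act (Nv v) g c = c \<longrightarrow> g = \<one>\<^bsub>torus (Nv v)\<^esub>)}"

definition edge1 :: "real^2 \<Rightarrow> (real^2) set" where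
  "edge1 v = (THE E. \<exists>E'. clockwise_edges P v E E')"

definition edge2 :: "real^2 \<Rightarrow> (real^2) set" where
  "edge2 v = (THE E'. \<exists>E. clockwise_edges P v E E')"

definition chart :: "real^2 \<Rightarrow> orbit_class \<Rightarrow> C2" where
  "chart v c = (THE z. \<exists>p t q1 q2. (p, t) \<in> c \<and>
     q1 *\<^sub>R \<Lambda> (edge1 v) + q2 *\<^sub>R \<Lambda> (edge2 v) \<in> t \<and>
     z = (of_real (sqrt (h v (edge1 v) p)) * cis (2 * pi * q1),
          of_real (sqrt (h v (edge2 v) p)) * cis (2 * pi * q2)))"

text \<open>From here on the points of \<open>Xt v\<close> are described by their coordinates: \<open>V v A\<close> is the part of
  the chart at \<open>v\<close> lying over \<open>A \<subseteq> P\<close>, in coordinates.\<close>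

definition V :: "real^2 \<Rightarrow> (real^2) set \<Rightarrow> C2 set" where
  "V v A = chart v ` {c \<in> Xt v. base c \<in> A}"

definition chart_inv :: "real^2 \<Rightarrow> C2 \<Rightarrow> orbit_class" where
  "chart_inv v = inv_into (Xt v) (chart v)"

definition rot :: "real^2 \<Rightarrow> (real^2) set \<Rightarrow> C2 \<Rightarrow> C2" where
  "rot v t z = chart v (act (Nv v) t (chart_inv v z))"

text \<open>\<open>\<phi>\<close> is a local lift to the charts at \<open>v\<close> and \<open>w\<close> of the map \<open>f\<close> on the orbifold.\<close>

definition local_lift :: "(orbit_class \<Rightarrow> orbit_class) \<Rightarrow>
    real^2 \<Rightarrow> real^2 \<Rightarrow> C2 set \<Rightarrow> (C2 \<Rightarrow> C2) \<Rightarrow> bool" where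
  "local_lift f v w S \<phi> \<longleftrightarrow> open_embedding_on S \<phi> \<and> S \<subseteq> V v P \<and> \<phi> ` S \<subseteq> V w P \<and>
     (\<forall>z\<in>S. \<xi> (chart_inv w (\<phi> z)) = f (\<xi> (chart_inv v z)))"

subsection \<open>Tensor fields\<close>

text \<open>Below, \<open>A\<close> is a relatively open subset of \<open>P\<close>, and the tensor fields are those on the part of
  the orbifold over \<open>A\<close>. Lifts of the identity comprise the chart changes and, for \<open>v = w\<close>, the
  action of \<open>G v\<close>.\<close>

definition chart_compatible :: "(real^2) set \<Rightarrow> chart_map_pred \<Rightarrow> bool" where
  "chart_compatible A K \<longleftrightarrow> (\<forall>v w S \<phi>. v extreme_point_of P \<and> w extreme_point_of P \<and>
     local_lift id v w S \<phi> \<and> S \<subseteq> V v A \<longrightarrow> (\<forall>z\<in>S. K v w \<phi> z))"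

definition TN_invariant_on_reg :: "(real^2) set \<Rightarrow> chart_map_pred \<Rightarrow> bool" where
  "TN_invariant_on_reg A K \<longleftrightarrow> (\<forall>t\<in>carrier (torus std_lattice). \<forall>v w S \<phi>.
     v extreme_point_of P \<and> w extreme_point_of P \<and> local_lift (act std_lattice t) v w S \<phi> \<and>
     S \<subseteq> V v A \<and> \<xi> ` chart_inv v ` S \<subseteq> X_reg \<longrightarrow> (\<forall>z\<in>S. K v w \<phi> z))"

definition torus_invariant :: "chart_map_pred \<Rightarrow> bool" where
  "torus_invariant K \<longleftrightarrow>
     (\<forall>v. v extreme_point_of P \<longrightarrow> (\<exists>B. open B \<and> v \<in> B \<and>
        (\<forall>t\<in>carrier (torus (Nv v)). \<forall>z\<in>V v B. K v v (rot v t) z))) \<and>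
     TN_invariant_on_reg P K"

definition metric_over :: "(real^2) set \<Rightarrow> metric_family \<Rightarrow> bool" where
  "metric_over A g \<longleftrightarrow>
     (\<forall>v. v extreme_point_of P \<longrightarrow>
        (\<forall>z\<in>V v A. bilinear (g v z) \<and> (\<forall>a b. g v z a b = g v z b a) \<and> (\<forall>a. a \<noteq> 0 \<longrightarrow> g v z a a > 0)) \<and>
        (\<forall>a b. smooth_on (V v A) (\<lambda>z. g v z a b))) \<and>
     chart_compatible A (preserves_metric g)"

definition almost_complex_structure :: "acs_family \<Rightarrow> bool" where
  "almost_complex_structure J \<longleftrightarrow>
     (\<forall>v. v extreme_point_of P \<longrightarrow>
        (\<forall>z\<in>V v P. linear (J v z) \<and> (\<forall>a. J v z (J v z a) = - a)) \<and>
        (\<forall>a. smooth_on (V v P) (\<lambda>z. J v z a))) \<and>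
     chart_compatible P (preserves_acs J)"

definition orthogonal_acs :: "metric_family \<Rightarrow> acs_family \<Rightarrow> bool" where
  "orthogonal_acs g J \<longleftrightarrow> (\<forall>v. v extreme_point_of P \<longrightarrow>
     (\<forall>z\<in>V v P. \<forall>a b. g v z (J v z a) (J v z b) = g v z a b))"

subsection \<open>Metrics that are standard near the vertices\<close>

text \<open>The members of a cover and of a partition of unity are given on \<open>P\<close> and pulled back to the
  orbifold. Smoothness of the pulled back functions is tested in the charts. By uniqueness in
  \<open>adapted_cover\<close> and closedness and local finiteness of the supports, only one term of the glued
  metric survives near a vertex.\<close>

definition adapted_cover :: "(real^2) set set \<Rightarrow> bool" where
  "adapted_cover \<O> \<longleftrightarrow> (\<forall>W\<in>\<O>. openin (top_of_set P) W) \<and> \<Union>\<O> = P \<and>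
     (\<forall>v. v extreme_point_of P \<longrightarrow>
        (\<exists>!W. W \<in> \<O> \<and> (\<exists>B. openin (top_of_set P) B \<and> v \<in> B \<and> B \<subseteq> W)))"

definition partition_of_unity :: "(real^2) set set \<Rightarrow> ((real^2) set \<Rightarrow> real^2 \<Rightarrow> real) \<Rightarrow> bool" where
  "partition_of_unity \<O> \<rho> \<longleftrightarrow>
     (\<forall>W\<in>\<O>. (\<forall>p\<in>P. \<rho> W p \<ge> 0) \<and> closure {p\<in>P. \<rho> W p \<noteq> 0} \<subseteq> W \<and>
        (\<forall>v. v extreme_point_of P \<longrightarrow> smooth_on (V v P) (\<lambda>z. \<rho> W (base (chart_inv v z))))) \<and>
     (\<forall>p\<in>P. \<exists>B. open B \<and> p \<in> B \<and> finite {W\<in>\<O>. \<exists>q\<in>B \<inter> P. \<rho> W q \<noteq> 0}) \<and>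
     (\<forall>p\<in>P. (\<Sum>W\<in>{W\<in>\<O>. \<rho> W p \<noteq> 0}. \<rho> W p) = 1)"

definition glued_metric :: "metric_family \<Rightarrow> bool" where
  "glued_metric \<mu> \<longleftrightarrow> (\<exists>\<O> \<rho> g. adapted_cover \<O> \<and> partition_of_unity \<O> \<rho> \<and>
     (\<forall>W\<in>\<O>. metric_over W (g W) \<and>
        (\<forall>v. v extreme_point_of P \<and> v \<in> W \<longrightarrow>
           W \<subseteq> U v \<and> (\<forall>z\<in>V v W. \<forall>a b. g W v z a b = a \<bullet> b)) \<and>
        ((\<forall>v. v extreme_point_of P \<longrightarrow> v \<notin> W) \<longrightarrow>
           TN_invariant_on_reg W (preserves_metric (g W)))) \<and>
     (\<forall>v. v extreme_point_of P \<longrightarrow> (\<forall>z\<in>V v P. \<forall>a b.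
        \<mu> v z a b = (\<Sum>W\<in>{W\<in>\<O>. \<rho> W (base (chart_inv v z)) \<noteq> 0}.
                       \<rho> W (base (chart_inv v z)) * g W v z a b))))"

end

end

theory Submission
  imports Defs
begin

text \<open>The theorem reduces to the construction of one invariant \<open>2\<close>-form. If \<open>\<omega>\<close> is a nondegenerate
  \<open>2\<close>-form and \<open>A\<close> is the \<open>\<mu>\<close>-skew endomorphism with \<open>\<mu> (A a) b = \<omega> a b\<close>, then the orthogonal factor \<open>J\<close> of
  the polar decomposition of \<open>A\<close> satisfies \<open>J\<^sup>2 = -1\<close> and is \<open>\<mu>\<close>-orthogonal. It depends on the pair \<open>(\<mu>, \<omega>)\<close>
  alone, so every map that preserves both tensors preserves \<open>J\<close> (\<open>polar_part_natural\<close>), and in dimension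
  \<open>4\<close> it is a smooth function of them (\<open>smooth_polar_part\<close>).

  Over the interior of \<open>P\<close>, with base point \<open>p\<close> and angular coordinates \<open>q\<close>, a linear
  map \<open>B p\<close> from the Lie algebra of the torus to the cotangent space of \<open>P\<close> defines a torus invariant
  \<open>2\<close>-form, by pairing \<open>B p (dq)\<close> with \<open>dp\<close>. In the chart at a vertex \<open>u\<close> the
  standard form comes, up to positive factors, from the constant map \<open>B\<^sub>u\<close> that sends the two
  characteristic vectors at \<open>u\<close> to the normals of their edges.
  Let \<open>l\<^sub>E\<close> be an affine function that vanishes on the edge \<open>E\<close> and is positive inside \<open>P\<close>,
  weight \<open>u\<close> by the product of the \<open>l\<^sub>E\<close> over the edges \<open>E\<close> avoiding \<open>u\<close>, and put \<open>B = \<Sum>\<^sub>u weight\<^sub>u B\<^sub>u\<close>.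
  On an edge only its own vertices contribute. The clockwise order of the edges and the positive
  omniorientation give all these contributions the same sign, so that \<open>det B > 0\<close> on the boundary of
  \<open>P\<close> (\<open>interpolant_det_pos\<close>).

  In the interior \<open>det B\<close> may vanish. Adding \<open>K H (dp\<^sub>1 \<and> dp\<^sub>2 - dq\<^sub>1 \<and> dq\<^sub>2)\<close>, with \<open>H\<close> the product of all
  \<open>l\<^sub>E\<close>, changes the Pfaffian to \<open>det B + (K H)\<^sup>2\<close>. Since \<open>H\<close> is positive on the compact set where
  \<open>det B \<le> 0\<close>, a suitable constant \<open>K\<close> makes the form nondegenerate everywhere.

  The form extends smoothly over the points \<open>z\<^sub>i = 0\<close> of the charts, although \<open>dq\<^sub>i\<close> is singular there:
  modulo \<open>l\<^sub>E\<close>, the map \<open>B p\<close> sends the characteristic vector of \<open>E\<close> to a multiple of \<open>dl\<^sub>E\<close>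
  (\<open>interpolant_edge\<close>), and both \<open>dl\<^sub>E \<and> dq\<^sub>i\<close> and \<open>l\<^sub>E dq\<^sub>i\<close> are smooth, because \<open>l\<^sub>E\<close> is a multiple of \<open>\<bar>z\<^sub>i\<bar>\<^sup>2\<close>.
  Chart changes and lifts of torus translations preserve \<open>p\<close> and shift \<open>q\<close> by a constant, so they preserve
  the form where \<open>z\<^sub>1 z\<^sub>2 \<noteq> 0\<close>, and everywhere by continuity (\<open>lift_preserves_chart_form\<close>).\<close>

section \<open>Calculus of smooth maps\<close>

lemma Ck_on_Suc_imp: "Ck_on (Suc n) S f \<Longrightarrow> Ck_on n S f"
proof (induction n arbitrary: f)
  case 0
  then show ?case
    by (simp add: continuous_at_imp_continuous_on differentiable_imp_continuous_within)
next
  case (Suc n)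
  then show ?case by (metis Ck_on.simps(2))
qed

lemma Ck_on_cong:
  assumes "open S" "\<And>x. x \<in> S \<Longrightarrow> f x = g x" "Ck_on n S f"
  shows "Ck_on n S g"
  using assms(2,3)
proof (induction n arbitrary: f g)
  case 0
  then show ?case using continuous_on_cong by fastforce
next
  case (Suc n)
  have D: "(g has_derivative frechet_derivative f (at x)) (at x)" if "x \<in> S" for x
    using Suc.prems that assms(1)
    by (metis Ck_on.simps(2) frechet_derivative_works has_derivative_transform_within_open)
  have "Ck_on n S (\<lambda>x. frechet_derivative g (at x) a)" for a
    by (rule Suc.IH[of "\<lambda>x. frechet_derivative f (at x) a"])
      (use Suc.prems in \<open>auto simp: frechet_derivative_at[OF D, symmetric]\<close>)
  with D show ?case by (auto simp: differentiable_def)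
qed

text \<open>The recursion in \<open>Ck_on\<close> runs through \<open>frechet_derivative\<close>, a choice operator. On an open set any
  derivative that has been computed by hand may be used in its place.\<close>
lemma Ck_on_SucI:
  assumes "open S" "\<And>x. x \<in> S \<Longrightarrow> (f has_derivative f' x) (at x)"
    and "\<And>a. Ck_on n S (\<lambda>x. f' x a)"
  shows "Ck_on (Suc n) S f"
proof -
  have "Ck_on n S (\<lambda>x. frechet_derivative f (at x) a)" for a
    by (rule Ck_on_cong[OF assms(1) _ assms(3)[of a]])
      (simp add: frechet_derivative_at[OF assms(2), symmetric])
  with assms(2) show ?thesis by (auto simp: differentiable_def)
qed

lemma Ck_on_SucD:
  assumes "Ck_on (Suc n) S f"
  shows "\<And>x. x \<in> S \<Longrightarrow> (f has_derivative frechet_derivative f (at x)) (at x)"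
    and "\<And>a. Ck_on n S (\<lambda>x. frechet_derivative f (at x) a)"
  using assms by (auto simp: frechet_derivative_works[symmetric])

lemma Ck_on_const: "open S \<Longrightarrow> Ck_on n S (\<lambda>x. c)"
proof (induction n arbitrary: c)
  case (Suc n)
  show ?case by (rule Ck_on_SucI[where f'="\<lambda>x a. 0"]) (use Suc in auto)
qed auto

lemma Ck_on_linear: "open S \<Longrightarrow> bounded_linear f \<Longrightarrow> Ck_on n S f"
proof (induction n)
  case 0
  then show ?case by (simp add: linear_continuous_on)
next
  case (Suc n)
  show ?case by (rule Ck_on_SucI[where f'="\<lambda>x. f"])
    (use Suc in \<open>auto simp: Ck_on_const bounded_linear_imp_has_derivative\<close>)
qed

lemma Ck_on_add:
  "open S \<Longrightarrow> Ck_on n S f \<Longrightarrow> Ck_on n S g \<Longrightarrow> Ck_on n S (\<lambda>x. f x + g x)"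
proof (induction n arbitrary: f g)
  case 0
  then show ?case by (auto intro: continuous_intros)
next
  case (Suc n)
  show ?case
    by (rule Ck_on_SucI[where f'="\<lambda>x a. frechet_derivative f (at x) a + frechet_derivative g (at x) a"])
      (use Suc Ck_on_SucD[OF Suc.prems(2)] Ck_on_SucD[OF Suc.prems(3)]
        in \<open>auto intro!: derivative_intros\<close>)
qed

lemma Ck_on_bilinear:
  assumes "bounded_bilinear b"
  shows "open S \<Longrightarrow> Ck_on n S f \<Longrightarrow> Ck_on n S g \<Longrightarrow> Ck_on n S (\<lambda>x. b (f x) (g x))"
proof (induction n arbitrary: f g)
  case 0
  then show ?case by (auto intro: bounded_bilinear.continuous_on[OF assms])
next
  case (Suc n)
  show ?case
  proof (rule Ck_on_SucI[where f'="\<lambda>x a. b (f x) (frechet_derivative g (at x) a)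
      + b (frechet_derivative f (at x) a) (g x)"])
    fix x assume "x \<in> S"
    then show "((\<lambda>x. b (f x) (g x)) has_derivative
       (\<lambda>a. b (f x) (frechet_derivative g (at x) a) + b (frechet_derivative f (at x) a) (g x))) (at x)"
      using bounded_bilinear.FDERIV[OF assms] Ck_on_SucD[OF Suc.prems(2)] Ck_on_SucD[OF Suc.prems(3)]
      by blast
  next
    show "Ck_on n S (\<lambda>x. b (f x) (frechet_derivative g (at x) a)
      + b (frechet_derivative f (at x) a) (g x))" for a
      by (intro Ck_on_add Suc.IH Suc.prems Ck_on_Suc_imp[OF Suc.prems(2)]
          Ck_on_Suc_imp[OF Suc.prems(3)] Ck_on_SucD(2)[OF Suc.prems(2)] Ck_on_SucD(2)[OF Suc.prems(3)])
  qed (rule Suc.prems(1))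
qed

lemma Ck_on_inverse:
  fixes f :: "_ \<Rightarrow> real"
  shows "open S \<Longrightarrow> Ck_on n S f \<Longrightarrow> (\<And>x. x \<in> S \<Longrightarrow> f x \<noteq> 0) \<Longrightarrow> Ck_on n S (\<lambda>x. inverse (f x))"
proof (induction n)
  case 0
  then show ?case by (auto intro: continuous_intros)
next
  case (Suc n)
  note D = Ck_on_SucD[OF Suc.prems(2)]
  have I: "Ck_on n S (\<lambda>x. inverse (f x))" using Suc Ck_on_Suc_imp by blast
  show ?case
  proof (rule Ck_on_SucI[where f'="\<lambda>x a. (-1) * (inverse (f x) * frechet_derivative f (at x) a * inverse (f x))"])
    show "((\<lambda>x. inverse (f x)) has_derivative
        (\<lambda>a. (-1) * (inverse (f x) * frechet_derivative f (at x) a * inverse (f x)))) (at x)"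
      if "x \<in> S" for x
      using Deriv.has_derivative_inverse[OF _ D(1)[OF that]] Suc.prems(3)[OF that] by simp
    show "Ck_on n S (\<lambda>x. (-1) * (inverse (f x) * frechet_derivative f (at x) a * inverse (f x)))" for a
      by (intro Ck_on_bilinear[OF bounded_bilinear_mult] Ck_on_const Suc.prems(1) I D(2))
  qed (rule Suc.prems(1))
qed

lemma Ck_on_sqrt:
  fixes f :: "_ \<Rightarrow> real"
  shows "open S \<Longrightarrow> Ck_on n S f \<Longrightarrow> (\<And>x. x \<in> S \<Longrightarrow> f x > 0) \<Longrightarrow> Ck_on n S (\<lambda>x. sqrt (f x))"
proof (induction n)
  case 0
  then show ?case by (simp add: continuous_on_real_sqrt)
next
  case (Suc n)
  note D = Ck_on_SucD[OF Suc.prems(2)]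
  have I: "Ck_on n S (\<lambda>x. inverse (sqrt (f x)))"
  proof (rule Ck_on_inverse[OF Suc.prems(1)])
    show "Ck_on n S (\<lambda>x. sqrt (f x))"
      using Suc.IH[OF Suc.prems(1) Ck_on_Suc_imp[OF Suc.prems(2)]] Suc.prems(3) by blast
  qed (use Suc.prems(3) in force)
  show ?case
  proof (rule Ck_on_SucI[where f'="\<lambda>x a. frechet_derivative f (at x) a * (inverse (sqrt (f x)) * (1/2))"])
    show "((\<lambda>x. sqrt (f x)) has_derivative
        (\<lambda>a. frechet_derivative f (at x) a * (inverse (sqrt (f x)) * (1/2)))) (at x)"
      if "x \<in> S" for x
      using has_derivative_real_sqrt[OF Suc.prems(3)[OF that] D(1)[OF that]]
      by (simp add: field_simps)
    show "Ck_on n S (\<lambda>x. frechet_derivative f (at x) a * (inverse (sqrt (f x)) * (1/2)))" for a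
      by (intro Ck_on_bilinear[OF bounded_bilinear_mult] Ck_on_const Suc.prems(1) I D(2))
  qed (rule Suc.prems(1))
qed

lemma smooth_on_cong:
  "open S \<Longrightarrow> smooth_on S f \<Longrightarrow> (\<And>x. x \<in> S \<Longrightarrow> f x = g x) \<Longrightarrow> smooth_on S g"
  unfolding smooth_on_def by (metis Ck_on_cong)

lemma smooth_on_const: "open S \<Longrightarrow> smooth_on S (\<lambda>x. c)"
  by (simp add: smooth_on_def Ck_on_const)

lemma smooth_on_linear: "open S \<Longrightarrow> bounded_linear f \<Longrightarrow> smooth_on S f"
  by (simp add: smooth_on_def Ck_on_linear)

lemma smooth_on_add: "open S \<Longrightarrow> smooth_on S f \<Longrightarrow> smooth_on S g \<Longrightarrow> smooth_on S (\<lambda>x. f x + g x)"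
  by (simp add: smooth_on_def Ck_on_add)

lemma smooth_on_mult:
  fixes f g :: "_ \<Rightarrow> real"
  shows "open S \<Longrightarrow> smooth_on S f \<Longrightarrow> smooth_on S g \<Longrightarrow> smooth_on S (\<lambda>x. f x * g x)"
  by (simp add: smooth_on_def Ck_on_bilinear[OF bounded_bilinear_mult])

lemma smooth_on_scaleR:
  "open S \<Longrightarrow> smooth_on S f \<Longrightarrow> smooth_on S g \<Longrightarrow> smooth_on S (\<lambda>x. f x *\<^sub>R g x)"
  by (simp add: smooth_on_def Ck_on_bilinear[OF bounded_bilinear_scaleR])

lemma smooth_on_inner:
  "open S \<Longrightarrow> smooth_on S f \<Longrightarrow> smooth_on S g \<Longrightarrow> smooth_on S (\<lambda>x. f x \<bullet> g x)"
  by (simp add: smooth_on_def Ck_on_bilinear[OF bounded_bilinear_inner])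

lemma smooth_on_minus:
  "open S \<Longrightarrow> smooth_on S f \<Longrightarrow> smooth_on S (\<lambda>x. - f x)"
  using smooth_on_scaleR[of S "\<lambda>x. -1" f] by (simp add: smooth_on_const)

lemma smooth_on_diff:
  "open S \<Longrightarrow> smooth_on S f \<Longrightarrow> smooth_on S g \<Longrightarrow> smooth_on S (\<lambda>x. f x - g x)"
  using smooth_on_add[of S f "\<lambda>x. - g x"] by (simp add: smooth_on_minus)

lemma smooth_on_sum:
  "open S \<Longrightarrow> (\<And>i. i \<in> I \<Longrightarrow> smooth_on S (f i)) \<Longrightarrow> smooth_on S (\<lambda>x. \<Sum>i\<in>I. f i x)"
  by (induction I rule: infinite_finite_induct) (auto intro: smooth_on_const smooth_on_add)

lemma smooth_on_prod:
  fixes f :: "_ \<Rightarrow> _ \<Rightarrow> real"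
  shows "open S \<Longrightarrow> (\<And>i. i \<in> I \<Longrightarrow> smooth_on S (f i)) \<Longrightarrow> smooth_on S (\<lambda>x. \<Prod>i\<in>I. f i x)"
  by (induction I rule: infinite_finite_induct) (auto intro: smooth_on_const smooth_on_mult)

lemma smooth_on_divide:
  fixes f g :: "_ \<Rightarrow> real"
  shows "open S \<Longrightarrow> smooth_on S f \<Longrightarrow> smooth_on S g \<Longrightarrow> (\<And>x. x \<in> S \<Longrightarrow> g x \<noteq> 0) \<Longrightarrow>
    smooth_on S (\<lambda>x. f x / g x)"
  unfolding divide_inverse by (rule smooth_on_mult) (auto simp: smooth_on_def Ck_on_inverse)

lemma smooth_on_sqrt:
  fixes f :: "_ \<Rightarrow> real"
  shows "open S \<Longrightarrow> smooth_on S f \<Longrightarrow> (\<And>x. x \<in> S \<Longrightarrow> f x > 0) \<Longrightarrow> smooth_on S (\<lambda>x. sqrt (f x))"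
  by (auto simp: smooth_on_def Ck_on_sqrt)

lemmas smooth_on_intros = smooth_on_const smooth_on_add smooth_on_mult smooth_on_scaleR
  smooth_on_inner smooth_on_minus smooth_on_diff smooth_on_sum smooth_on_prod

lemma smooth_on_imp_continuous_on: "smooth_on S f \<Longrightarrow> continuous_on S f"
  using Ck_on.simps(1) unfolding smooth_on_def by blast

lemma smooth_on_has_derivative:
  "smooth_on S f \<Longrightarrow> x \<in> S \<Longrightarrow> (f has_derivative frechet_derivative f (at x)) (at x)"
  using Ck_on_SucD(1)[of 0 S f x] unfolding smooth_on_def by blast

lemma smooth_on_derivative_continuous:
  "smooth_on S f \<Longrightarrow> continuous_on S (\<lambda>x. frechet_derivative f (at x) a)"
  using Ck_on_SucD(2)[of 0 S f a] unfolding smooth_on_def by (metis Ck_on.simps(1))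

text \<open>Both arguments expand in the basis, which reduces the claim to smoothness of the coefficients of \<open>g\<close>.\<close>
lemma smooth_on_bilinear_apply:
  fixes g :: "'a::euclidean_space \<Rightarrow> 'b::euclidean_space \<Rightarrow> 'b \<Rightarrow> real"
  assumes S: "open S" and bil: "\<And>z. z \<in> S \<Longrightarrow> bilinear (g z)"
    and g: "\<And>a b. smooth_on S (\<lambda>z. g z a b)" and f: "smooth_on S f" "smooth_on S h"
  shows "smooth_on S (\<lambda>z. g z (f z) (h z))"
proof -
  have "smooth_on S (\<lambda>z. \<Sum>i\<in>Basis. \<Sum>j\<in>Basis. (f z \<bullet> i) * (h z \<bullet> j) * g z i j)"
    by (intro smooth_on_intros S g f)
  moreover have "(\<Sum>i\<in>Basis. \<Sum>j\<in>Basis. (f z \<bullet> i) * (h z \<bullet> j) * g z i j) = g z (f z) (h z)"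
    if "z \<in> S" for z
  proof -
    have "g z (f z) (h z) = g z (\<Sum>i\<in>Basis. (f z \<bullet> i) *\<^sub>R i) (\<Sum>j\<in>Basis. (h z \<bullet> j) *\<^sub>R j)"
      by (simp add: euclidean_representation)
    also have "\<dots> = (\<Sum>(i,j)\<in>Basis \<times> Basis. g z ((f z \<bullet> i) *\<^sub>R i) ((h z \<bullet> j) *\<^sub>R j))"
      by (rule bilinear_sum[OF bil[OF that]])
    also have "\<dots> = (\<Sum>i\<in>Basis. \<Sum>j\<in>Basis. (f z \<bullet> i) * (h z \<bullet> j) * g z i j)"
      by (simp add: sum.cartesian_product[symmetric] bilinear_lmul[OF bil[OF that]]
          bilinear_rmul[OF bil[OF that]] mult.assoc mult.left_commute)
    finally show ?thesis by simp
  qed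
  ultimately show ?thesis
    by (rule smooth_on_cong[OF S])
qed

section \<open>The polar part of a nondegenerate 2-form\<close>

definition inner_product_form :: "('a::real_vector \<Rightarrow> 'a \<Rightarrow> real) \<Rightarrow> bool" where
  "inner_product_form g \<longleftrightarrow>
     bilinear g \<and> (\<forall>a b. g a b = g b a) \<and> (\<forall>a. a \<noteq> 0 \<longrightarrow> g a a > 0)"

definition nondegenerate :: "('a::real_vector \<Rightarrow> 'a \<Rightarrow> real) \<Rightarrow> bool" where
  "nondegenerate \<omega> \<longleftrightarrow> (\<forall>a. (\<forall>b. \<omega> a b = 0) \<longrightarrow> a = 0)"

lemma inner_product_formD:
  assumes "inner_product_form g"
  shows "bilinear g" "g a b = g b a" "a \<noteq> 0 \<Longrightarrow> g a a > 0"
    "g (a + a') b = g a b + g a' b" "g (a - a') b = g a b - g a' b" "g (- a) b = - g a b"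
    "g (r *\<^sub>R a) b = r * g a b" "g a (b + b') = g a b + g a b'" "g a (b - b') = g a b - g a b'"
    "g a (- b) = - g a b" "g a (r *\<^sub>R b) = r * g a b" "g 0 b = 0" "g a 0 = 0"
    "g (sum f I) b = (\<Sum>i\<in>I. g (f i) b)" "g a (sum f I) = (\<Sum>i\<in>I. g a (f i))"
proof -
  have b: "bilinear g" using assms by (auto simp: inner_product_form_def)
  then have l: "linear (\<lambda>x. g x b)" "linear (g a)" by (auto simp: bilinear_def)
  show "bilinear g" "g a b = g b a" "a \<noteq> 0 \<Longrightarrow> g a a > 0"
    using assms by (auto simp: inner_product_form_def)
  show "g (a + a') b = g a b + g a' b" "g (a - a') b = g a b - g a' b" "g (- a) b = - g a b"
    "g (r *\<^sub>R a) b = r * g a b" "g a (b + b') = g a b + g a b'" "g a (b - b') = g a b - g a b'"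
    "g a (- b) = - g a b" "g a (r *\<^sub>R b) = r * g a b" "g 0 b = 0" "g a 0 = 0"
    "g (sum f I) b = (\<Sum>i\<in>I. g (f i) b)" "g a (sum f I) = (\<Sum>i\<in>I. g a (f i))"
    using linear_add[OF l(1)] linear_diff[OF l(1)] linear_neg[OF l(1)] linear_scale[OF l(1)]
      linear_add[OF l(2)] linear_diff[OF l(2)] linear_neg[OF l(2)] linear_scale[OF l(2)]
      linear_0[OF l(1)] linear_0[OF l(2)] linear_sum[OF l(1)] linear_sum[OF l(2)]
    by (auto simp: o_def)
qed

lemma inner_product_form_eqI:
  assumes g: "inner_product_form g" and eq: "\<And>b. g a b = g a' b"
  shows "a = a'"
proof (rule ccontr)
  assume "a \<noteq> a'"
  then have "g (a - a') (a - a') > 0" using inner_product_formD(3)[OF g] by simp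
  then show False using eq by (simp add: inner_product_formD(5)[OF g])
qed

definition orthonormal_frame :: "('a::euclidean_space \<Rightarrow> 'a \<Rightarrow> real) \<Rightarrow> (nat \<Rightarrow> 'a) \<Rightarrow> bool" where
  "orthonormal_frame g e \<longleftrightarrow>
     (\<forall>i<DIM('a). \<forall>j<DIM('a). g (e i) (e j) = (if i = j then 1 else 0))"

text \<open>Orthonormal vectors are independent, so \<open>DIM('a)\<close> of them span; the difference of the two sides
  is then orthogonal to everything, in particular to itself.\<close>
lemma orthonormal_frame_expansion:
  fixes e :: "nat \<Rightarrow> 'a::euclidean_space"
  assumes g: "inner_product_form g" and e: "orthonormal_frame g e"
  shows "a = (\<Sum>i<DIM('a). g a (e i) *\<^sub>R e i)"
proof -
  let ?n = "DIM('a)"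
  have on: "g (e i) (e j) = (if i = j then 1 else 0)" if "i < ?n" "j < ?n" for i j
    using e that by (auto simp: orthonormal_frame_def)
  have inj: "inj_on e {..<?n}"
    by (rule inj_onI) (metis lessThan_iff on zero_neq_one)
  have ind: "independent (e ` {..<?n})"
  proof (rule independent_if_scalars_zero)
    fix f x assume 0: "(\<Sum>x\<in>e ` {..<?n}. f x *\<^sub>R x) = 0" and "x \<in> e ` {..<?n}"
    then obtain j where j: "j < ?n" "x = e j" by auto
    have "0 = g (\<Sum>i<?n. f (e i) *\<^sub>R e i) (e j)"
      using 0 by (simp add: sum.reindex[OF inj] inner_product_formD(12)[OF g])
    also have "\<dots> = (\<Sum>i<?n. if i = j then f (e i) else 0)"
      unfolding inner_product_formD(14)[OF g]
      by (rule sum.cong) (auto simp: inner_product_formD[OF g] on j)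
    also have "\<dots> = f x" using j by simp
    finally show "f x = 0" by simp
  qed simp
  have "card (e ` {..<?n}) = ?n" using inj by (simp add: card_image)
  then have span: "span (e ` {..<?n}) = UNIV"
    using ind by (metis dim_UNIV dim_eq_full dim_eq_card_independent)
  define r where "r = a - (\<Sum>i<?n. g a (e i) *\<^sub>R e i)"
  have orth: "g r (e j) = 0" if j: "j < ?n" for j
  proof -
    have "g r (e j) = g a (e j) - (\<Sum>i<?n. if i = j then g a (e i) else 0)"
      unfolding r_def inner_product_formD(5,14)[OF g]
      by (intro arg_cong2[where f="(-)"] refl sum.cong) (auto simp: inner_product_formD[OF g] on j)
    then show ?thesis using j by simp
  qed
  have "subspace {x. g r x = 0}"
    by (auto simp: subspace_def inner_product_formD[OF g])
  moreover have "e ` {..<?n} \<subseteq> {x. g r x = 0}" using orth by auto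
  ultimately have "span (e ` {..<?n}) \<subseteq> {x. g r x = 0}" by (rule span_minimal[rotated])
  then have "g r r = 0" using span by auto
  then have "r = 0" using inner_product_formD(3)[OF g, of r] by force
  then show ?thesis by (simp add: r_def)
qed

text \<open>Gram--Schmidt applied to a fixed basis involves only the coefficients of \<open>g\<close>, sums, products and
  the square root of a positive function, so the resulting frame depends smoothly on the point.\<close>
lemma smooth_orthonormal_frame:
  fixes g :: "'a::euclidean_space \<Rightarrow> 'b::euclidean_space \<Rightarrow> 'b \<Rightarrow> real"
  assumes S: "open S" and g: "\<And>z. z \<in> S \<Longrightarrow> inner_product_form (g z)"
    and sm: "\<And>a b. smooth_on S (\<lambda>z. g z a b)"
  shows "\<exists>e. (\<forall>i<DIM('b). smooth_on S (e i)) \<and> (\<forall>z\<in>S. orthonormal_frame (g z) (\<lambda>i. e i z))"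
proof -
  let ?n = "DIM('b)"
  obtain b where b: "bij_betw b {..<?n} (Basis :: 'b set)"
    using ex_bij_betw_nat_finite[of "Basis :: 'b set"] by (auto simp: atLeast0LessThan)
  have bil: "bilinear (g z)" if "z \<in> S" for z by (rule inner_product_formD(1)[OF g[OF that]])
  have smg: "smooth_on S (\<lambda>z. g z (f z) (h z))" if "smooth_on S f" "smooth_on S h" for f h
    using bil by (rule smooth_on_bilinear_apply[OF S _ sm that])
  have "\<exists>e. (\<forall>i<k. smooth_on S (e i)) \<and>
      (\<forall>z\<in>S. \<forall>i<k. e i z \<in> span (b ` {..<k})) \<and>
      (\<forall>z\<in>S. \<forall>i<k. \<forall>j<k. g z (e i z) (e j z) = (if i = j then 1 else 0))" if "k \<le> ?n" for k
    using that
  proof (induction k)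
    case (Suc k)
    then obtain e where e: "\<And>i. i < k \<Longrightarrow> smooth_on S (e i)"
      and sp: "\<And>z i. z \<in> S \<Longrightarrow> i < k \<Longrightarrow> e i z \<in> span (b ` {..<k})"
      and on: "\<And>z i j. z \<in> S \<Longrightarrow> i < k \<Longrightarrow> j < k \<Longrightarrow> g z (e i z) (e j z) = (if i = j then 1 else 0)"
      by (metis Suc_leD)
    define f where "f z = b k - (\<Sum>i<k. g z (b k) (e i z) *\<^sub>R e i z)" for z
    have sf: "smooth_on S f"
      unfolding f_def by (intro smooth_on_intros S smg e) auto
    have f0: "f z \<noteq> 0" if z: "z \<in> S" for z
    proof
      assume "f z = 0"
      then have "b k = (\<Sum>i<k. g z (b k) (e i z) *\<^sub>R e i z)" by (simp add: f_def)
      also have "\<dots> \<in> span (b ` {..<k})"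
        by (intro span_sum span_scale) (use sp z in auto)
      finally have "b k \<in> span (b ` {..<k})" .
      moreover have "b k \<notin> b ` {..<k}"
        using b Suc.prems inj_onD[of b "{..<?n}" k] by (force simp: bij_betw_def)
      moreover have "insert (b k) (b ` {..<k}) \<subseteq> Basis"
        using b Suc.prems by (auto simp: bij_betw_def)
      ultimately show False
        using independent_Basis independent_insert independent_mono by metis
    qed
    have orth: "g z (f z) (e j z) = 0" if "z \<in> S" "j < k" for z j
    proof -
      have "g z (f z) (e j z) = g z (b k) (e j z) - (\<Sum>i<k. if i = j then g z (b k) (e i z) else 0)"
        unfolding f_def inner_product_formD(5,14)[OF g[OF that(1)]]
        by (intro arg_cong2[where f="(-)"] refl sum.cong) (auto simp: inner_product_formD[OF g[OF that(1)]] on that)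
      then show ?thesis using that by simp
    qed
    define u where "u z = (1 / sqrt (g z (f z) (f z))) *\<^sub>R f z" for z
    have pos: "g z (f z) (f z) > 0" if "z \<in> S" for z
      using inner_product_formD(3)[OF g[OF that] f0[OF that]] .
    have su: "smooth_on S u"
    proof -
      have q: "smooth_on S (\<lambda>z. sqrt (g z (f z) (f z)))"
        using pos by (rule smooth_on_sqrt[OF S smg[OF sf sf]])
      have "sqrt (g z (f z) (f z)) \<noteq> 0" if "z \<in> S" for z using pos[OF that] by simp
      then have "smooth_on S (\<lambda>z. 1 / sqrt (g z (f z) (f z)))"
        by (rule smooth_on_divide[OF S smooth_on_const[OF S] q])
      then show ?thesis unfolding u_def[abs_def] by (rule smooth_on_scaleR[OF S _ sf])
    qed
    have uu: "g z (u z) (u z) = 1" and ue: "\<And>j. j < k \<Longrightarrow> g z (u z) (e j z) = 0"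
      and eu: "\<And>j. j < k \<Longrightarrow> g z (e j z) (u z) = 0" if "z \<in> S" for z
    proof -
      note gs = inner_product_formD(7,11)[OF g[OF that]]
      show "g z (u z) (u z) = 1"
        using pos[OF that] by (simp add: u_def gs flip: real_sqrt_mult)
      show ue: "g z (u z) (e j z) = 0" if "j < k" for j
        using orth[OF \<open>z \<in> S\<close> that] by (simp add: u_def gs)
      show "g z (e j z) (u z) = 0" if "j < k" for j
        using ue[OF that] inner_product_formD(2)[OF g[OF \<open>z \<in> S\<close>]] by metis
    qed
    have spe: "e i z \<in> span (b ` {..<Suc k})" if "z \<in> S" "i < k" for z i
    proof -
      have "span (b ` {..<k}) \<subseteq> span (b ` {..<Suc k})" by (intro span_mono) auto
      then show ?thesis using sp that by blast
    qed
    have spu: "u z \<in> span (b ` {..<Suc k})" if "z \<in> S" for z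
      unfolding u_def f_def
      by (intro span_scale span_diff span_sum) (auto intro: span_base spe that)
    show ?case
      by (rule exI[of _ "e(k := u)"]) (auto simp: less_Suc_eq e su spu spe uu ue eu on)
  qed simp
  from this[OF order_refl] show ?thesis by (auto simp: orthonormal_frame_def)
qed

text \<open>Here \<open>A\<close> is the endomorphism that represents \<open>\<omega>\<close>, and the last equation says
  \<open>N J = A - s A\<inverse>\<close>. In dimension \<open>4\<close> the eigenvalues of \<open>A\<close> are \<open>\<plusminus>i\<alpha>\<close> and \<open>\<plusminus>i\<beta>\<close>, and with
  \<open>s = \<alpha>\<beta>\<close> the map \<open>A - s A\<inverse>\<close> is \<open>\<alpha> + \<beta>\<close> times the orthogonal factor of the polar
  decomposition of \<open>A\<close>. This description involves only \<open>A\<close>, its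
  inverse and two numbers, and avoids the square root of \<open>- A\<^sup>2\<close>.\<close>
definition polar_part :: "('a::real_vector \<Rightarrow> 'a \<Rightarrow> real) \<Rightarrow> ('a \<Rightarrow> 'a \<Rightarrow> real) \<Rightarrow> ('a \<Rightarrow> 'a) \<Rightarrow> bool" where
  "polar_part g \<omega> J \<longleftrightarrow> linear J \<and> (\<forall>a. J (J a) = - a) \<and>
     (\<exists>A s N. linear A \<and> (\<forall>a b. g (A a) b = \<omega> a b) \<and> (\<forall>a. J (A a) = A (J a)) \<and>
        s > 0 \<and> N > 0 \<and> (\<forall>a. A (A a) = N *\<^sub>R J (A a) + s *\<^sub>R a))"

text \<open>Both \<open>J\<close> and \<open>J'\<close> commute with \<open>A\<close>, hence with each other. Eliminating \<open>A\<close> from the two defining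
  equations shows that \<open>J J'\<close> is a negative scalar, and its square is \<open>1\<close>; so \<open>J J' = -1 = J J\<close>.\<close>
lemma polar_part_unique:
  fixes J J' :: "'a::euclidean_space \<Rightarrow> 'a"
  assumes g: "inner_product_form g" and nd: "nondegenerate \<omega>"
    and "polar_part g \<omega> J" "polar_part g \<omega> J'"
  shows "J a = J' a"
proof -
  obtain A s N where J: "linear J" "\<And>a. J (J a) = - a" and A: "linear A" "\<And>a b. g (A a) b = \<omega> a b"
    and JA: "\<And>a. J (A a) = A (J a)" and sN: "s > 0" "N > 0"
    and eq: "\<And>a. A (A a) = N *\<^sub>R J (A a) + s *\<^sub>R a"
    using assms(3) unfolding polar_part_def by metis
  obtain A' s' N' where J': "linear J'" "\<And>a. J' (J' a) = - a" and A': "\<And>a b. g (A' a) b = \<omega> a b"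
    and JA': "\<And>a. J' (A' a) = A' (J' a)" and sN': "s' > 0" "N' > 0"
    and eq': "\<And>a. A' (A' a) = N' *\<^sub>R J' (A' a) + s' *\<^sub>R a"
    using assms(4) unfolding polar_part_def by metis
  have "A' x = A x" for x by (rule inner_product_form_eqI[OF g]) (simp add: A A')
  then have [simp]: "A' = A" by auto
  note J_simps = linear_add[OF J(1)] linear_diff[OF J(1)] linear_scale[OF J(1)] linear_neg[OF J(1)]
    linear_add[OF J'(1)] linear_diff[OF J'(1)] linear_scale[OF J'(1)] linear_neg[OF J'(1)] J(2) J'(2)
  have "inj A"
  proof (subst linear_injective_0[OF A(1)], intro allI impI)
    fix x assume "A x = 0"
    then have "\<omega> x b = 0" for b using A(2)[of x b] by (simp add: inner_product_formD[OF g])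
    then show "x = 0" using nd by (auto simp: nondegenerate_def)
  qed
  then have "surj A" using A(1) linear_injective_imp_surjective by blast
  have com: "J' (J y) = J (J' y)" for y
  proof -
    obtain x where x: "y = A x" using \<open>surj A\<close> by (metis surjD)
    have "N *\<^sub>R J' (J y) = J' (A (A x) - s *\<^sub>R x)" by (simp add: eq x J_simps)
    also have "\<dots> = A (A (J' x)) - s *\<^sub>R J' x" using JA' by (simp add: J_simps)
    also have "\<dots> = N *\<^sub>R J (J' y)" using JA' by (simp add: eq x)
    finally show ?thesis using sN by simp
  qed
  \<comment> \<open>\<open>P\<close> and \<open>Q\<close> are multiples of \<open>A\<inverse>\<close> and \<open>A\<close>; expanding the scalar \<open>P Q\<close> isolates \<open>J J'\<close>\<close>
  have key: "(N * N' * (s + s')) *\<^sub>R J (J' y) = - (((s' - s)\<^sup>2 + s' * N\<^sup>2 + s * N'\<^sup>2) *\<^sub>R y)" for y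
  proof -
    obtain x where x: "y = A x" using \<open>surj A\<close> by (metis surjD)
    define P where "P x = N *\<^sub>R J x - N' *\<^sub>R J' x" for x
    define Q where "Q x = (s' * N) *\<^sub>R J x - (s * N') *\<^sub>R J' x" for x
    have PA: "P (A x) = (s' - s) *\<^sub>R x" for x
      using eq[of x] eq'[of x] by (simp add: P_def scaleR_diff_left algebra_simps)
    have NJ: "N *\<^sub>R J (A x) = A (A x) - s *\<^sub>R x" "N' *\<^sub>R J' (A x) = A (A x) - s' *\<^sub>R x"
      using eq[of x] eq'[of x] by (metis add_diff_cancel_right' \<open>A' = A\<close>)+
    have "Q y = s' *\<^sub>R (N *\<^sub>R J (A x)) - s *\<^sub>R (N' *\<^sub>R J' (A x))" by (simp add: Q_def x)
    also have "\<dots> = s' *\<^sub>R (A (A x) - s *\<^sub>R x) - s *\<^sub>R (A (A x) - s' *\<^sub>R x)"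
      by (simp only: NJ)
    also have "\<dots> = (s' - s) *\<^sub>R A (A x)" by (simp add: algebra_simps)
    finally have Q: "Q y = (s' - s) *\<^sub>R A (A x)" .
    have "P (Q y) = (s' - s) *\<^sub>R P (A (A x))"
      unfolding Q by (simp add: P_def J_simps algebra_simps)
    then have "P (Q y) = (s' - s)\<^sup>2 *\<^sub>R y" by (simp add: PA x power2_eq_square)
    moreover have "P (Q y) = - ((s' * N\<^sup>2 + s * N'\<^sup>2) *\<^sub>R y) - (N * N' * (s + s')) *\<^sub>R J (J' y)"
      by (simp add: P_def Q_def J_simps com power2_eq_square algebra_simps)
    ultimately show ?thesis by (simp add: algebra_simps)
  qed
  define \<kappa> where "\<kappa> = - ((s' - s)\<^sup>2 + s' * N\<^sup>2 + s * N'\<^sup>2) / (N * N' * (s + s'))"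
  have pos: "N * N' * (s + s') > 0" using sN sN' by simp
  have "0 < (s' - s)\<^sup>2 + s' * N\<^sup>2 + s * N'\<^sup>2"
    using sN sN' by (intro add_nonneg_pos add_nonneg_nonneg) auto
  then have "\<kappa> < 0" using pos unfolding \<kappa>_def by (intro divide_neg_pos) auto
  have K: "J (J' y) = \<kappa> *\<^sub>R y" for y
  proof -
    have "(N * N' * (s + s')) *\<^sub>R (J (J' y)) = (N * N' * (s + s')) *\<^sub>R (\<kappa> *\<^sub>R y)"
    proof -
      have "N * N' * (s + s') * \<kappa> = - ((s' - s)\<^sup>2 + s' * N\<^sup>2 + s * N'\<^sup>2)"
        using pos unfolding \<kappa>_def by (metis less_irrefl nonzero_mult_div_cancel_left times_divide_eq_right)
      then show ?thesis unfolding key by (simp only: scaleR_scaleR scaleR_minus_left)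
    qed
    then show ?thesis using pos by (simp only: scaleR_cancel_left) auto
  qed
  show ?thesis
  proof (cases "a = 0")
    case True
    then show ?thesis using J(1) J'(1) by (simp add: linear_0)
  next
    case False
    have "J (J' (J (J' a))) = J (J (J' (J' a)))" by (simp only: com)
    then have "J (J' (J (J' a))) = a" by (simp add: J_simps)
    then have "(\<kappa> * \<kappa>) *\<^sub>R a = 1 *\<^sub>R a" by (simp add: K)
    then have "\<kappa> * \<kappa> = 1" using False by (metis scaleR_cancel_right)
    then have "\<kappa> = -1" using \<open>\<kappa> < 0\<close> by (metis mult_minus1 square_eq_1_iff not_one_less_zero)
    then have "J (J (J' a)) = J (- a)" using K by simp
    then show ?thesis by (simp add: J_simps)
  qed
qed

text \<open>The pull-back of \<open>J'\<close> along the isometry \<open>L\<close> is a polar part of \<open>(g, \<omega>)\<close>, so uniqueness applies.\<close>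
lemma polar_part_natural:
  fixes J :: "'a::euclidean_space \<Rightarrow> 'a" and J' :: "'a \<Rightarrow> 'a"
  assumes g: "inner_product_form g" and nd: "nondegenerate \<omega>"
    and J: "polar_part g \<omega> J" and J': "polar_part g' \<omega>' J'"
    and L: "linear L" "\<And>a b. g' (L a) (L b) = g a b" "\<And>a b. \<omega>' (L a) (L b) = \<omega> a b"
    and g': "inner_product_form g'"
  shows "L (J a) = J' (L a)"
proof -
  have "inj L"
  proof (subst linear_injective_0[OF L(1)], intro allI impI)
    fix x assume "L x = 0"
    then have "g x x = 0" using L(2)[of x x] by (simp add: inner_product_formD[OF g'])
    then show "x = 0" using inner_product_formD(3)[OF g, of x] by force
  qed
  then obtain M where M: "linear M" "\<And>x. M (L x) = x" "\<And>x. L (M x) = x"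
    using linear_injective_isomorphism[OF L(1)] by metis
  obtain A s N where JJ: "linear J'" "\<And>a. J' (J' a) = - a" and A: "linear A" "\<And>a b. g' (A a) b = \<omega>' a b"
    and JA: "\<And>a. J' (A a) = A (J' a)" and sN: "s > 0" "N > 0"
    and eq: "\<And>a. A (A a) = N *\<^sub>R J' (A a) + s *\<^sub>R a"
    using J' unfolding polar_part_def by metis
  note simps = linear_neg[OF M(1)] linear_add[OF M(1)] linear_scale[OF M(1)]
  have "polar_part g \<omega> (\<lambda>a. M (J' (L a)))"
    unfolding polar_part_def
  proof (intro conjI[OF _ conjI])
    show "linear (\<lambda>a. M (J' (L a)))"
      using linear_compose[OF linear_compose[OF L(1) JJ(1)] M(1)] by (simp add: o_def)
    have "linear (\<lambda>a. M (A (L a)))"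
      using linear_compose[OF linear_compose[OF L(1) A(1)] M(1)] by (simp add: o_def)
    moreover have "g (M (A (L a))) b = \<omega> a b" for a b
      using L(2)[of "M (A (L a))" b] by (simp add: M A L)
    moreover have "M (A (L (M (A (L a))))) = N *\<^sub>R M (J' (L (M (A (L a))))) + s *\<^sub>R a" for a
      using eq[of "L a"] by (simp add: M simps)
    ultimately show "\<exists>A s N. linear A \<and> (\<forall>a b. g (A a) b = \<omega> a b) \<and>
        (\<forall>a. M (J' (L (A a))) = A (M (J' (L a)))) \<and> s > 0 \<and> N > 0 \<and>
        (\<forall>a. A (A a) = N *\<^sub>R M (J' (L (A a))) + s *\<^sub>R a)"
      using sN by (intro exI[of _ "\<lambda>a. M (A (L a))"] exI[of _ s] exI[of _ N]) (simp add: M JA)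
  qed (simp add: M JJ simps)
  then have "J a = M (J' (L a))" by (rule polar_part_unique[OF g nd J])
  then show ?thesis by (simp add: M)
qed

text \<open>\<open>B = N J A = A\<^sup>2 - s\<close> is symmetric, since \<open>A\<close> is skew, and \<open>B\<^sup>2 = - N\<^sup>2 A\<^sup>2\<close>. Thus
  \<open>N\<^sup>2 g (J A x) (J A y) = g (B x) (B y) = g x (B\<^sup>2 y) = N\<^sup>2 g (A x) (A y)\<close>, and \<open>A\<close> is onto.\<close>
lemma polar_part_orthogonal:
  fixes J :: "'a::euclidean_space \<Rightarrow> 'a"
  assumes g: "inner_product_form g" and nd: "nondegenerate \<omega>"
    and sk: "\<And>a b. \<omega> a b = - \<omega> b a" and J: "polar_part g \<omega> J"
  shows "g (J a) (J b) = g a b"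
proof -
  obtain A s N where J: "linear J" "\<And>a. J (J a) = - a" and A: "linear A" "\<And>a b. g (A a) b = \<omega> a b"
    and JA: "\<And>a. J (A a) = A (J a)" and sN: "s > 0" "N > 0"
    and eq: "\<And>a. A (A a) = N *\<^sub>R J (A a) + s *\<^sub>R a"
    using J unfolding polar_part_def by metis
  have skA: "g (A x) y = - g x (A y)" for x y
    using sk A(2) inner_product_formD(2)[OF g] by metis
  have "inj A"
  proof (subst linear_injective_0[OF A(1)], intro allI impI)
    fix x assume "A x = 0"
    then have "\<omega> x b = 0" for b using A(2)[of x b] by (simp add: inner_product_formD[OF g])
    then show "x = 0" using nd by (auto simp: nondegenerate_def)
  qed
  then have "surj A" using A(1) linear_injective_imp_surjective by blast
  then obtain x y where xy: "a = A x" "b = A y" by (metis surjD)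
  define B where "B x = A (A x) - s *\<^sub>R x" for x
  have B: "B x = N *\<^sub>R J (A x)" for x by (simp add: B_def eq)
  have symB: "g (B x) y = g x (B y)" for x y
    by (simp add: B_def inner_product_formD(4-15)[OF g] skA)
  have "N\<^sup>2 * g (J a) (J b) = g (B x) (B y)"
    by (simp add: B xy inner_product_formD(7,11)[OF g] power2_eq_square)
  also have "\<dots> = g x (B (B y))" by (rule symB)
  also have "B (B y) = - (N\<^sup>2 *\<^sub>R A (A y))"
    by (simp add: B linear_scale[OF J(1)] linear_scale[OF A(1)] JA J power2_eq_square
        linear_neg[OF A(1)])
  also have "g x \<dots> = N\<^sup>2 * g a b" by (simp add: xy inner_product_formD(10,11)[OF g] skA)
  finally show ?thesis using sN by simp
qed

text \<open>In an orthonormal frame \<open>- pf A\<inverse>\<close>, with \<open>pf\<close> the Pfaffian of \<open>\<omega>\<close>, is the matrix of the Hodge dual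
  of \<open>\<omega>\<close>. With \<open>s = \<bar>pf\<bar>\<close> the map \<open>A - s A\<inverse>\<close> is therefore the self-dual or the anti-self-dual part
  of \<open>\<omega>\<close>, according to the sign \<open>\<epsilon>\<close> of \<open>pf\<close>: it has the three coefficients \<open>u1, u2, u3\<close>, and its square is
  the scalar \<open>- (u1\<^sup>2 + u2\<^sup>2 + u3\<^sup>2)\<close>.\<close>
lemma smooth_polar_part:
  fixes g \<omega> :: "'a::euclidean_space \<Rightarrow> 'b::euclidean_space \<Rightarrow> 'b \<Rightarrow> real"
  assumes S: "open S" and dim: "DIM('b) = 4"
    and g: "\<And>z. z \<in> S \<Longrightarrow> inner_product_form (g z)"
    and smg: "\<And>a b. smooth_on S (\<lambda>z. g z a b)"
    and bil: "\<And>z. z \<in> S \<Longrightarrow> bilinear (\<omega> z)"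
    and sk: "\<And>z a b. z \<in> S \<Longrightarrow> \<omega> z a b = - \<omega> z b a"
    and nd: "\<And>z. z \<in> S \<Longrightarrow> nondegenerate (\<omega> z)"
    and smw: "\<And>a b. smooth_on S (\<lambda>z. \<omega> z a b)"
  shows "\<exists>J. (\<forall>z\<in>S. polar_part (g z) (\<omega> z) (J z)) \<and> (\<forall>a. smooth_on S (\<lambda>z. J z a))"
proof -
  have sum4: "(\<Sum>i<4. f i) = f 0 + f 1 + f 2 + f 3" for f :: "nat \<Rightarrow> 'b"
    by (simp add: eval_nat_numeral)
  note One_nat_def [simp del]
  obtain e where e: "\<And>i. i < 4 \<Longrightarrow> smooth_on S (e i)"
    and on: "\<And>z. z \<in> S \<Longrightarrow> orthonormal_frame (g z) (\<lambda>i. e i z)"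
    using smooth_orthonormal_frame[OF S g smg] dim by metis
  have bilg: "bilinear (g z)" if "z \<in> S" for z by (rule inner_product_formD(1)[OF g[OF that]])
  have sgg: "smooth_on S (\<lambda>z. g z (f z) (h z))" if "smooth_on S f" "smooth_on S h" for f h
    using bilg by (rule smooth_on_bilinear_apply[OF S _ smg that])
  have sww: "smooth_on S (\<lambda>z. \<omega> z (f z) (h z))" if "smooth_on S f" "smooth_on S h" for f h
    using bil by (rule smooth_on_bilinear_apply[OF S _ smw that])
  define w where "w i j z = \<omega> z (e i z) (e j z)" for i j z
  have sw: "smooth_on S (w i j)" if "i < 4" "j < 4" for i j
    unfolding w_def[abs_def] by (intro sww e that)
  define pf where "pf z = w 0 1 z * w 2 3 z - w 0 2 z * w 1 3 z + w 0 3 z * w 1 2 z" for z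
  define \<epsilon> where "\<epsilon> z = pf z / sqrt (pf z * pf z)" for z
  define u1 where "u1 z = w 0 1 z + \<epsilon> z * w 2 3 z" for z
  define u2 where "u2 z = w 0 2 z - \<epsilon> z * w 1 3 z" for z
  define u3 where "u3 z = w 0 3 z + \<epsilon> z * w 1 2 z" for z
  define N where "N z = sqrt (u1 z * u1 z + u2 z * u2 z + u3 z * u3 z)" for z
  define x where "x i a z = g z a (e i z)" for i a z
  define J1 where "J1 z a =
      (- u1 z * x 1 a z - u2 z * x 2 a z - u3 z * x 3 a z) *\<^sub>R e 0 z +
      (u1 z * x 0 a z - \<epsilon> z * u3 z * x 2 a z + \<epsilon> z * u2 z * x 3 a z) *\<^sub>R e 1 z +
      (u2 z * x 0 a z + \<epsilon> z * u3 z * x 1 a z - \<epsilon> z * u1 z * x 3 a z) *\<^sub>R e 2 z +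
      (u3 z * x 0 a z - \<epsilon> z * u2 z * x 1 a z + \<epsilon> z * u1 z * x 2 a z) *\<^sub>R e 3 z" for z a
  define J where "J z a = (1 / N z) *\<^sub>R J1 z a" for z a
  define A where "A z a = \<omega> z a (e 0 z) *\<^sub>R e 0 z + \<omega> z a (e 1 z) *\<^sub>R e 1 z
      + \<omega> z a (e 2 z) *\<^sub>R e 2 z + \<omega> z a (e 3 z) *\<^sub>R e 3 z" for z a
  have pt: "pf z \<noteq> 0 \<and> N z > 0 \<and> u1 z * u1 z + u2 z * u2 z + u3 z * u3 z > 0 \<and>
      polar_part (g z) (\<omega> z) (J z)" if z: "z \<in> S" for z
  proof -
    note gs = inner_product_formD[OF g[OF z]]
    have ee: "g z (e i z) (e j z) = (if i = j then 1 else 0)" if "i < 4" "j < 4" for i j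
      using on[OF z] that dim by (auto simp: orthonormal_frame_def)
    have ex: "a = x 0 a z *\<^sub>R e 0 z + x 1 a z *\<^sub>R e 1 z + x 2 a z *\<^sub>R e 2 z + x 3 a z *\<^sub>R e 3 z" for a
      using orthonormal_frame_expansion[OF g[OF z] on[OF z], of a]
      unfolding dim sum4 x_def .
    have eqI: "a = b" if "x 0 a z = x 0 b z" "x 1 a z = x 1 b z" "x 2 a z = x 2 b z" "x 3 a z = x 3 b z" for a b
      using ex[of a] ex[of b] that by simp
    have xs: "x i (a + b) z = x i a z + x i b z" "x i (r *\<^sub>R a) z = r * x i a z"
      "x i (- a) z = - x i a z" for i a b r
      by (simp_all add: x_def gs)
    have xe: "x i (e j z) z = (if i = j then 1 else 0)" if "i < 4" "j < 4" for i j
      using ee that by (auto simp: x_def)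
    have lw: "linear (\<lambda>a. \<omega> z a b)" "linear (\<lambda>b. \<omega> z a b)" for a b
      using bil[OF z] by (auto simp: bilinear_def)
    note ws = linear_add[OF lw(1)] linear_add[OF lw(2)] linear_scale[OF lw(1)] linear_scale[OF lw(2)]
    have skw: "w i j z = - w j i z" for i j unfolding w_def by (rule sk[OF z])
    have w0: "w i i z = 0" for i using skw[of i i] by simp
    note w_simps = skw[of 1 0] skw[of 2 0] skw[of 3 0] skw[of 2 1] skw[of 3 1] skw[of 3 2] w0
    have we: "\<omega> z a (e i z) = x 0 a z * w 0 i z + x 1 a z * w 1 i z + x 2 a z * w 2 i z + x 3 a z * w 3 i z" for a i
      by (subst ex[of a]) (simp add: ws w_def)
    have wnd: "a = 0" if "\<And>i. i < 4 \<Longrightarrow> \<omega> z a (e i z) = 0" for a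
    proof -
      have "\<omega> z a b = 0" for b
        by (subst ex[of b]) (simp add: ws that)
      then show ?thesis using nd[OF z] by (auto simp: nondegenerate_def)
    qed
    have wnd': "c0 = 0 \<and> c1 = 0 \<and> c2 = 0 \<and> c3 = 0"
      if c: "c1 * w 0 1 z + c2 * w 0 2 z + c3 * w 0 3 z = 0" "c0 * w 0 1 z - c2 * w 1 2 z - c3 * w 1 3 z = 0"
        "c0 * w 0 2 z + c1 * w 1 2 z - c3 * w 2 3 z = 0" "c0 * w 0 3 z + c1 * w 1 3 z + c2 * w 2 3 z = 0"
      for c0 c1 c2 c3
    proof -
      let ?a = "c0 *\<^sub>R e 0 z + c1 *\<^sub>R e 1 z + c2 *\<^sub>R e 2 z + c3 *\<^sub>R e 3 z"
      have x: "x 0 ?a z = c0" "x 1 ?a z = c1" "x 2 ?a z = c2" "x 3 ?a z = c3" by (auto simp: xs xe)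
      have "\<omega> z ?a (e i z) = 0" if "i < 4" for i
      proof -
        have "i = 0 \<or> i = 1 \<or> i = 2 \<or> i = 3" using that by auto
        then show ?thesis unfolding we x using c by (auto simp: w_simps)
      qed
      then have "?a = 0" by (rule wnd)
      then have "x i ?a z = 0" for i by (simp add: x_def gs)
      with x show ?thesis by metis
    qed
    \<comment> \<open>the vectors are columns of the matrix of the Hodge dual, whose product with that of \<open>\<omega>\<close> is a multiple of \<open>pf z\<close>\<close>
    have pf0: "pf z \<noteq> 0"
    proof
      assume pf: "pf z = 0"
      have "w 2 3 z = 0 \<and> w 1 3 z = 0 \<and> w 1 2 z = 0"
        using wnd'[of "w 2 3 z" "- w 1 3 z" "w 1 2 z" 0] pf
        by (simp add: pf_def algebra_simps)
      moreover have "w 2 3 z = 0 \<and> w 0 3 z = 0 \<and> w 0 2 z = 0"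
        using wnd'[of 0 "- w 0 3 z" "w 0 2 z" "w 2 3 z"] pf
        by (simp add: pf_def algebra_simps)
      moreover have "w 1 3 z = 0 \<and> w 0 3 z = 0 \<and> w 0 1 z = 0"
        using wnd'[of "- w 0 3 z" 0 "w 0 1 z" "w 1 3 z"] pf
        by (simp add: pf_def algebra_simps)
      ultimately show False
        using wnd'[of 0 0 0 1] by simp
    qed
    have \<epsilon>2: "\<epsilon> z * \<epsilon> z = 1" using pf0 by (simp add: \<epsilon>_def)
    have \<epsilon>pf: "\<epsilon> z * pf z > 0" using pf0 by (simp add: \<epsilon>_def) (auto simp: zero_less_mult_iff not_less linorder_neq_iff abs_real_def)
    have uu: "u1 z * u1 z + u2 z * u2 z + u3 z * u3 z = (w 0 1 z)\<^sup>2 + (w 0 2 z)\<^sup>2 + (w 0 3 z)\<^sup>2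
        + (\<epsilon> z * \<epsilon> z) * ((w 1 2 z)\<^sup>2 + (w 1 3 z)\<^sup>2 + (w 2 3 z)\<^sup>2) + 2 * (\<epsilon> z * pf z)"
      by (simp add: u1_def u2_def u3_def pf_def power2_eq_square algebra_simps)
    have upos: "u1 z * u1 z + u2 z * u2 z + u3 z * u3 z > 0"
      unfolding uu \<epsilon>2 using \<epsilon>pf by (smt (verit) zero_le_power2 mult_1)
    then have Npos: "N z > 0" by (simp add: N_def)
    have N2: "N z * N z = u1 z * u1 z + u2 z * u2 z + u3 z * u3 z" using upos by (simp add: N_def)
    have xJ: "x 0 (J1 z a) z = - u1 z * x 1 a z - u2 z * x 2 a z - u3 z * x 3 a z"
      "x 1 (J1 z a) z = u1 z * x 0 a z - \<epsilon> z * u3 z * x 2 a z + \<epsilon> z * u2 z * x 3 a z"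
      "x 2 (J1 z a) z = u2 z * x 0 a z + \<epsilon> z * u3 z * x 1 a z - \<epsilon> z * u1 z * x 3 a z"
      "x 3 (J1 z a) z = u3 z * x 0 a z - \<epsilon> z * u2 z * x 1 a z + \<epsilon> z * u1 z * x 2 a z" for a
      unfolding J1_def xs by (simp_all add: xe)
    have xA: "x 0 (A z a) z = - w 0 1 z * x 1 a z - w 0 2 z * x 2 a z - w 0 3 z * x 3 a z"
      "x 1 (A z a) z = w 0 1 z * x 0 a z - w 1 2 z * x 2 a z - w 1 3 z * x 3 a z"
      "x 2 (A z a) z = w 0 2 z * x 0 a z + w 1 2 z * x 1 a z - w 2 3 z * x 3 a z"
      "x 3 (A z a) z = w 0 3 z * x 0 a z + w 1 3 z * x 1 a z + w 2 3 z * x 2 a z" for a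
      unfolding A_def xs we by (simp_all add: xe w_simps)
    have lJ1: "linear (J1 z)"
      unfolding J1_def[abs_def] by (rule linearI) (simp_all add: xs algebra_simps)
    then have lJ: "linear (J z)" unfolding J_def[abs_def] by (rule linear_compose_scale_right)
    have lA: "linear (A z)"
      unfolding A_def[abs_def] by (rule linearI) (simp_all add: ws algebra_simps)
    have gA: "g z (A z a) b = \<omega> z a b" for a b
    proof -
      have "g z (A z a) b = \<omega> z a (e 0 z) * x 0 b z + \<omega> z a (e 1 z) * x 1 b z
          + \<omega> z a (e 2 z) * x 2 b z + \<omega> z a (e 3 z) * x 3 b z"
        by (simp add: A_def gs(4,7) x_def gs(2)[of b])
      also have "\<dots> = \<omega> z a b" by (subst (5) ex[of b]) (simp add: ws)
      finally show ?thesis .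
    qed
    have \<epsilon>2': "\<epsilon> z * (\<epsilon> z * p) = p" for p using \<epsilon>2 by (metis mult.assoc mult_1)
    let ?n = "u1 z * u1 z + u2 z * u2 z + u3 z * u3 z"
    have J1J1: "J1 z (J1 z a) = - (?n *\<^sub>R a)" for a
      by (rule eqI; unfold xs xJ; simp add: algebra_simps \<epsilon>2')
    have JJ: "J z (J z a) = - a" for a
    proof -
      have "J z (J z a) = - ((?n / (N z * N z)) *\<^sub>R a)"
        by (simp add: J_def linear_scale[OF lJ1] J1J1)
      then show ?thesis using upos by (simp add: N2)
    qed
    have J1A: "J1 z (A z a) = A z (J1 z a)" for a
    proof (rule eqI)
      show "x 0 (J1 z (A z a)) z = x 0 (A z (J1 z a)) z"
        unfolding xJ xA u1_def u2_def u3_def by (simp add: algebra_simps \<epsilon>2')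
      show "x 1 (J1 z (A z a)) z = x 1 (A z (J1 z a)) z"
        unfolding xJ xA u1_def u2_def u3_def by (simp add: algebra_simps \<epsilon>2')
      show "x 2 (J1 z (A z a)) z = x 2 (A z (J1 z a)) z"
        unfolding xJ xA u1_def u2_def u3_def by (simp add: algebra_simps \<epsilon>2')
      show "x 3 (J1 z (A z a)) z = x 3 (A z (J1 z a)) z"
        unfolding xJ xA u1_def u2_def u3_def by (simp add: algebra_simps \<epsilon>2')
    qed
    have JA: "J z (A z a) = A z (J z a)" for a
      by (simp add: J_def J1A linear_scale[OF lA])
    have "A z (A z a) = J1 z (A z a) + (\<epsilon> z * pf z) *\<^sub>R a" for a
      by (rule eqI; unfold xs xJ xA; unfold u1_def u2_def u3_def pf_def; simp add: algebra_simps \<epsilon>2')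
    then have AA: "A z (A z a) = N z *\<^sub>R J z (A z a) + (\<epsilon> z * pf z) *\<^sub>R a" for a
      using Npos by (simp add: J_def)
    have "polar_part (g z) (\<omega> z) (J z)"
      unfolding polar_part_def
    proof (intro conjI[OF lJ conjI] allI JJ)
      show "\<exists>A s N. linear A \<and> (\<forall>a b. g z (A a) b = \<omega> z a b) \<and> (\<forall>a. J z (A a) = A (J z a)) \<and>
          s > 0 \<and> N > 0 \<and> (\<forall>a. A (A a) = N *\<^sub>R J z (A a) + s *\<^sub>R a)"
        using lA gA JA \<epsilon>pf Npos AA by metis
    qed
    with pf0 Npos upos show ?thesis by blast
  qed
  have sx: "smooth_on S (x i a)" if "i < 4" for i a
    unfolding x_def[abs_def] by (intro sgg e that smooth_on_const S)
  have spf: "smooth_on S pf"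
    unfolding pf_def[abs_def] by (intro smooth_on_intros S sw) auto
  have pfpos: "pf z * pf z > 0" "sqrt (pf z * pf z) \<noteq> 0" if "z \<in> S" for z
    using pt[OF that] by (auto simp: zero_less_mult_iff linorder_neq_iff)
  have s\<epsilon>: "smooth_on S \<epsilon>"
    unfolding \<epsilon>_def[abs_def]
    by (rule smooth_on_divide[OF S spf smooth_on_sqrt[OF S smooth_on_mult[OF S spf spf]]])
      (simp_all add: pfpos pt)
  have su: "smooth_on S u1" "smooth_on S u2" "smooth_on S u3"
    unfolding u1_def[abs_def] u2_def[abs_def] u3_def[abs_def]
    by (intro smooth_on_intros S sw s\<epsilon>; simp)+
  have sN: "smooth_on S N"
    unfolding N_def[abs_def]
  proof (rule smooth_on_sqrt[OF S])
    show "smooth_on S (\<lambda>z. u1 z * u1 z + u2 z * u2 z + u3 z * u3 z)"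
      by (intro smooth_on_intros S su)
  qed (use pt in blast)
  have N0: "N z \<noteq> 0" if "z \<in> S" for z using pt[OF that] by auto
  have "smooth_on S (\<lambda>z. J z a)" for a
    unfolding J_def J1_def
  proof (rule smooth_on_scaleR[OF S])
    show "smooth_on S (\<lambda>z. 1 / N z)"
      using N0 by (rule smooth_on_divide[OF S smooth_on_const[OF S] sN])
  qed (intro smooth_on_intros S su sx s\<epsilon> e; simp)
  with pt show ?thesis by blast
qed

section \<open>Edges and vertices of the polygon\<close>

definition cross2 :: "real^2 \<Rightarrow> real^2 \<Rightarrow> real" where
  "cross2 x y = x $ 1 * y $ 2 - x $ 2 * y $ 1"

lemma det_eq_cross2: "det (vector [x, y] :: real^2^2) = cross2 x y"
  by (simp add: det_2 cross2_def)

lemma cross2_simps: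
  "cross2 (x + x') y = cross2 x y + cross2 x' y" "cross2 (x - x') y = cross2 x y - cross2 x' y"
  "cross2 x (y + y') = cross2 x y + cross2 x y'" "cross2 x (y - y') = cross2 x y - cross2 x y'"
  "cross2 (r *\<^sub>R x) y = r * cross2 x y" "cross2 x (r *\<^sub>R y) = r * cross2 x y"
  "cross2 (- x) y = - cross2 x y" "cross2 x (- y) = - cross2 x y" "cross2 x x = 0"
  "cross2 0 y = 0" "cross2 x 0 = 0"
  by (auto simp: cross2_def algebra_simps)

lemma cross2_commute: "cross2 x y = - cross2 y x"
  by (simp add: cross2_def)

text \<open>Used to read off the sign of a determinant of edge directions from that of the normals.\<close>
lemma cross2_Binet_Cauchy:
  "cross2 a b * cross2 c d = (a \<bullet> c) * (b \<bullet> d) - (a \<bullet> d) * (b \<bullet> c)"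
  by (simp add: cross2_def inner_vec_def sum_2 algebra_simps)

lemma cross2_Cramer: "cross2 a b *\<^sub>R c = cross2 c b *\<^sub>R a + cross2 a c *\<^sub>R b"
  unfolding vec_eq_iff forall_2 by (simp add: cross2_def) algebra

lemma cross2_inner_Cramer:
  "cross2 a b * (c \<bullet> x) = cross2 c b * (a \<bullet> x) + cross2 a c * (b \<bullet> x)"
  using arg_cong[OF cross2_Cramer[of a b c], of "\<lambda>v. v \<bullet> x"] by (simp add: inner_add_left)

lemma independent_imp_cross2_neq_0:
  assumes "independent {a, b}" "a \<noteq> b"
  shows "cross2 a b \<noteq> 0"
proof
  assume 0: "cross2 a b = 0"
  have b: "b \<noteq> 0" using assms dependent_zero by blast
  then have bb: "b \<bullet> b \<noteq> 0" by simp
  have e: "(b \<bullet> b) *\<^sub>R a = (a \<bullet> b) *\<^sub>R b"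
    using 0 unfolding vec_eq_iff forall_2 by (simp add: cross2_def inner_vec_def sum_2) algebra
  have "a = (1 / (b \<bullet> b)) *\<^sub>R ((b \<bullet> b) *\<^sub>R a)" using bb by simp
  then have "a = ((a \<bullet> b) / (b \<bullet> b)) *\<^sub>R b" unfolding e by simp
  then have "a \<in> span {b}" by (metis span_base singletonI span_scale)
  then show False using assms by (simp add: independent_insert)
qed

context primitive_quasitoric
begin

lemma convex_P: "convex P" using polytope polytope_imp_convex by blast

lemma polyhedron_P: "polyhedron P" using polytope polytope_imp_polyhedron by blast

lemma rel_interior_P: "rel_interior P = interior P"
  using dim2 by (intro rel_interior_interior) (simp flip: aff_dim_eq_full)

lemma interior_nonempty: "interior P \<noteq> {}"
proof -
  have "P \<noteq> {}" using dim2 by auto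
  then show ?thesis using rel_interior_eq_empty[OF convex_P] rel_interior_P by simp
qed

lemma edge_iff_facet: "E edge_of P \<longleftrightarrow> E facet_of P"
  using dim2 by (auto simp: edge_of_def facet_of_def)

lemma finite_edges: "finite {E. E edge_of P \<and> Q E}"
  by (rule finite_subset[OF _ finite_polytope_faces[OF polytope]]) (auto simp: edge_of_def)

text \<open>A normal \<open>n\<close> and an offset \<open>c\<close> such that \<open>n \<bullet> p - c\<close> vanishes on \<open>E\<close> and is nonnegative on \<open>P\<close>. The
  functions \<open>h v E\<close> depend on the vertex; one function for each edge is needed to
  compare different vertices.\<close>
definition edge_data :: "(real^2) set \<Rightarrow> (real^2) \<times> real" where
  "edge_data E = (SOME (n, c). n \<noteq> 0 \<and> P \<subseteq> {p. n \<bullet> p \<ge> c} \<and> E = P \<inter> {p. n \<bullet> p = c})"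

definition edge_normal :: "(real^2) set \<Rightarrow> real^2" where "edge_normal E = fst (edge_data E)"

definition edge_fun :: "(real^2) set \<Rightarrow> real^2 \<Rightarrow> real" where
  "edge_fun E p = edge_normal E \<bullet> p - snd (edge_data E)"

lemma edge_fun_props:
  assumes "E edge_of P"
  shows edge_fun_nonneg: "p \<in> P \<Longrightarrow> edge_fun E p \<ge> 0"
    and edge_fun_eq_0_iff: "p \<in> P \<Longrightarrow> edge_fun E p = 0 \<longleftrightarrow> p \<in> E"
proof -
  obtain a b where ab: "a \<noteq> 0" "P \<subseteq> {x. a \<bullet> x \<le> b}" "E = P \<inter> {x. a \<bullet> x = b}"
    using facet_of_polyhedron[OF polyhedron_P] assms by (auto simp: edge_iff_facet)
  have "case (- a, - b) of (n, c) \<Rightarrow>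
      n \<noteq> 0 \<and> P \<subseteq> {p. n \<bullet> p \<ge> c} \<and> E = P \<inter> {p. n \<bullet> p = c}"
    using ab by auto
  then have *: "case edge_data E of (n, c) \<Rightarrow>
      n \<noteq> 0 \<and> P \<subseteq> {p. n \<bullet> p \<ge> c} \<and> E = P \<inter> {p. n \<bullet> p = c}"
    unfolding edge_data_def by (rule someI)
  show "p \<in> P \<Longrightarrow> edge_fun E p \<ge> 0" "p \<in> P \<Longrightarrow> edge_fun E p = 0 \<longleftrightarrow> p \<in> E"
    using * by (auto simp: edge_normal_def edge_fun_def split: prod.splits)
qed

lemma edge_fun_affine: "edge_fun E p = edge_fun E q + edge_normal E \<bullet> (p - q)"
  by (simp add: edge_fun_def inner_diff_right)

lemma edge_subset: "E edge_of P \<Longrightarrow> E \<subseteq> P"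
  by (auto simp: edge_of_def dest: face_of_imp_subset)

lemma edge_nonempty: "E edge_of P \<Longrightarrow> E \<noteq> {}"
  by (auto simp: edge_of_def)

lemma edge_fun_pos_interior:
  assumes "E edge_of P" "p \<in> interior P"
  shows "edge_fun E p > 0"
proof -
  have "E face_of P" "E \<noteq> P" using assms dim2 by (auto simp: edge_of_def)
  then have "p \<notin> E"
    using face_of_disjoint_rel_interior assms(2) rel_interior_P by blast
  then show ?thesis
    using edge_fun_nonneg[OF assms(1)] edge_fun_eq_0_iff[OF assms(1)] assms(2) interior_subset
    by (metis less_eq_real_def subsetD)
qed

lemma interiorI:
  assumes "p \<in> P" "\<And>E. E edge_of P \<Longrightarrow> edge_fun E p > 0"
  shows "p \<in> interior P"
proof (rule ccontr)
  assume "p \<notin> interior P"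
  then obtain E where "E facet_of P" "p \<in> E"
    using rel_boundary_of_polyhedron[OF polyhedron_P] assms(1) rel_interior_P by blast
  then show False using assms edge_fun_eq_0_iff[of E p] edge_iff_facet by (metis less_irrefl)
qed

lemma not_interior_edge:
  assumes "p \<in> P" "p \<notin> interior P"
  obtains E where "E edge_of P" "p \<in> E"
  using interiorI assms edge_fun_nonneg edge_fun_eq_0_iff by (metis less_eq_real_def)

text \<open>A segment from an interior point to a point outside \<open>P\<close> leaves \<open>P\<close> through some edge, and the affine
  function of that edge is negative beyond the crossing.\<close>
lemma mem_P_iff: "p \<in> P \<longleftrightarrow> (\<forall>E. E edge_of P \<longrightarrow> edge_fun E p \<ge> 0)"
proof
  assume nn: "\<forall>E. E edge_of P \<longrightarrow> edge_fun E p \<ge> 0"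
  show "p \<in> P"
  proof (rule ccontr)
    assume p: "p \<notin> P"
    obtain c where c: "c \<in> interior P" using interior_nonempty by auto
    then have "c \<in> P" using interior_subset by blast
    have "connected (closed_segment c p)" by simp
    moreover have "closed_segment c p \<inter> P \<noteq> {}" "closed_segment c p - P \<noteq> {}"
      using \<open>c \<in> P\<close> p by auto
    ultimately obtain y where y: "y \<in> closed_segment c p" "y \<in> frontier P"
      using connected_Int_frontier by blast
    have "closed P" using polytope polytope_imp_closed by blast
    then have "y \<in> P" "y \<notin> interior P" using y by (auto simp: frontier_def)
    then obtain E where E: "E edge_of P" "y \<in> E" by (rule not_interior_edge)
    have ey: "edge_fun E y = 0" using E \<open>y \<in> P\<close> edge_fun_eq_0_iff by blast
    obtain u where u: "0 \<le> u" "u \<le> 1" "y = (1 - u) *\<^sub>R c + u *\<^sub>R p"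
      using y by (auto simp: closed_segment_def)
    have "edge_fun E y = (1 - u) * edge_fun E c + u * edge_fun E p"
      unfolding edge_fun_def u by (simp add: inner_add_right algebra_simps)
    moreover have "edge_fun E c > 0" using edge_fun_pos_interior[OF E(1) c] .
    moreover have "edge_fun E p \<ge> 0" using nn E by blast
    ultimately have "u = 1" using ey u
      by (smt (verit) mult_nonneg_nonneg mult_pos_pos)
    then have "y = p" using u by simp
    then show False using \<open>y \<in> P\<close> p by simp
  qed
qed (auto simp: edge_fun_nonneg)

lemma edges_Int_vertex:
  assumes "E edge_of P" "F edge_of P" "E \<noteq> F" "p \<in> E" "p \<in> F"
  shows "E \<inter> F = {p}"
proof -
  have f: "E face_of P" "F face_of P" "aff_dim E = 1" "aff_dim F = 1"
    using assms by (auto simp: edge_of_def)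
  have "E \<inter> F \<noteq> E"
  proof
    assume "E \<inter> F = E"
    then have "E face_of F" using face_of_subset[OF f(1) _ face_of_imp_subset[OF f(2)]] by blast
    then have "aff_dim E < aff_dim F"
      using face_of_aff_dim_lt[of F E] assms(3) face_of_imp_convex[OF f(2)] by auto
    then show False using f by simp
  qed
  moreover have "E \<inter> F face_of E"
    using face_of_subset[OF face_of_Int[OF f(1,2)] _ face_of_imp_subset[OF f(1)]] by simp
  ultimately have "aff_dim (E \<inter> F) < 1"
    using face_of_aff_dim_lt[of E "E \<inter> F"] face_of_imp_convex[OF f(1)] f by auto
  moreover have "aff_dim (E \<inter> F) \<ge> 0"
    using aff_dim_subset[of "{p}" "E \<inter> F"] assms by simp
  ultimately have "aff_dim (E \<inter> F) = 0" by simp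
  then obtain a where a: "E \<inter> F = {a}" unfolding aff_dim_eq_0 ..
  moreover have "p \<in> E \<inter> F" using assms(4,5) by (rule IntI)
  ultimately show ?thesis by simp
qed

lemma two_edges_vertex:
  assumes "E edge_of P" "F edge_of P" "E \<noteq> F" "p \<in> E" "p \<in> F"
  shows "p extreme_point_of P"
  using edges_Int_vertex[OF assms] assms face_of_Int[of E P F]
  by (simp add: edge_of_def face_of_singleton)

lemma edge_has_vertex:
  assumes "E edge_of P"
  obtains v where "v extreme_point_of P" "v \<in> E"
proof -
  have "polytope E" using assms face_of_polytope_polytope polytope by (auto simp: edge_of_def)
  then obtain v where "v extreme_point_of E"
    using extreme_point_exists_convex[of E] edge_nonempty[OF assms] polytope_imp_compact polytope_imp_convex
    by blast
  then show ?thesis using that assms extreme_point_of_face by (auto simp: edge_of_def)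
qed

lemma edge_other_point:
  assumes "E edge_of P"
  obtains x where "x \<in> E" "x \<noteq> v"
proof -
  have "E \<noteq> {v}" using assms by (auto simp: edge_of_def)
  then show ?thesis using that edge_nonempty[OF assms] by blast
qed

lemma edge_dir:
  assumes "E edge_of P" "v \<in> E" "x \<in> E"
  shows "edge_normal E \<bullet> (x - v) = 0"
proof -
  have "v \<in> P" "x \<in> P" using edge_subset assms by blast+
  then have "edge_fun E v = 0" "edge_fun E x = 0" using edge_fun_eq_0_iff assms by blast+
  then show ?thesis using edge_fun_affine[of E x v] by simp
qed

lemma other_edge_dir:
  assumes "E edge_of P" "F edge_of P" "E \<noteq> F" "v \<in> E" "v \<in> F" "x \<in> E" "x \<noteq> v"
  shows "edge_normal F \<bullet> (x - v) > 0"
proof -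
  have "x \<notin> F" using edges_Int_vertex[OF assms(1-5)] assms by auto
  moreover have "x \<in> P" "v \<in> P" using assms edge_subset by auto
  ultimately have "edge_fun F x > 0" "edge_fun F v = 0"
    using edge_fun_nonneg[OF assms(2)] edge_fun_eq_0_iff[OF assms(2)] assms(5)
    by (auto simp: less_le)
  then show ?thesis using edge_fun_affine[of F x v] by simp
qed

text \<open>Each edge direction is orthogonal to its own normal and positive on the other one, so
  \<open>cross2_Binet_Cauchy\<close> leaves a single term of known sign.\<close>
lemma edges_cross2:
  assumes "E edge_of P" "F edge_of P" "E \<noteq> F" "v \<in> E" "v \<in> F"
    "x \<in> E - {v}" "y \<in> F - {v}"
  shows "cross2 (edge_normal E) (edge_normal F) * cross2 (x - v) (y - v) < 0"
proof -
  have "cross2 (edge_normal E) (edge_normal F) * cross2 (x - v) (y - v) =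
      - ((edge_normal E \<bullet> (y - v)) * (edge_normal F \<bullet> (x - v)))"
    using edge_dir[of E v x] assms by (simp add: cross2_Binet_Cauchy)
  then show ?thesis
    using other_edge_dir[of E F v x] other_edge_dir[of F E v y] assms by auto
qed

lemma clockwise_edges_iff:
  "clockwise_edges P v E F \<longleftrightarrow> E edge_of P \<and> F edge_of P \<and> v \<in> E \<and> v \<in> F \<and> E \<noteq> F \<and>
     cross2 (edge_normal E) (edge_normal F) > 0" (is "?L \<longleftrightarrow> ?R")
proof
  assume L: ?L
  then have 1: "E edge_of P" "F edge_of P" "v \<in> E" "v \<in> F" by (auto simp: clockwise_edges_def)
  obtain x y where xy: "x \<in> E - {v}" "y \<in> F - {v}"
    using edge_other_point[OF 1(1)] edge_other_point[OF 1(2)] by (metis Diff_iff singletonD)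
  have L': "cross2 (x - v) (y - v) < 0" if "x \<in> E - {v}" "y \<in> F - {v}" for x y
    using L that unfolding clockwise_edges_def det_eq_cross2 by blast
  have "E \<noteq> F" using L'[of x x] xy by (auto simp: cross2_simps)
  then show ?R using 1 edges_cross2[OF 1(1,2) _ 1(3,4) xy] L'[OF xy]
    by (auto simp: mult_less_0_iff)
next
  assume R: ?R
  then have "cross2 (x - v) (y - v) < 0" if "x \<in> E - {v}" "y \<in> F - {v}" for x y
    using edges_cross2[of E F v x y] that by (auto simp: mult_less_0_iff)
  then show ?L using R unfolding clockwise_edges_def det_eq_cross2 by blast
qed

text \<open>Two edges meet at \<open>v\<close> since \<open>{v}\<close> is the intersection of the edges through it. Given a third one,
  write its normal as a combination of the other two normals. Evaluation on the first two edges
  shows that both coefficients are positive, and evaluation on the third edge that they cannot be.\<close>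
lemma vertex_two_edges:
  assumes v: "v extreme_point_of P"
  obtains E F where "clockwise_edges P v E F" "\<And>G. G edge_of P \<Longrightarrow> v \<in> G \<Longrightarrow> G = E \<or> G = F"
proof -
  have "{v} face_of P" using v by (simp add: face_of_singleton)
  moreover have "{v} \<noteq> P" using dim2 by auto
  ultimately have vI: "{v} = \<Inter>{G. G edge_of P \<and> v \<in> G}"
    using face_of_polyhedron[OF polyhedron_P, of "{v}"] by (simp add: edge_iff_facet)
  have "{G. G edge_of P \<and> v \<in> G} \<noteq> {}"
  proof
    assume "{G. G edge_of P \<and> v \<in> G} = {}"
    then have "{v} = UNIV" using vI by (metis Inf_empty)
    moreover have "v + axis 1 1 \<noteq> v" by (simp add: axis_eq_0_iff)
    ultimately show False by (metis UNIV_I singletonD)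
  qed
  then obtain E where E: "E edge_of P" "v \<in> E" by auto
  obtain x where x: "x \<in> E" "x \<noteq> v" using edge_other_point[OF E(1)] .
  obtain F where F: "F edge_of P" "v \<in> F" "x \<notin> F" using x vI by blast
  then have "E \<noteq> F" using x by auto
  obtain y where y: "y \<in> F" "y \<noteq> v" using edge_other_point[OF F(1)] .
  have nz: "cross2 (edge_normal E) (edge_normal F) \<noteq> 0"
  proof -
    have "x \<in> E - {v}" "y \<in> F - {v}" using x y by auto
    from edges_cross2[OF E(1) F(1) \<open>E \<noteq> F\<close> E(2) F(2) this] show ?thesis by auto
  qed
  have only: "G = E \<or> G = F" if G: "G edge_of P" "v \<in> G" for G
  proof (rule ccontr)
    assume n: "\<not> (G = E \<or> G = F)"
    obtain w where w: "w \<in> G" "w \<noteq> v" using edge_other_point[OF G(1)] .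
    let ?c = "cross2 (edge_normal E) (edge_normal F)"
    let ?a = "cross2 (edge_normal G) (edge_normal F)" let ?b = "cross2 (edge_normal E) (edge_normal G)"
    have 1: "?c * (edge_normal G \<bullet> (x - v)) = ?b * (edge_normal F \<bullet> (x - v))"
      using cross2_inner_Cramer[of "edge_normal E" "edge_normal F" "edge_normal G" "x - v"] edge_dir[OF E x(1)] by simp
    have 2: "?c * (edge_normal G \<bullet> (y - v)) = ?a * (edge_normal E \<bullet> (y - v))"
      using cross2_inner_Cramer[of "edge_normal E" "edge_normal F" "edge_normal G" "y - v"] edge_dir[OF F(1,2) y(1)] by simp
    have 3: "0 = ?a * (edge_normal E \<bullet> (w - v)) + ?b * (edge_normal F \<bullet> (w - v))"
      using cross2_inner_Cramer[of "edge_normal E" "edge_normal F" "edge_normal G" "w - v"] edge_dir[OF G w(1)] by simp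
    have "edge_normal G \<bullet> (x - v) > 0" "edge_normal F \<bullet> (x - v) > 0" "edge_normal G \<bullet> (y - v) > 0" "edge_normal E \<bullet> (y - v) > 0"
      "edge_normal E \<bullet> (w - v) > 0" "edge_normal F \<bullet> (w - v) > 0"
      using other_edge_dir E F G x y w n \<open>E \<noteq> F\<close> by metis+
    moreover have "?c * ?c > 0" using nz by (metis not_real_square_gt_zero)
    ultimately have "(?c * ?c) * (edge_normal G \<bullet> (x - v)) > 0" "(?c * ?c) * (edge_normal G \<bullet> (y - v)) > 0"
      and p: "edge_normal F \<bullet> (x - v) > 0" "edge_normal E \<bullet> (y - v) > 0" "edge_normal E \<bullet> (w - v) > 0" "edge_normal F \<bullet> (w - v) > 0"
      by simp_all
    then have "(?c * ?b) * (edge_normal F \<bullet> (x - v)) > 0" "(?c * ?a) * (edge_normal E \<bullet> (y - v)) > 0"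
      using 1 2 by (simp_all only: mult.assoc)
    then have "?c * ?b > 0" "?c * ?a > 0" using p by (metis zero_less_mult_pos2)+
    then have "(?c * ?a) * (edge_normal E \<bullet> (w - v)) + (?c * ?b) * (edge_normal F \<bullet> (w - v)) > 0"
      using p by (simp add: add_pos_pos)
    moreover have "(?c * ?a) * (edge_normal E \<bullet> (w - v)) + (?c * ?b) * (edge_normal F \<bullet> (w - v)) = ?c * 0"
      unfolding 3 by (simp only: distrib_left mult.assoc)
    ultimately show False by simp
  qed
  show ?thesis
  proof (cases "cross2 (edge_normal E) (edge_normal F) > 0")
    case True
    then show ?thesis using that[of E F] only E F \<open>E \<noteq> F\<close> by (auto simp: clockwise_edges_iff)
  next
    case False
    then have "cross2 (edge_normal F) (edge_normal E) > 0" using nz cross2_commute[of "edge_normal E" "edge_normal F"] by auto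
    then show ?thesis using that[of F E] only E F \<open>E \<noteq> F\<close> by (auto simp: clockwise_edges_iff)
  qed
qed

lemma vertex_edges:
  assumes v: "v extreme_point_of P"
  shows "edge1 v edge_of P" "edge2 v edge_of P" "v \<in> edge1 v" "v \<in> edge2 v" "edge1 v \<noteq> edge2 v"
    "cross2 (edge_normal (edge1 v)) (edge_normal (edge2 v)) > 0" "clockwise_edges P v (edge1 v) (edge2 v)"
    and vertex_edges_only: "\<And>G. G edge_of P \<Longrightarrow> v \<in> G \<Longrightarrow> G = edge1 v \<or> G = edge2 v"
proof -
  obtain E F where cw: "clockwise_edges P v E F"
    and only: "\<And>G. G edge_of P \<Longrightarrow> v \<in> G \<Longrightarrow> G = E \<or> G = F"
    using vertex_two_edges[OF v] by blast
  have uniq: "A = E \<and> B = F" if "clockwise_edges P v A B" for A B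
    using that cw only[of A] only[of B] cross2_commute[of "edge_normal E" "edge_normal F"]
    by (auto simp: clockwise_edges_iff)
  have [simp]: "edge1 v = E" "edge2 v = F"
    unfolding edge1_def edge2_def by (rule the_equality; use cw uniq in blast)+
  show "edge1 v edge_of P" "edge2 v edge_of P" "v \<in> edge1 v" "v \<in> edge2 v" "edge1 v \<noteq> edge2 v"
    "cross2 (edge_normal (edge1 v)) (edge_normal (edge2 v)) > 0" "clockwise_edges P v (edge1 v) (edge2 v)"
    "\<And>G. G edge_of P \<Longrightarrow> v \<in> G \<Longrightarrow> G = edge1 v \<or> G = edge2 v"
    using cw only by (auto simp: clockwise_edges_iff)
qed

lemma cross2_\<Lambda>_nz: "v extreme_point_of P \<Longrightarrow> cross2 (\<Lambda> (edge1 v)) (\<Lambda> (edge2 v)) \<noteq> 0"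
  using indep vertex_edges independent_imp_cross2_neq_0 by metis

text \<open>The difference of \<open>h v E\<close> and a suitable multiple of \<open>edge_fun E\<close> is affine and vanishes at three
  points that are not collinear: two on \<open>E\<close> and one in the interior.\<close>
lemma edge_fun_proportional:
  assumes v: "v extreme_point_of P" and E: "E edge_of P" "v \<in> E"
  obtains k where "k > 0" "\<And>p. h v E p = k * edge_fun E p"
proof -
  obtain a c where h: "\<And>p. h v E p = a \<bullet> p + c" and h0: "\<And>p. p \<in> E \<Longrightarrow> h v E p = 0"
    and hp: "\<And>p. p \<in> interior P \<Longrightarrow> h v E p > 0"
    using affine[OF v E] by metis
  obtain x where x: "x \<in> E" "x \<noteq> v" using edge_other_point[OF E(1)] .
  obtain q where q: "q \<in> interior P" using interior_nonempty by auto
  define k where "k = h v E q / edge_fun E q"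
  have eq: "edge_fun E q > 0" using edge_fun_pos_interior E q by blast
  then have k: "k > 0" using hp[OF q] by (simp add: k_def)
  define b where "b = a - k *\<^sub>R edge_normal E"
  have bx: "b \<bullet> (x - v) = 0"
    using h0[OF x(1)] h0[OF E(2)] edge_dir[OF E x(1)] by (simp add: h b_def inner_diff_left inner_diff_right)
  have eqv: "edge_fun E q = edge_normal E \<bullet> (q - v)"
    using edge_fun_affine[of E q v] edge_fun_eq_0_iff[OF E(1), of v] E edge_subset by auto
  have "k * edge_fun E q = h v E q" using eq by (simp add: k_def)
  then have bq: "b \<bullet> (q - v) = 0"
    using h0[OF E(2)] unfolding eqv h b_def by (simp add: inner_diff_left inner_diff_right algebra_simps)
  have "(edge_normal E \<bullet> (q - v)) * (w \<bullet> (x - v)) = - (cross2 (edge_normal E) w * cross2 (x - v) (q - v))" for w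
    using edge_dir[OF E x(1)] by (simp add: cross2_Binet_Cauchy)
  from this[of "x - v"] have nz: "cross2 (x - v) (q - v) \<noteq> 0" using eq eqv x by force
  have "b \<bullet> z = 0" for z
    using cross2_inner_Cramer[of "x - v" "q - v" z b] bx bq nz by (simp add: inner_commute)
  then have "b = 0" by (metis inner_eq_zero_iff)
  then have "a = k *\<^sub>R edge_normal E" by (simp add: b_def)
  then have "h v E p = k * (edge_normal E \<bullet> (p - v))" for p
    using h0[OF E(2)] by (simp add: h inner_diff_right algebra_simps)
  moreover have "edge_normal E \<bullet> (p - v) = edge_fun E p" for p
    using edge_fun_affine[of E p v] edge_fun_eq_0_iff[OF E(1), of v] E edge_subset by auto
  ultimately show ?thesis using that k by metis
qed

lemma face_at:
  assumes "p \<in> P"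
  shows "face_at p face_of P" "p \<in> rel_interior (face_at p)"
proof -
  have "\<exists>F. F face_of P \<and> p \<in> rel_interior F"
  proof (cases "p \<in> interior P")
    case True
    then show ?thesis using face_of_refl[OF convex_P] rel_interior_P by blast
  next
    case False
    then obtain E where E: "E edge_of P" "p \<in> E" using not_interior_edge assms by blast
    show ?thesis
    proof (cases "p \<in> rel_interior E")
      case True
      then show ?thesis using E by (auto simp: edge_of_def)
    next
      case False
      have "polyhedron E" using E polyhedron_P face_of_polyhedron_polyhedron by (auto simp: edge_of_def)
      then obtain F where F: "F facet_of E" "p \<in> F"
        using rel_boundary_of_polyhedron E False by blast
      then have "aff_dim F = 0" "F face_of P"
        using E face_of_trans by (auto simp: facet_of_def edge_of_def)
      then have "F = {p}" using F(2) unfolding aff_dim_eq_0 by auto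
      then show ?thesis using \<open>F face_of P\<close> by force
    qed
  qed
  then have "\<exists>!F. F face_of P \<and> p \<in> rel_interior F" using face_of_eq by blast
  from theI'[OF this] show "face_at p face_of P" "p \<in> rel_interior (face_at p)"
    unfolding face_at_def by auto
qed

lemma face_at_subset_iff:
  assumes "p \<in> P" "E edge_of P"
  shows "face_at p \<subseteq> E \<longleftrightarrow> p \<in> E"
proof
  show "p \<in> E" if "face_at p \<subseteq> E" using face_at[OF assms(1)] that rel_interior_subset by blast
  show "face_at p \<subseteq> E" if "p \<in> E"
    using subset_of_face_of[of E P "face_at p"] face_at[OF assms(1)] that assms(2)
      face_of_imp_subset by (auto simp: edge_of_def)
qed

end

section \<open>Interpolation between the standard forms at the vertices\<close>

text \<open>The general \<open>2\<close>-form that occurs in a chart: \<open>Im (cnj a\<^sub>i b\<^sub>i)\<close> are the standard area forms, and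
  \<open>z\<^sub>i \<bullet> a\<^sub>i\<close> and \<open>Im (cnj z\<^sub>i a\<^sub>i)\<close> are the \<open>1\<close>-forms \<open>r dr\<close> and \<open>r\<^sup>2 d\<theta>\<close> in polar coordinates. The left
  hand side of the last hypothesis is its Pfaffian.\<close>
lemma nondegenerate_chart_form:
  fixes z :: "complex \<times> complex"
  assumes f: "\<And>a b. f a b = m\<^sub>1 * Im (cnj (fst a) * fst b) + m\<^sub>2 * Im (cnj (snd a) * snd b)
      + \<beta> * ((snd z \<bullet> snd a) * Im (cnj (fst z) * fst b) - Im (cnj (fst z) * fst a) * (snd z \<bullet> snd b))
      + \<gamma> * ((fst z \<bullet> fst a) * Im (cnj (snd z) * snd b) - Im (cnj (snd z) * snd a) * (fst z \<bullet> fst b))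
      + s * ((fst z \<bullet> fst a) * (snd z \<bullet> snd b) - (snd z \<bullet> snd a) * (fst z \<bullet> fst b))
      + t * (Im (cnj (fst z) * fst a) * Im (cnj (snd z) * snd b)
             - Im (cnj (snd z) * snd a) * Im (cnj (fst z) * fst b))"
    and pf: "m\<^sub>1 * m\<^sub>2 - (cmod (fst z))\<^sup>2 * (cmod (snd z))\<^sup>2 * (\<beta> * \<gamma> + s * t) \<noteq> 0"
  shows "nondegenerate f"
  unfolding nondegenerate_def
proof (intro allI impI)
  fix a :: "complex \<times> complex" assume 0: "\<forall>b. f a b = 0"
  obtain z1 z2 a1 a2 where za: "z = (z1, z2)" "a = (a1, a2)" by (metis surj_pair)
  obtain x1 y1 x2 y2 where z12: "z1 = Complex x1 y1" "z2 = Complex x2 y2"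
    by (metis complex.exhaust)
  obtain u1 v1 u2 v2 where a12: "a1 = Complex u1 v1" "a2 = Complex u2 v2"
    by (metis complex.exhaust)
  define \<sigma>1 \<tau>1 \<sigma>2 \<tau>2 where "\<sigma>1 = x1 * u1 + y1 * v1" "\<tau>1 = x1 * v1 - y1 * u1"
    "\<sigma>2 = x2 * u2 + y2 * v2" "\<tau>2 = x2 * v2 - y2 * u2"
  note sd = this
  \<comment> \<open>\<open>f a b = 0\<close> for all \<open>b\<close> says \<open>m\<^sub>1 a\<^sub>1 = (\<i> B - A) z\<^sub>1\<close> and \<open>m\<^sub>2 a\<^sub>2 = (\<i> D - C) z\<^sub>2\<close>\<close>
  define A B C D where "A = \<beta> * \<sigma>2 - t * \<tau>2" "B = - \<gamma> * \<tau>2 - s * \<sigma>2"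
    "C = \<gamma> * \<sigma>1 + t * \<tau>1" "D = s * \<sigma>1 - \<beta> * \<tau>1"
  note ABCD = this
  have "f a (1, 0) = 0" "f a (\<i>, 0) = 0" "f a (0, 1) = 0" "f a (0, \<i>) = 0" using 0 by auto
  then have e: "m\<^sub>1 * u1 = - A * x1 - B * y1" "m\<^sub>1 * v1 = B * x1 - A * y1"
    "m\<^sub>2 * u2 = - C * x2 - D * y2" "m\<^sub>2 * v2 = D * x2 - C * y2"
    unfolding f za z12 a12 ABCD sd by (simp_all add: inner_complex_def algebra_simps)
  let ?n1 = "x1 * x1 + y1 * y1" let ?n2 = "x2 * x2 + y2 * y2"
  have m: "m\<^sub>1 * \<sigma>1 = - A * ?n1" "m\<^sub>1 * \<tau>1 = B * ?n1" "m\<^sub>2 * \<sigma>2 = - C * ?n2" "m\<^sub>2 * \<tau>2 = D * ?n2"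
    using e unfolding sd by algebra+
  let ?P = "m\<^sub>1 * m\<^sub>2 - ?n1 * ?n2 * (\<beta> * \<gamma> + s * t)"
  have P: "?P \<noteq> 0" using pf unfolding za z12 fst_conv snd_conv cmod_power2
    by (simp add: power2_eq_square)
  have "?P * \<sigma>1 = 0" "?P * \<tau>1 = 0" "?P * \<sigma>2 = 0" "?P * \<tau>2 = 0"
    using m unfolding ABCD by algebra+
  then have \<sigma>\<tau>: "\<sigma>1 = 0" "\<tau>1 = 0" "\<sigma>2 = 0" "\<tau>2 = 0" using P by auto
  then have m12: "m\<^sub>1 * u1 = 0" "m\<^sub>1 * v1 = 0" "m\<^sub>2 * u2 = 0" "m\<^sub>2 * v2 = 0"
    using e by (auto simp: ABCD)
  have "?n1 * u1 = 0" "?n1 * v1 = 0" "?n2 * u2 = 0" "?n2 * v2 = 0"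
    using \<sigma>\<tau> unfolding sd by algebra+
  moreover have "m\<^sub>1 \<noteq> 0 \<or> ?n1 \<noteq> 0" "m\<^sub>2 \<noteq> 0 \<or> ?n2 \<noteq> 0" using P by auto
  ultimately have "u1 = 0 \<and> v1 = 0" "u2 = 0 \<and> v2 = 0" using m12 mult_eq_0_iff by blast+
  then show "a = 0" by (simp add: za a12 zero_prod_def complex_eq_iff)
qed

lemma vec2_axis: "x = x $ 1 *\<^sub>R axis 1 1 + x $ 2 *\<^sub>R (axis 2 1 :: real^2)"
  by (simp add: vec_eq_iff forall_2 axis_def)

context primitive_quasitoric
begin

definition vertices :: "(real^2) set" where "vertices = {v. v extreme_point_of P}"

definition vertex_weight :: "real^2 \<Rightarrow> real^2 \<Rightarrow> real" where
  "vertex_weight u p = (\<Prod>F\<in>{F. F edge_of P \<and> u \<notin> F}. edge_fun F p)"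

text \<open>Up to the factor \<open>cross2 (\<Lambda> (edge1 u)) (\<Lambda> (edge2 u))\<close>, the linear map that sends the two
  characteristic vectors at \<open>u\<close> to the normals of their edges. It encodes the standard form of the
  chart at \<open>u\<close>. The factor is positive for a positive omniorientation.\<close>
definition vertex_map :: "real^2 \<Rightarrow> real^2 \<Rightarrow> real^2" where
  "vertex_map u x = cross2 x (\<Lambda> (edge2 u)) *\<^sub>R edge_normal (edge1 u) + cross2 (\<Lambda> (edge1 u)) x *\<^sub>R edge_normal (edge2 u)"

text \<open>At a point \<open>p\<close> of the polygon, a linear map from the Lie algebra of the torus to the cotangent
  space of \<open>P\<close>, both identified with \<open>real^2\<close>.\<close>
definition interpolant :: "real^2 \<Rightarrow> real^2 \<Rightarrow> real^2" where
  "interpolant p x = (\<Sum>u\<in>vertices. vertex_weight u p *\<^sub>R vertex_map u x)"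

definition interpolant_det :: "real^2 \<Rightarrow> real" where
  "interpolant_det p = cross2 (interpolant p (axis 1 1)) (interpolant p (axis 2 1))"

definition all_prod :: "real^2 \<Rightarrow> real" where
  "all_prod p = (\<Prod>F\<in>{F. F edge_of P}. edge_fun F p)"

lemma finite_vertices: "finite vertices"
proof -
  have "(\<lambda>v. {v}) ` vertices \<subseteq> {F. F face_of P}" by (auto simp: vertices_def face_of_singleton)
  then have "finite ((\<lambda>v. {v}) ` vertices)" using finite_polytope_faces[OF polytope] finite_subset by blast
  then show ?thesis by (rule finite_imageD) (auto simp: inj_on_def)
qed

lemma vertex_weight_nonneg: "p \<in> P \<Longrightarrow> vertex_weight u p \<ge> 0"
  unfolding vertex_weight_def by (rule prod_nonneg) (auto simp: edge_fun_nonneg)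

lemma vertex_weight_eq_0: "p \<in> E \<Longrightarrow> E edge_of P \<Longrightarrow> u \<notin> E \<Longrightarrow> vertex_weight u p = 0"
  unfolding vertex_weight_def
proof (rule prod_zero)
  assume "p \<in> E" "E edge_of P" "u \<notin> E"
  moreover from this have "edge_fun E p = 0" using edge_fun_eq_0_iff edge_subset by blast
  ultimately show "\<exists>F\<in>{F. F edge_of P \<and> u \<notin> F}. edge_fun F p = 0" by auto
qed (rule finite_edges)

text \<open>If \<open>p\<close> is a vertex, take \<open>u = p\<close>; otherwise \<open>E\<close> is the only edge through \<open>p\<close>, and any vertex of \<open>E\<close>
  will do.\<close>
lemma edge_vertex_weight_pos:
  assumes "E edge_of P" "p \<in> E"
  obtains u where "u \<in> vertices" "u \<in> E" "vertex_weight u p > 0"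
proof -
  have p: "p \<in> P" using assms edge_subset by blast
  have pos: "vertex_weight u p > 0" if "\<And>F. F edge_of P \<Longrightarrow> u \<notin> F \<Longrightarrow> p \<notin> F" for u
    unfolding vertex_weight_def
  proof (rule prod_pos, safe)
    fix F assume F: "F edge_of P" "u \<notin> F"
    then have "edge_fun F p \<noteq> 0" using that p edge_fun_eq_0_iff by blast
    then show "edge_fun F p > 0" using edge_fun_nonneg[OF F(1) p] by simp
  qed
  show ?thesis
  proof (cases "p extreme_point_of P")
    case True
    then show ?thesis using that[of p] assms pos[of p] by (auto simp: vertices_def)
  next
    case False
    obtain u where u: "u extreme_point_of P" "u \<in> E" using edge_has_vertex[OF assms(1)] .
    have "p \<notin> F" if "F edge_of P" "u \<notin> F" for F
      using two_edges_vertex[OF assms(1) that(1) _ assms(2)] False that u by metis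
    then show ?thesis using that[of u] u pos by (auto simp: vertices_def)
  qed
qed

lemma interpolant_linear: "interpolant p (r *\<^sub>R x + s *\<^sub>R y) = r *\<^sub>R interpolant p x + s *\<^sub>R interpolant p y"
  unfolding interpolant_def vertex_map_def
  by (simp add: scaleR_sum_right cross2_simps algebra_simps sum.distrib)

lemma cross2_interpolant: "cross2 (interpolant p x) (interpolant p y) = interpolant_det p * cross2 x y"
proof -
  have e: "interpolant p x = x $ 1 *\<^sub>R interpolant p (axis 1 1) + x $ 2 *\<^sub>R interpolant p (axis 2 1)" for x
    by (subst vec2_axis) (rule interpolant_linear)
  show ?thesis unfolding e[of x] e[of y] interpolant_det_def cross2_simps cross2_commute[of "interpolant p (axis 2 1)"]
    by (simp add: cross2_def[of x] algebra_simps)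
qed

text \<open>\<open>slope\<close> and \<open>remainder\<close> split the value of the interpolant at \<open>\<Lambda> E\<close>: the vertices on \<open>E\<close> contribute
  multiples of the normal of \<open>E\<close>, and the weights of the other vertices are divisible by \<open>edge_fun E\<close>.\<close>
definition slope :: "(real^2) set \<Rightarrow> real^2 \<Rightarrow> real" where
  "slope E p = (\<Sum>u\<in>{u\<in>vertices. u \<in> E}. vertex_weight u p * cross2 (\<Lambda> (edge1 u)) (\<Lambda> (edge2 u)))"

definition remainder :: "(real^2) set \<Rightarrow> real^2 \<Rightarrow> real^2" where
  "remainder E p = (\<Sum>u\<in>{u\<in>vertices. u \<notin> E}.
     (\<Prod>F\<in>{F. F edge_of P \<and> u \<notin> F \<and> F \<noteq> E}. edge_fun F p) *\<^sub>R vertex_map u (\<Lambda> E))"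

lemma vertex_map_edge:
  assumes "u \<in> vertices" "E edge_of P" "u \<in> E"
  shows "vertex_map u (\<Lambda> E) = cross2 (\<Lambda> (edge1 u)) (\<Lambda> (edge2 u)) *\<^sub>R edge_normal E"
proof -
  have "E = edge1 u \<or> E = edge2 u" using vertex_edges_only assms by (auto simp: vertices_def)
  then show ?thesis by (auto simp: vertex_map_def cross2_simps)
qed

text \<open>The reason for the smoothness of the invariant form over \<open>E\<close>: the first summand pairs \<open>dq\<close> with the
  differential of \<open>edge_fun E\<close>, the second one multiplies it by \<open>edge_fun E\<close>.\<close>
lemma interpolant_edge:
  assumes E: "E edge_of P"
  shows "interpolant p (\<Lambda> E) = slope E p *\<^sub>R edge_normal E + edge_fun E p *\<^sub>R remainder E p"
proof -
  have "interpolant p (\<Lambda> E) = (\<Sum>u\<in>{u\<in>vertices. u \<in> E}. vertex_weight u p *\<^sub>R vertex_map u (\<Lambda> E))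
      + (\<Sum>u\<in>{u\<in>vertices. u \<notin> E}. vertex_weight u p *\<^sub>R vertex_map u (\<Lambda> E))"
    unfolding interpolant_def
    by (subst sum.union_disjoint[symmetric]) (auto intro!: sum.cong simp: finite_vertices)
  moreover have "(\<Sum>u\<in>{u\<in>vertices. u \<in> E}. vertex_weight u p *\<^sub>R vertex_map u (\<Lambda> E)) = slope E p *\<^sub>R edge_normal E"
    unfolding slope_def scaleR_sum_left by (rule sum.cong) (auto simp: vertex_map_edge E)
  moreover have "vertex_weight u p = edge_fun E p * (\<Prod>F\<in>{F. F edge_of P \<and> u \<notin> F \<and> F \<noteq> E}. edge_fun F p)"
    if "u \<notin> E" for u
  proof -
    have "{F. F edge_of P \<and> u \<notin> F} = insert E {F. F edge_of P \<and> u \<notin> F \<and> F \<noteq> E}" using E that by auto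
    then show ?thesis unfolding vertex_weight_def using finite_edges[of "\<lambda>F. u \<notin> F \<and> F \<noteq> E"] by simp
  qed
  ultimately show ?thesis
    unfolding remainder_def scaleR_sum_right by (simp add: scaleR_scaleR)
qed

text \<open>At a point of \<open>E\<close> only the vertices \<open>u\<close> on \<open>E\<close> have nonzero weight. For each of them the vertex map is
  the sum of a multiple \<open>\<alpha> u\<close> of the normal of \<open>E\<close> and of \<open>cross2 (\<Lambda> E) x\<close> times a vector \<open>N u\<close>, which
  comes from the other edge at \<open>u\<close>. Whether \<open>E\<close> is the first or the second edge at \<open>u\<close>, the number
  \<open>\<alpha> u (\<Lambda> E)\<close> is positive by the omniorientation, and \<open>N u\<close> lies on the positive side of the normal by
  the clockwise order. Positive combinations inherit both signs.\<close>
lemma interpolant_det_pos: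
  assumes pos: positively_omnioriented and E: "E edge_of P" "p \<in> E"
  shows "interpolant_det p > 0"
proof -
  let ?I = "{u\<in>vertices. u \<in> E}"
  have p: "p \<in> P" using E edge_subset by blast
  define N where "N u = (if E = edge1 u then edge_normal (edge2 u) else - edge_normal (edge1 u))" for u
  define \<alpha> where "\<alpha> u x = (if E = edge1 u then cross2 x (\<Lambda> (edge2 u)) else cross2 (\<Lambda> (edge1 u)) x)" for u x
  have u: "u extreme_point_of P" "E = edge1 u \<or> E = edge2 u" "edge1 u \<noteq> edge2 u" if "u \<in> ?I" for u
    using that vertex_edges_only vertex_edges(5) E by (auto simp: vertices_def)
  have vm: "vertex_map u x = \<alpha> u x *\<^sub>R edge_normal E + cross2 (\<Lambda> E) x *\<^sub>R N u" if "u \<in> ?I" for u x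
    using u[OF that] by (auto simp: vertex_map_def N_def \<alpha>_def cross2_commute[of x])
  have \<alpha>pos: "\<alpha> u (\<Lambda> E) > 0" if "u \<in> ?I" for u
    using u[OF that] pos vertex_edges(7) unfolding positively_omnioriented_def det_eq_cross2
    by (auto simp: \<alpha>_def)
  have Npos: "cross2 (edge_normal E) (N u) > 0" if "u \<in> ?I" for u
    using u[OF that] vertex_edges(6)[OF u(1)[OF that]] cross2_commute[of "edge_normal (edge2 u)"]
    by (auto simp: N_def cross2_simps)
  have interpolant: "interpolant p x = (\<Sum>u\<in>?I. vertex_weight u p * \<alpha> u x) *\<^sub>R edge_normal E + cross2 (\<Lambda> E) x *\<^sub>R (\<Sum>u\<in>?I. vertex_weight u p *\<^sub>R N u)" for x
  proof -
    have "interpolant p x = (\<Sum>u\<in>?I. vertex_weight u p *\<^sub>R vertex_map u x)"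
      unfolding interpolant_def by (rule sum.mono_neutral_right) (auto simp: finite_vertices vertex_weight_eq_0[OF E(2,1)])
    also have "\<dots> = (\<Sum>u\<in>?I. (vertex_weight u p * \<alpha> u x) *\<^sub>R edge_normal E + cross2 (\<Lambda> E) x *\<^sub>R (vertex_weight u p *\<^sub>R N u))"
      by (rule sum.cong) (auto simp: vm algebra_simps)
    finally show ?thesis by (simp add: sum.distrib scaleR_sum_left scaleR_sum_right)
  qed
  obtain u0 where u0: "u0 \<in> ?I" "vertex_weight u0 p > 0" using edge_vertex_weight_pos[OF E] by blast
  have sum_pos: "(\<Sum>u\<in>?I. vertex_weight u p * f u) > 0" if "\<And>u. u \<in> ?I \<Longrightarrow> f u > 0" for f
    by (rule sum_pos2[of _ u0]) (use u0 that vertex_weight_nonneg[OF p] finite_vertices in \<open>auto intro: less_imp_le mult_nonneg_nonneg\<close>)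
  have c0: "cross2 x (\<Sum>u\<in>?I. vertex_weight u p *\<^sub>R N u) = (\<Sum>u\<in>?I. vertex_weight u p * cross2 x (N u))" for x
  proof -
    have "linear (cross2 x)" by (rule linearI) (auto simp: cross2_simps)
    then show ?thesis by (simp add: linear_sum linear_scale)
  qed
  \<comment> \<open>a vector completing \<open>\<Lambda> E\<close> to a positive basis\<close>
  define y :: "real^2" where "y = vector [- (\<Lambda> E $ 2), \<Lambda> E $ 1]"
  have "\<Lambda> E \<noteq> 0" using primitive[OF E(1)] by (simp add: primitive_vector_def)
  then have y: "cross2 (\<Lambda> E) y > 0"
    by (auto simp: cross2_def y_def vec_eq_iff forall_2 sum_power2_gt_zero_iff simp flip: power2_eq_square)
  define S where "S = (\<Sum>u\<in>?I. vertex_weight u p *\<^sub>R N u)"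
  have "interpolant p (\<Lambda> E) = (\<Sum>u\<in>?I. vertex_weight u p * \<alpha> u (\<Lambda> E)) *\<^sub>R edge_normal E"
    "interpolant p y = (\<Sum>u\<in>?I. vertex_weight u p * \<alpha> u y) *\<^sub>R edge_normal E + cross2 (\<Lambda> E) y *\<^sub>R S"
    by (simp_all add: interpolant cross2_simps S_def)
  then have "cross2 (interpolant p (\<Lambda> E)) (interpolant p y) =
      (\<Sum>u\<in>?I. vertex_weight u p * \<alpha> u (\<Lambda> E)) * (cross2 (edge_normal E) S * cross2 (\<Lambda> E) y)"
    by (simp add: cross2_simps)
  moreover have "interpolant_det p * cross2 (\<Lambda> E) y = cross2 (interpolant p (\<Lambda> E)) (interpolant p y)" by (simp add: cross2_interpolant)
  moreover have "(\<Sum>u\<in>?I. vertex_weight u p * \<alpha> u (\<Lambda> E)) * (cross2 (edge_normal E) S * cross2 (\<Lambda> E) y) > 0"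
    unfolding S_def c0 using sum_pos[of "\<lambda>u. \<alpha> u (\<Lambda> E)"] sum_pos[of "\<lambda>u. cross2 (edge_normal E) (N u)"] \<alpha>pos Npos y
    by simp
  ultimately have "interpolant_det p * cross2 (\<Lambda> E) y > 0" by metis
  then show ?thesis using y by (rule zero_less_mult_pos2)
qed

lemma continuous_on_edge_fun [continuous_intros]: "continuous_on S (edge_fun E)"
  unfolding edge_fun_def[abs_def] by (intro continuous_intros)

lemma continuous_on_interpolant_det: "continuous_on S interpolant_det"
  unfolding interpolant_det_def[abs_def] interpolant_def cross2_def vertex_weight_def by (intro continuous_intros)

text \<open>On the compact set where the determinant is not positive, which avoids the boundary, \<open>all_prod\<close> has a
  positive minimum.\<close>
lemma exists_dominating_factor:
  assumes pos: positively_omnioriented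
  shows "\<exists>K. \<forall>p\<in>P. interpolant_det p + (K * all_prod p)\<^sup>2 > 0"
proof (cases "\<exists>p\<in>P. interpolant_det p \<le> 0")
  case False
  then show ?thesis by (intro exI[of _ 0]) (auto simp: not_le)
next
  case True
  define Z where "Z = {p\<in>P. interpolant_det p \<le> 0}"
  have cP: "compact P" using polytope polytope_imp_compact by blast
  have "closed Z"
    unfolding Z_def using continuous_closed_preimage[OF continuous_on_interpolant_det compact_imp_closed[OF cP], of "{..0}"]
    by (simp add: vimage_def Int_def)
  then have "compact (P \<inter> Z)" using cP by blast
  moreover have "P \<inter> Z = Z" by (auto simp: Z_def)
  ultimately have cZ: "compact Z" by simp
  have Z: "Z \<noteq> {}" using True by (auto simp: Z_def)
  have cH: "continuous_on Z all_prod" unfolding all_prod_def[abs_def] by (intro continuous_intros)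
  obtain m where m: "m \<in> Z" "\<And>p. p \<in> Z \<Longrightarrow> all_prod m \<le> all_prod p"
    using continuous_attains_inf[OF cZ Z cH] by blast
  obtain M where M: "M \<in> Z" "\<And>p. p \<in> Z \<Longrightarrow> interpolant_det M \<le> interpolant_det p"
    using continuous_attains_inf[OF cZ Z continuous_on_interpolant_det] by blast
  have "m \<in> interior P"
    using m(1) not_interior_edge interpolant_det_pos[OF pos] unfolding Z_def by (metis (mono_tags, lifting) mem_Collect_eq not_le)
  then have Hm: "all_prod m > 0"
    unfolding all_prod_def by (auto intro!: prod_pos edge_fun_pos_interior)
  \<comment> \<open>chosen such that \<open>(K * all_prod p)\<^sup>2\<close> is at least \<open>1 - interpolant_det M\<close> on \<open>Z\<close>\<close>
  define K where "K = sqrt (1 - interpolant_det M) / all_prod m"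
  have K: "K\<^sup>2 * (all_prod m)\<^sup>2 = 1 - interpolant_det M"
    using M(1) Hm by (simp add: K_def power_divide Z_def)
  have "interpolant_det p + (K * all_prod p)\<^sup>2 > 0" if "p \<in> P" for p
  proof (cases "p \<in> Z")
    case True
    have "(all_prod m)\<^sup>2 \<le> (all_prod p)\<^sup>2" using m(2)[OF True] Hm by (intro power_mono) auto
    then have "1 - interpolant_det M \<le> K\<^sup>2 * (all_prod p)\<^sup>2"
      unfolding K[symmetric] by (intro mult_left_mono) auto
    then show ?thesis using M(2)[OF True] by (simp add: power_mult_distrib)
  next
    case False
    then have "interpolant_det p > 0" using that by (auto simp: Z_def)
    then show ?thesis by (simp add: add_pos_nonneg)
  qed
  then show ?thesis by blast
qed

definition dominating_factor :: real where
  "dominating_factor = (SOME K. \<forall>p\<in>P. interpolant_det p + (K * all_prod p)\<^sup>2 > 0)"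

lemma dominating_factor:
  "positively_omnioriented \<Longrightarrow> p \<in> P \<Longrightarrow> interpolant_det p + (dominating_factor * all_prod p)\<^sup>2 > 0"
  using someI_ex[OF exists_dominating_factor] unfolding dominating_factor_def by blast

section \<open>The invariant 2-form in the charts\<close>

text \<open>The form over the interior of \<open>P\<close>. A tangent vector is given by its component \<open>x\<close> along \<open>P\<close> and its
  component \<open>\<theta>\<close> along the torus.\<close>
definition invariant_form ::
    "real^2 \<Rightarrow> real^2 \<Rightarrow> real^2 \<Rightarrow> real^2 \<Rightarrow> real^2 \<Rightarrow> real" where
  "invariant_form p x \<theta> x' \<theta>' = interpolant p \<theta>' \<bullet> x - interpolant p \<theta> \<bullet> x'
     + dominating_factor * all_prod p * (cross2 x x' - cross2 \<theta> \<theta>')"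

definition chart_scale :: "real^2 \<Rightarrow> (real^2) set \<Rightarrow> real" where
  "chart_scale v E = (SOME k. k > 0 \<and> (\<forall>p. h v E p = k * edge_fun E p))"

lemma chart_scale:
  assumes "v extreme_point_of P" "E edge_of P" "v \<in> E"
  shows "chart_scale v E > 0" "h v E p = chart_scale v E * edge_fun E p"
proof -
  have "\<exists>k. k > 0 \<and> (\<forall>p. h v E p = k * edge_fun E p)" using edge_fun_proportional[OF assms] by metis
  from someI_ex[OF this] have *: "chart_scale v E > 0 \<and> (\<forall>p. h v E p = chart_scale v E * edge_fun E p)"
    unfolding chart_scale_def .
  show "chart_scale v E > 0" by (rule conjunct1[OF *])
  show "h v E p = chart_scale v E * edge_fun E p" by (rule spec[OF conjunct2[OF *]])
qed

text \<open>\<open>dual1 v, dual2 v\<close> is the basis dual to the normals of the edges at \<open>v\<close>.\<close>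
definition dual1 :: "real^2 \<Rightarrow> real^2" where
  "dual1 v = (1 / cross2 (edge_normal (edge1 v)) (edge_normal (edge2 v))) *\<^sub>R
     vector [edge_normal (edge2 v) $ 2, - (edge_normal (edge2 v) $ 1)]"

definition dual2 :: "real^2 \<Rightarrow> real^2" where
  "dual2 v = (1 / cross2 (edge_normal (edge1 v)) (edge_normal (edge2 v))) *\<^sub>R
     vector [- (edge_normal (edge1 v) $ 2), edge_normal (edge1 v) $ 1]"

lemma dual_basis:
  assumes "v extreme_point_of P"
  shows "edge_normal (edge1 v) \<bullet> dual1 v = 1" "edge_normal (edge1 v) \<bullet> dual2 v = 0"
    "edge_normal (edge2 v) \<bullet> dual1 v = 0" "edge_normal (edge2 v) \<bullet> dual2 v = 1"
    "cross2 (edge_normal (edge1 v)) (edge_normal (edge2 v)) * cross2 (dual1 v) (dual2 v) = 1"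
proof -
  have c: "cross2 (edge_normal (edge1 v)) (edge_normal (edge2 v)) > 0" using vertex_edges assms by blast
  have e: "edge_normal E \<bullet> dual1 v = cross2 (edge_normal E) (edge_normal (edge2 v)) / cross2 (edge_normal (edge1 v)) (edge_normal (edge2 v))"
    "edge_normal E \<bullet> dual2 v = cross2 (edge_normal (edge1 v)) (edge_normal E) / cross2 (edge_normal (edge1 v)) (edge_normal (edge2 v))" for E
    unfolding dual1_def dual2_def inner_scaleR_right
    by (simp_all add: inner_vec_def sum_2 cross2_def mult.commute)
  show "edge_normal (edge1 v) \<bullet> dual1 v = 1" "edge_normal (edge1 v) \<bullet> dual2 v = 0"
    "edge_normal (edge2 v) \<bullet> dual1 v = 0" "edge_normal (edge2 v) \<bullet> dual2 v = 1"
    unfolding e using c by (simp_all add: cross2_simps)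
  then show "cross2 (edge_normal (edge1 v)) (edge_normal (edge2 v)) * cross2 (dual1 v) (dual2 v) = 1"
    by (simp add: cross2_Binet_Cauchy)
qed

text \<open>The base point of a chart point, recovered from \<open>\<bar>z\<^sub>i\<bar>\<^sup>2 = h v E\<^sub>i p\<close>. The formula defines a polynomial on all
  of \<open>C2\<close>.\<close>
definition base_pt :: "real^2 \<Rightarrow> C2 \<Rightarrow> real^2" where
  "base_pt v z = v + ((fst z \<bullet> fst z) / chart_scale v (edge1 v)) *\<^sub>R dual1 v
     + ((snd z \<bullet> snd z) / chart_scale v (edge2 v)) *\<^sub>R dual2 v"

definition base_der :: "real^2 \<Rightarrow> C2 \<Rightarrow> C2 \<Rightarrow> real^2" where
  "base_der v z a = (2 * (fst z \<bullet> fst a) / chart_scale v (edge1 v)) *\<^sub>R dual1 v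
     + (2 * (snd z \<bullet> snd a) / chart_scale v (edge2 v)) *\<^sub>R dual2 v"

text \<open>The differential of the angular coordinates, as a vector in the Lie algebra of the torus; meaningful
  where both coordinates of \<open>z\<close> are nonzero.\<close>
definition angle_der :: "real^2 \<Rightarrow> C2 \<Rightarrow> C2 \<Rightarrow> real^2" where
  "angle_der v z a = (Im (cnj (fst z) * fst a) / (2 * pi * (fst z \<bullet> fst z))) *\<^sub>R \<Lambda> (edge1 v)
     + (Im (cnj (snd z) * snd a) / (2 * pi * (snd z \<bullet> snd z))) *\<^sub>R \<Lambda> (edge2 v)"

lemma has_derivative_base_pt: "(base_pt v has_derivative base_der v z) (at z within S)"
  unfolding base_pt_def[abs_def] base_der_def[abs_def] divide_inverse
  by (auto intro!: derivative_eq_intros ext simp: inner_commute)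

lemma edge_fun_base_pt:
  assumes v: "v extreme_point_of P"
  shows "edge_fun (edge1 v) (base_pt v z) = (fst z \<bullet> fst z) / chart_scale v (edge1 v)"
    "edge_fun (edge2 v) (base_pt v z) = (snd z \<bullet> snd z) / chart_scale v (edge2 v)"
proof -
  have "v \<in> P" using v by (auto simp: extreme_point_of_def)
  then have "edge_fun (edge1 v) v = 0" "edge_fun (edge2 v) v = 0"
    using edge_fun_eq_0_iff vertex_edges[OF v] by blast+
  then show "edge_fun (edge1 v) (base_pt v z) = (fst z \<bullet> fst z) / chart_scale v (edge1 v)"
    "edge_fun (edge2 v) (base_pt v z) = (snd z \<bullet> snd z) / chart_scale v (edge2 v)"
    using edge_fun_affine[of "edge1 v" "base_pt v z" v] edge_fun_affine[of "edge2 v" "base_pt v z" v]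
    by (simp_all add: base_pt_def inner_add_right dual_basis[OF v])
qed

lemma base_pt_unique:
  assumes v: "v extreme_point_of P"
    and p: "edge_fun (edge1 v) p = (fst z \<bullet> fst z) / chart_scale v (edge1 v)"
    "edge_fun (edge2 v) p = (snd z \<bullet> snd z) / chart_scale v (edge2 v)"
  shows "p = base_pt v z"
proof -
  let ?q = "p - base_pt v z"
  have q: "edge_normal (edge1 v) \<bullet> ?q = 0" "edge_normal (edge2 v) \<bullet> ?q = 0"
    using p edge_fun_base_pt[OF v, of z] edge_fun_affine[of _ p "base_pt v z"] by auto
  have "cross2 (edge_normal (edge1 v)) (edge_normal (edge2 v)) * (c \<bullet> ?q) = 0" for c
    using cross2_inner_Cramer[of "edge_normal (edge1 v)" "edge_normal (edge2 v)" c ?q] q by simp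
  then have "?q \<bullet> ?q = 0" using vertex_edges(6)[OF v] by (metis less_irrefl mult_eq_0_iff)
  then show ?thesis by simp
qed

definition other_prod :: "real^2 \<Rightarrow> real^2 \<Rightarrow> real" where
  "other_prod v p = (\<Prod>F\<in>{F. F edge_of P \<and> F \<noteq> edge1 v \<and> F \<noteq> edge2 v}. edge_fun F p)"

lemma all_prod_eq:
  assumes v: "v extreme_point_of P"
  shows "all_prod p = edge_fun (edge1 v) p * edge_fun (edge2 v) p * other_prod v p"
proof -
  have "{F. F edge_of P} =
      insert (edge1 v) (insert (edge2 v) {F. F edge_of P \<and> F \<noteq> edge1 v \<and> F \<noteq> edge2 v})"
    using vertex_edges[OF v] by auto
  then show ?thesis
    unfolding all_prod_def other_prod_def
    using vertex_edges(5)[OF v] finite_edges[of "\<lambda>F. F \<noteq> edge1 v \<and> F \<noteq> edge2 v"] by simp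
qed

text \<open>The expansion of \<open>invariant_form\<close> in the chart at \<open>v\<close>, after cancellation of all negative powers of
  \<open>\<bar>z\<^sub>i\<bar>\<close>. It is polynomial in the real coordinates of \<open>z\<close>.\<close>
definition chart_form :: "real^2 \<Rightarrow> C2 \<Rightarrow> C2 \<Rightarrow> C2 \<Rightarrow> real" where
  "chart_form v z a b =
     (let p = base_pt v z; E = edge1 v; F = edge2 v; k = chart_scale v E; l = chart_scale v F;
        \<tau> = (\<lambda>a. Im (cnj (fst z) * fst a)); \<tau>' = (\<lambda>a. Im (cnj (snd z) * snd a));
        x = base_der v z
      in slope E p / (pi * k) * Im (cnj (fst a) * fst b) + slope F p / (pi * l) * Im (cnj (snd a) * snd b)
         + 1 / (2 * pi * k) * (\<tau> b * (remainder E p \<bullet> x a) - \<tau> a * (remainder E p \<bullet> x b))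
         + 1 / (2 * pi * l) * (\<tau>' b * (remainder F p \<bullet> x a) - \<tau>' a * (remainder F p \<bullet> x b))
         + dominating_factor * all_prod p * cross2 (x a) (x b)
         - dominating_factor * other_prod v p * cross2 (\<Lambda> E) (\<Lambda> F) / (4 * pi\<^sup>2 * k * l)
             * (\<tau> a * \<tau>' b - \<tau>' a * \<tau> b))"

text \<open>The identity \<open>r dr \<and> r\<^sup>2 d\<theta> = r\<^sup>2 dx \<and> dy\<close>, which cancels the singularity of the angle.\<close>
lemma complex_inner_wedge:
  "(z \<bullet> a) * Im (cnj z * b) - Im (cnj z * a) * (z \<bullet> b) = (z \<bullet> z) * Im (cnj a * b)"
  by (simp add: inner_complex_def algebra_simps)

lemma chart_form_interior:
  assumes v: "v extreme_point_of P" and z: "fst z \<noteq> 0" "snd z \<noteq> 0"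
  shows "chart_form v z a b = invariant_form (base_pt v z) (base_der v z a) (angle_der v z a)
           (base_der v z b) (angle_der v z b)"
proof -
  define E F p k l where "E = edge1 v" "F = edge2 v" "p = base_pt v z" "k = chart_scale v E" "l = chart_scale v F"
  note d = this
  define \<tau> \<tau>' where "\<tau> a = Im (cnj (fst z) * fst a)" "\<tau>' a = Im (cnj (snd z) * snd a)" for a :: C2
  define r s where "r = fst z \<bullet> fst z" "s = snd z \<bullet> snd z"
  note d' = this
  have rs: "r \<noteq> 0" "s \<noteq> 0" using z by (auto simp: d')
  have kl: "k > 0" "l > 0" using chart_scale vertex_edges[OF v] v by (auto simp: d)
  have ef: "edge_fun E p = r / k" "edge_fun F p = s / l"
    using edge_fun_base_pt[OF v, of z] by (simp_all add: d d')
  have nx: "edge_normal E \<bullet> base_der v z c = 2 * (fst z \<bullet> fst c) / k" "edge_normal F \<bullet> base_der v z c = 2 * (snd z \<bullet> snd c) / l" for c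
    by (simp_all add: d base_der_def inner_add_right dual_basis[OF v])
  have ang: "angle_der v z c = (\<tau> c / (2 * pi * r)) *\<^sub>R \<Lambda> E + (\<tau>' c / (2 * pi * s)) *\<^sub>R \<Lambda> F" for c
    by (simp add: angle_der_def d d' \<tau>_\<tau>'_def)
  have mm: "interpolant p (angle_der v z c) \<bullet> x = \<tau> c / (2 * pi * r) * (slope E p * (edge_normal E \<bullet> x) + r / k * (remainder E p \<bullet> x))
     + \<tau>' c / (2 * pi * s) * (slope F p * (edge_normal F \<bullet> x) + s / l * (remainder F p \<bullet> x))" for c x
    unfolding ang interpolant_linear using interpolant_edge vertex_edges[OF v]
    by (simp add: d(1,2) inner_add_left ef[unfolded d(1,2)])
  have cr: "cross2 (angle_der v z a) (angle_der v z b) =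
      (\<tau> a * \<tau>' b - \<tau>' a * \<tau> b) / (4 * pi\<^sup>2 * r * s) * cross2 (\<Lambda> E) (\<Lambda> F)"
    unfolding ang cross2_simps cross2_commute[of "\<Lambda> F" "\<Lambda> E"] using rs
    by (simp add: field_simps power2_eq_square)
  have w1: "(fst z \<bullet> fst a) * \<tau> b - \<tau> a * (fst z \<bullet> fst b) = r * Im (cnj (fst a) * fst b)"
    and w2: "(snd z \<bullet> snd a) * \<tau>' b - \<tau>' a * (snd z \<bullet> snd b) = s * Im (cnj (snd a) * snd b)"
    unfolding \<tau>_\<tau>'_def d' by (rule complex_inner_wedge)+
  have ap: "all_prod p = r / k * (s / l) * other_prod v p"
    unfolding all_prod_eq[OF v] using ef by (simp add: d(1,2))
  have 1: "\<tau> b / (2 * pi * r) * (C * (2 * (fst z \<bullet> fst a) / k) + r / k * X)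
      - \<tau> a / (2 * pi * r) * (C * (2 * (fst z \<bullet> fst b) / k) + r / k * Y)
      = C / (pi * k) * Im (cnj (fst a) * fst b) + 1 / (2 * pi * k) * (\<tau> b * X - \<tau> a * Y)" for C X Y
  proof -
    have "\<tau> b / (2 * pi * r) * (C * (2 * (fst z \<bullet> fst a) / k) + r / k * X)
      - \<tau> a / (2 * pi * r) * (C * (2 * (fst z \<bullet> fst b) / k) + r / k * Y)
      = C / (pi * k) * (((fst z \<bullet> fst a) * \<tau> b - \<tau> a * (fst z \<bullet> fst b)) / r) + 1 / (2 * pi * k) * (\<tau> b * X - \<tau> a * Y)"
      using kl rs by (simp add: field_simps)
    then show ?thesis unfolding w1 using rs by simp
  qed
  have 2: "\<tau>' b / (2 * pi * s) * (C * (2 * (snd z \<bullet> snd a) / l) + s / l * X)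
      - \<tau>' a / (2 * pi * s) * (C * (2 * (snd z \<bullet> snd b) / l) + s / l * Y)
      = C / (pi * l) * Im (cnj (snd a) * snd b) + 1 / (2 * pi * l) * (\<tau>' b * X - \<tau>' a * Y)" for C X Y
  proof -
    have "\<tau>' b / (2 * pi * s) * (C * (2 * (snd z \<bullet> snd a) / l) + s / l * X)
      - \<tau>' a / (2 * pi * s) * (C * (2 * (snd z \<bullet> snd b) / l) + s / l * Y)
      = C / (pi * l) * (((snd z \<bullet> snd a) * \<tau>' b - \<tau>' a * (snd z \<bullet> snd b)) / s) + 1 / (2 * pi * l) * (\<tau>' b * X - \<tau>' a * Y)"
      using kl rs by (simp add: field_simps)
    then show ?thesis unfolding w2 using rs by simp
  qed
  have 3: "dominating_factor * all_prod p * ((\<tau> a * \<tau>' b - \<tau>' a * \<tau> b) / (4 * pi\<^sup>2 * r * s) * cross2 (\<Lambda> E) (\<Lambda> F))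
      = dominating_factor * other_prod v p * cross2 (\<Lambda> E) (\<Lambda> F) / (4 * pi\<^sup>2 * k * l) * (\<tau> a * \<tau>' b - \<tau>' a * \<tau> b)"
    unfolding ap using kl rs by (simp add: field_simps)
  have arith: "x + x' - (y + y') + q = u + u' + q" if "x - y = u" "x' - y' = u'" for x x' y y' u u' q :: real
    using that by simp
  have "invariant_form p (base_der v z a) (angle_der v z a) (base_der v z b) (angle_der v z b) =
     slope E p / (pi * k) * Im (cnj (fst a) * fst b) + 1 / (2 * pi * k) * (\<tau> b * (remainder E p \<bullet> base_der v z a) - \<tau> a * (remainder E p \<bullet> base_der v z b))
   + (slope F p / (pi * l) * Im (cnj (snd a) * snd b) + 1 / (2 * pi * l) * (\<tau>' b * (remainder F p \<bullet> base_der v z a) - \<tau>' a * (remainder F p \<bullet> base_der v z b)))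
   + (dominating_factor * all_prod p * cross2 (base_der v z a) (base_der v z b)
   - dominating_factor * other_prod v p * cross2 (\<Lambda> E) (\<Lambda> F) / (4 * pi\<^sup>2 * k * l) * (\<tau> a * \<tau>' b - \<tau>' a * \<tau> b))"
    unfolding invariant_form_def mm nx right_diff_distrib[of "dominating_factor * all_prod p"] cr 3
    by (rule arith[OF 1 2])
  then show ?thesis unfolding chart_form_def Let_def by (simp add: d \<tau>_\<tau>'_def)
qed

text \<open>Up to a positive factor the Pfaffian in the chart is the Pfaffian of the invariant form in the
  coordinates \<open>(p, q)\<close>, because \<open>(p, q) \<mapsto> z\<close> multiplies the volume by a constant. Hence one computation
  covers the interior, the edges and the vertices.\<close>
lemma nondegenerate_chart_form_at:
  assumes pos: positively_omnioriented and v: "v extreme_point_of P" and p: "base_pt v z \<in> P"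
  shows "nondegenerate (chart_form v z)"
proof -
  define E F p k l where "E = edge1 v" "F = edge2 v" "p = base_pt v z" "k = chart_scale v E" "l = chart_scale v F"
  note d = this
  define r s where "r = fst z \<bullet> fst z" "s = snd z \<bullet> snd z"
  note d' = this
  have kl: "k > 0" "l > 0" using chart_scale vertex_edges[OF v] v by (auto simp: d)
  have ef: "edge_fun E p = r / k" "edge_fun F p = s / l"
    using edge_fun_base_pt[OF v, of z] by (simp_all add: d d')
  define B C where "B = remainder E p" "C = remainder F p"
  note bc = this
  let ?m1 = "slope E p / (pi * k) + r * (B \<bullet> dual1 v) / (pi * k\<^sup>2)"
  let ?m2 = "slope F p / (pi * l) + s * (C \<bullet> dual2 v) / (pi * l\<^sup>2)"
  let ?\<beta> = "B \<bullet> dual2 v / (pi * k * l)" let ?\<gamma> = "C \<bullet> dual1 v / (pi * k * l)"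
  let ?s = "dominating_factor * all_prod p * (4 * cross2 (dual1 v) (dual2 v) / (k * l))"
  let ?t = "- (dominating_factor * other_prod v p * cross2 (\<Lambda> E) (\<Lambda> F) / (4 * pi\<^sup>2 * k * l))"
  show ?thesis
  proof (rule nondegenerate_chart_form[where m\<^sub>1 = ?m1 and m\<^sub>2 = ?m2 and \<beta> = ?\<beta> and \<gamma> = ?\<gamma> and s = ?s and t = ?t and z = z])
    fix a b :: C2
    define \<tau> \<tau>' where "\<tau> a = Im (cnj (fst z) * fst a)" "\<tau>' a = Im (cnj (snd z) * snd a)" for a :: C2
    define \<sigma> \<sigma>' where "\<sigma> a = fst z \<bullet> fst a" "\<sigma>' a = snd z \<bullet> snd a" for a :: C2
    have x: "base_der v z a = (2 * \<sigma> a / k) *\<^sub>R dual1 v + (2 * \<sigma>' a / l) *\<^sub>R dual2 v" for a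
      by (simp add: base_der_def \<sigma>_\<sigma>'_def d)
    have w1: "r * Im (cnj (fst a) * fst b) = \<sigma> a * \<tau> b - \<tau> a * \<sigma> b"
      and w2: "s * Im (cnj (snd a) * snd b) = \<sigma>' a * \<tau>' b - \<tau>' a * \<sigma>' b"
      unfolding \<tau>_\<tau>'_def \<sigma>_\<sigma>'_def d' by (rule complex_inner_wedge[symmetric])+
    have m1: "?m1 * Im (cnj (fst a) * fst b) = slope E p / (pi * k) * Im (cnj (fst a) * fst b)
        + (\<sigma> a * \<tau> b - \<tau> a * \<sigma> b) * (B \<bullet> dual1 v) / (pi * k\<^sup>2)"
      unfolding w1[symmetric] by (simp add: algebra_simps)
    have m2: "?m2 * Im (cnj (snd a) * snd b) = slope F p / (pi * l) * Im (cnj (snd a) * snd b)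
        + (\<sigma>' a * \<tau>' b - \<tau>' a * \<sigma>' b) * (C \<bullet> dual2 v) / (pi * l\<^sup>2)"
      unfolding w2[symmetric] by (simp add: algebra_simps)
    have c: "cross2 (base_der v z a) (base_der v z b) = 4 * cross2 (dual1 v) (dual2 v) / (k * l) * (\<sigma> a * \<sigma>' b - \<sigma>' a * \<sigma> b)"
      unfolding x cross2_simps cross2_commute[of "dual2 v" "dual1 v"] using kl by (simp add: field_simps)
    have rB: "1 / (2 * pi * k) * (\<tau> b * (B \<bullet> base_der v z a) - \<tau> a * (B \<bullet> base_der v z b)) =
        (\<sigma> a * \<tau> b - \<tau> a * \<sigma> b) * (B \<bullet> dual1 v) / (pi * k\<^sup>2) + ?\<beta> * (\<sigma>' a * \<tau> b - \<tau> a * \<sigma>' b)"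
      unfolding x inner_add_right inner_scaleR_right using kl by (simp add: field_simps power2_eq_square)
    have rC: "1 / (2 * pi * l) * (\<tau>' b * (C \<bullet> base_der v z a) - \<tau>' a * (C \<bullet> base_der v z b)) =
        (\<sigma>' a * \<tau>' b - \<tau>' a * \<sigma>' b) * (C \<bullet> dual2 v) / (pi * l\<^sup>2) + ?\<gamma> * (\<sigma> a * \<tau>' b - \<tau>' a * \<sigma> b)"
      unfolding x inner_add_right inner_scaleR_right using kl by (simp add: field_simps power2_eq_square)
    have "chart_form v z a b = slope E p / (pi * k) * Im (cnj (fst a) * fst b) + slope F p / (pi * l) * Im (cnj (snd a) * snd b)
         + 1 / (2 * pi * k) * (\<tau> b * (B \<bullet> base_der v z a) - \<tau> a * (B \<bullet> base_der v z b))
         + 1 / (2 * pi * l) * (\<tau>' b * (C \<bullet> base_der v z a) - \<tau>' a * (C \<bullet> base_der v z b))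
         + dominating_factor * all_prod p * cross2 (base_der v z a) (base_der v z b)
         + ?t * (\<tau> a * \<tau>' b - \<tau>' a * \<tau> b)"
      unfolding chart_form_def Let_def by (simp add: d \<tau>_\<tau>'_def bc)
    also have "\<dots> = ?m1 * Im (cnj (fst a) * fst b) + ?m2 * Im (cnj (snd a) * snd b)
      + ?\<beta> * (\<sigma>' a * \<tau> b - \<tau> a * \<sigma>' b) + ?\<gamma> * (\<sigma> a * \<tau>' b - \<tau>' a * \<sigma> b)
      + ?s * (\<sigma> a * \<sigma>' b - \<sigma>' a * \<sigma> b) + ?t * (\<tau> a * \<tau>' b - \<tau>' a * \<tau> b)"
      unfolding rB rC m1 m2 c by simp
    finally show "chart_form v z a b = ?m1 * Im (cnj (fst a) * fst b) + ?m2 * Im (cnj (snd a) * snd b)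
      + ?\<beta> * ((snd z \<bullet> snd a) * Im (cnj (fst z) * fst b) - Im (cnj (fst z) * fst a) * (snd z \<bullet> snd b))
      + ?\<gamma> * ((fst z \<bullet> fst a) * Im (cnj (snd z) * snd b) - Im (cnj (snd z) * snd a) * (fst z \<bullet> fst b))
      + ?s * ((fst z \<bullet> fst a) * (snd z \<bullet> snd b) - (snd z \<bullet> snd a) * (fst z \<bullet> fst b))
      + ?t * (Im (cnj (fst z) * fst a) * Im (cnj (snd z) * snd b)
             - Im (cnj (snd z) * snd a) * Im (cnj (fst z) * fst b))"
      unfolding \<tau>_\<tau>'_def \<sigma>_\<sigma>'_def .
  next
    let ?D = "cross2 (\<Lambda> E) (\<Lambda> F)" let ?d = "cross2 (dual1 v) (dual2 v)"
    have M: "interpolant p (\<Lambda> E) = slope E p *\<^sub>R edge_normal E + (r / k) *\<^sub>R B" "interpolant p (\<Lambda> F) = slope F p *\<^sub>R edge_normal F + (s / l) *\<^sub>R C"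
      using interpolant_edge vertex_edges[OF v] ef by (auto simp: d(1,2) bc)
    have Md: "interpolant p (\<Lambda> E) \<bullet> dual1 v = slope E p + (r / k) * (B \<bullet> dual1 v)" "interpolant p (\<Lambda> E) \<bullet> dual2 v = (r / k) * (B \<bullet> dual2 v)"
      "interpolant p (\<Lambda> F) \<bullet> dual1 v = (s / l) * (C \<bullet> dual1 v)" "interpolant p (\<Lambda> F) \<bullet> dual2 v = slope F p + (s / l) * (C \<bullet> dual2 v)"
      unfolding M by (simp_all add: inner_add_left dual_basis[OF v] d(1,2))
    have det: "interpolant_det p * ?D * ?d = (slope E p + (r / k) * (B \<bullet> dual1 v)) * (slope F p + (s / l) * (C \<bullet> dual2 v))
        - (r / k) * (B \<bullet> dual2 v) * ((s / l) * (C \<bullet> dual1 v))"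
      unfolding cross2_interpolant[symmetric] cross2_Binet_Cauchy Md by simp
    have ap: "all_prod p = r / k * (s / l) * other_prod v p"
      unfolding all_prod_eq[OF v] using ef by (simp add: d(1,2))
    have "(pi\<^sup>2 * k * l) * (?m1 * ?m2 - r * s * (?\<beta> * ?\<gamma> + ?s * ?t))
      = ((slope E p + (r / k) * (B \<bullet> dual1 v)) * (slope F p + (s / l) * (C \<bullet> dual2 v))
        - (r / k) * (B \<bullet> dual2 v) * ((s / l) * (C \<bullet> dual1 v)))
        + dominating_factor\<^sup>2 * all_prod p * (r / k * (s / l) * other_prod v p) * ?D * ?d"
      using kl by (simp add: field_simps power2_eq_square)
    also have "\<dots> = ?D * ?d * (interpolant_det p + (dominating_factor * all_prod p)\<^sup>2)"
      unfolding det[symmetric] ap[symmetric] by (simp add: algebra_simps power2_eq_square)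
    finally have e: "(pi\<^sup>2 * k * l) * (?m1 * ?m2 - r * s * (?\<beta> * ?\<gamma> + ?s * ?t)) = ?D * ?d * (interpolant_det p + (dominating_factor * all_prod p)\<^sup>2)" .
    have "?D \<noteq> 0" using cross2_\<Lambda>_nz[OF v] by (simp add: d)
    moreover have "?d \<noteq> 0" using dual_basis(5)[OF v] by auto
    moreover have "interpolant_det p + (dominating_factor * all_prod p)\<^sup>2 > 0"
      using dominating_factor[OF pos] assms(3) by (simp add: d)
    ultimately have "?D * ?d * (interpolant_det p + (dominating_factor * all_prod p)\<^sup>2) \<noteq> 0" by simp
    then have "?m1 * ?m2 - r * s * (?\<beta> * ?\<gamma> + ?s * ?t) \<noteq> 0" using e by auto
    then show "?m1 * ?m2 - (cmod (fst z))\<^sup>2 * (cmod (snd z))\<^sup>2 * (?\<beta> * ?\<gamma> + ?s * ?t) \<noteq> 0"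
      by (simp add: d' power2_norm_eq_inner)
  qed
qed

end

section \<open>Tori and orbits\<close>

text \<open>The tori are defined as quotient groups; the lemmas below translate their operations to explicit
  cosets, with which the equivalence classes of the orbifold can be written down.\<close>
definition additive_subgroup :: "(real^2) set \<Rightarrow> bool" where
  "additive_subgroup M \<longleftrightarrow> 0 \<in> M \<and> (\<forall>x\<in>M. \<forall>y\<in>M. x + y \<in> M) \<and> (\<forall>x\<in>M. - x \<in> M)"

lemma additive_subgroup_diff: "additive_subgroup M \<Longrightarrow> x \<in> M \<Longrightarrow> y \<in> M \<Longrightarrow> x - y \<in> M"
  unfolding additive_subgroup_def by (metis add_uminus_conv_diff)

definition coset :: "(real^2) set \<Rightarrow> real^2 \<Rightarrow> (real^2) set" where
  "coset M x = (\<lambda>m. m + x) ` M"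

lemma mem_coset_iff: "y \<in> coset M x \<longleftrightarrow> y - x \<in> M"
  by (auto simp: coset_def image_iff algebra_simps) (metis diff_add_cancel)

lemma coset_eq_iff:
  assumes "additive_subgroup M"
  shows "coset M x = coset M y \<longleftrightarrow> x - y \<in> M"
proof
  assume "coset M x = coset M y"
  moreover have "x \<in> coset M x" using assms by (simp add: mem_coset_iff additive_subgroup_def)
  ultimately show "x - y \<in> M" by (simp add: mem_coset_iff)
next
  assume xy: "x - y \<in> M"
  show "coset M x = coset M y"
  proof (rule Set.set_eqI)
    fix z
    have "z - y = (z - x) + (x - y)" "z - x = (z - y) - (x - y)" by auto
    then show "z \<in> coset M x \<longleftrightarrow> z \<in> coset M y"
      using xy assms additive_subgroup_diff[OF assms]
      unfolding mem_coset_iff additive_subgroup_def by metis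
  qed
qed

lemma group_vec_group: "comm_group (vec_group (span M))"
  unfolding vec_group_def
  by (rule comm_groupI) (auto simp: span_add span_zero intro!: bexI[of _ "- _"] span_neg)

lemma normal_vec_group:
  assumes "additive_subgroup M"
  shows "M \<lhd> vec_group (span M)"
proof -
  interpret comm_group "vec_group (span M)" by (rule group_vec_group)
  have "inv\<^bsub>vec_group (span M)\<^esub> x = - x" if "x \<in> span M" for x
    by (rule inv_equality) (use that span_neg in \<open>auto simp: vec_group_def\<close>)
  then have "subgroup M (vec_group (span M))"
    by (intro subgroupI) (use assms in \<open>auto simp: vec_group_def additive_subgroup_def span_base\<close>)
  then show ?thesis by (rule subgroup_imp_normal)
qed

lemma torus_carrier: "carrier (torus M) = coset M ` span M"
  by (auto simp: torus_def carrier_FactGroup r_coset_def vec_group_def coset_def)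

lemma torus_mult:
  assumes "additive_subgroup M"
  shows "coset M x \<otimes>\<^bsub>torus M\<^esub> coset M y = coset M (x + y)"
proof -
  have "z \<in> coset M (x + y) \<longleftrightarrow> (\<exists>a\<in>coset M x. \<exists>b\<in>coset M y. z = a + b)" for z
  proof
    assume "z \<in> coset M (x + y)"
    then have "z - y \<in> coset M x" "y \<in> coset M y"
      using assms by (auto simp: mem_coset_iff additive_subgroup_def algebra_simps)
    then show "\<exists>a\<in>coset M x. \<exists>b\<in>coset M y. z = a + b"
      by (intro bexI[of _ "z - y"] bexI[of _ y]) auto
  next
    assume "\<exists>a\<in>coset M x. \<exists>b\<in>coset M y. z = a + b"
    then obtain a b where ab: "a - x \<in> M" "b - y \<in> M" "z = a + b" by (auto simp: mem_coset_iff)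
    then have "(a - x) + (b - y) \<in> M" using assms by (simp add: additive_subgroup_def)
    then show "z \<in> coset M (x + y)" by (simp add: mem_coset_iff ab algebra_simps)
  qed
  then show ?thesis by (auto simp: torus_def set_mult_def vec_group_def)
qed

lemma torus_inv:
  assumes M: "additive_subgroup M" and x: "x \<in> span M"
  shows "inv\<^bsub>torus M\<^esub> coset M x = coset M (- x)"
proof -
  interpret normal M "vec_group (span M)" by (rule normal_vec_group[OF M])
  interpret T: group "torus M" unfolding torus_def by (rule factorgroup_is_group)
  have "coset M 0 = M" by (simp add: coset_def)
  then have "\<one>\<^bsub>torus M\<^esub> = coset M 0" by (simp add: torus_def)
  then show ?thesis
    by (intro T.inv_equality) (auto simp: torus_mult[OF M] torus_carrier x span_neg)
qed

lemma torus_hom_coset: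
  assumes M: "additive_subgroup M" and L: "0 \<in> L" "L \<subseteq> M"
  shows "torus_hom M (coset L x) = coset M x"
proof -
  have "z \<in> coset M x \<longleftrightarrow> (\<exists>a\<in>M. \<exists>b\<in>coset L x. z = a + b)" for z
  proof
    assume "z \<in> coset M x"
    then show "\<exists>a\<in>M. \<exists>b\<in>coset L x. z = a + b"
      using L by (intro bexI[of _ "z - x"] bexI[of _ x]) (auto simp: mem_coset_iff)
  next
    assume "\<exists>a\<in>M. \<exists>b\<in>coset L x. z = a + b"
    then obtain a b where ab: "a \<in> M" "b - x \<in> M" "z = a + b" using L by (auto simp: mem_coset_iff)
    then have "a + (b - x) \<in> M" using M by (simp add: additive_subgroup_def)
    then show "z \<in> coset M x" by (simp add: mem_coset_iff ab algebra_simps)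
  qed
  then show ?thesis by (auto simp: torus_hom_def set_mult_def vec_group_def)
qed

lemma module_int: "module (\<lambda>(k::int) (x::real^2). of_int k *\<^sub>R x)"
  by unfold_locales (auto simp: algebra_simps)

lemma additive_subgroup_int_span: "additive_subgroup (int_span S)"
  unfolding additive_subgroup_def int_span_def
  using module.span_zero[OF module_int] module.span_add[OF module_int] module.span_neg[OF module_int]
  by blast

lemma int_span_base: "x \<in> S \<Longrightarrow> x \<in> int_span S"
  unfolding int_span_def by (rule module.span_base[OF module_int])

lemma int_span_minimal:
  assumes "S \<subseteq> T" "additive_subgroup T"
  shows "int_span S \<subseteq> T"
proof -
  have nat: "of_nat n *\<^sub>R x \<in> T" if "x \<in> T" for n x
    using assms(2) that by (induction n) (auto simp: additive_subgroup_def algebra_simps)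
  have "of_int k *\<^sub>R x \<in> T" if x: "x \<in> T" for k x
  proof (cases k)
    case (nonneg n) then show ?thesis using nat[OF x, of n] by simp
  next
    case (neg n)
    then have "real_of_int k = - real (Suc n)" by simp
    then have "of_int k *\<^sub>R x = - (of_nat (Suc n) *\<^sub>R x)" by (simp only: scaleR_minus_left)
    then show ?thesis using nat[OF x, of "Suc n"] assms(2) unfolding additive_subgroup_def by metis
  qed
  then have "module.subspace (\<lambda>(k::int) (x::real^2). of_int k *\<^sub>R x) T"
    using assms(2) by (auto simp: module.subspace_def[OF module_int] additive_subgroup_def)
  then show ?thesis
    unfolding int_span_def by (rule module.span_minimal[OF module_int assms(1)])
qed

lemma additive_subgroup_span: "additive_subgroup (span S)"
  by (auto simp: additive_subgroup_def span_zero span_add span_neg)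

lemma span_int_span: "span (int_span S) = span S"
proof
  have "int_span S \<subseteq> span S" by (rule int_span_minimal[OF span_superset additive_subgroup_span])
  then show "span (int_span S) \<subseteq> span S" by (metis span_mono span_span)
  show "span S \<subseteq> span (int_span S)" by (rule span_mono) (auto intro: int_span_base)
qed

lemma mem_int_span_two:
  "x \<in> int_span {a, b} \<longleftrightarrow> (\<exists>k l :: int. x = of_int k *\<^sub>R a + of_int l *\<^sub>R b)" (is "?L \<longleftrightarrow> ?R")
proof
  assume ?L
  then obtain k l :: int where "x - of_int k *\<^sub>R a - of_int l *\<^sub>R b = 0"
    unfolding int_span_def module.span_insert[OF module_int] module.span_empty[OF module_int]
    by (auto simp: module.span_insert[OF module_int] module.span_empty[OF module_int])
  then show ?R by (intro exI[of _ k] exI[of _ l]) (simp add: algebra_simps)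
next
  assume ?R
  then show ?L unfolding int_span_def
    using module.span_add[OF module_int] module.span_scale[OF module_int] module.span_base[OF module_int]
    by (metis insertI1 insertI2 singletonI)
qed

lemma additive_subgroup_std_lattice: "additive_subgroup std_lattice"
  by (auto simp: additive_subgroup_def std_lattice_def)

lemma cis_2pi_eq_iff: "cis (2 * pi * q) = cis (2 * pi * r) \<longleftrightarrow> q - r \<in> \<int>"
proof
  assume "cis (2 * pi * q) = cis (2 * pi * r)"
  then have "cis (2 * pi * q) / cis (2 * pi * r) = 1" by simp
  then have "cis (2 * pi * (q - r)) = 1" by (simp add: cis_divide algebra_simps)
  then have "cos (2 * pi * (q - r)) = 1" by (metis cis.sel(1) one_complex.sel(1))
  then obtain n :: int where "2 * pi * (q - r) = of_int n * 2 * pi" by (auto simp: cos_one_2pi_int)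
  then have "q - r = of_int n" by simp
  then show "q - r \<in> \<int>" by simp
next
  assume "q - r \<in> \<int>"
  then have "cis (2 * pi * (q - r)) = 1" by simp
  then have "cis (2 * pi * r + 2 * pi * (q - r)) = cis (2 * pi * r)" by (simp flip: cis_mult)
  then show "cis (2 * pi * q) = cis (2 * pi * r)" by (simp add: algebra_simps)
qed

context primitive_quasitoric
begin

text \<open>The Lie algebra of the stabiliser of the points over \<open>p\<close>.\<close>
definition stab :: "real^2 \<Rightarrow> (real^2) set" where
  "stab p = span {\<Lambda> E |E. E edge_of P \<and> p \<in> E}"

text \<open>The equivalence class of \<open>(p, x + M)\<close>, as a point of \<open>X\<close> for \<open>M = std_lattice\<close> and of \<open>Xt v\<close> for
  \<open>M = Nv v\<close>.\<close>
definition orbit :: "(real^2) set \<Rightarrow> real^2 \<Rightarrow> real^2 \<Rightarrow> orbit_class" where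
  "orbit M p x = {(p, coset M (x + s)) |s. s \<in> stab p}"

lemma stab_simps: "0 \<in> stab p" "x \<in> stab p \<Longrightarrow> y \<in> stab p \<Longrightarrow> x + y \<in> stab p"
  "x \<in> stab p \<Longrightarrow> y \<in> stab p \<Longrightarrow> x - y \<in> stab p" "x \<in> stab p \<Longrightarrow> - x \<in> stab p"
  unfolding stab_def by (auto intro: span_zero span_add span_diff span_neg)

lemma orbit_eq_iff:
  assumes M: "additive_subgroup M"
  shows "orbit M p x = orbit M q y \<longleftrightarrow> p = q \<and> (\<exists>s\<in>stab p. x - y - s \<in> M)"
proof
  assume eq: "orbit M p x = orbit M q y"
  have "(p, coset M (x + 0)) \<in> orbit M p x" using stab_simps(1) unfolding orbit_def by blast
  then obtain s where s: "p = q" "s \<in> stab q" "coset M x = coset M (y + s)"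
    unfolding eq by (auto simp: orbit_def)
  then have "x - y - s \<in> M" using coset_eq_iff[OF M] by (simp add: algebra_simps)
  then show "p = q \<and> (\<exists>s\<in>stab p. x - y - s \<in> M)" using s by auto
next
  assume "p = q \<and> (\<exists>s\<in>stab p. x - y - s \<in> M)"
  then obtain s where s: "p = q" "s \<in> stab p" "x - y - s \<in> M" by auto
  have "coset M (x + t) = coset M (y + (s + t))" for t
    using s coset_eq_iff[OF M] by (simp add: algebra_simps)
  moreover have "coset M (y + t) = coset M (x + (t - s))" for t
    using calculation[of "t - s"] by simp
  ultimately show "orbit M p x = orbit M q y"
    using s stab_simps unfolding orbit_def by (safe; metis)
qed

lemma face_lattice_face_at:
  assumes "p \<in> P"
  shows "face_lattice (face_at p) = int_span {\<Lambda> E |E. E edge_of P \<and> p \<in> E}"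
  unfolding face_lattice_def using face_at_subset_iff[OF assms]
  by (intro arg_cong[where f=int_span]) auto

lemma span_face_lattice:
  "p \<in> P \<Longrightarrow> span (face_lattice (face_at p)) = stab p"
  by (simp add: face_lattice_face_at stab_def span_int_span)

lemma orbit_space_eq:
  assumes M: "additive_subgroup M" "span M = UNIV" and W: "W \<subseteq> P"
    and sub: "\<And>p. p \<in> W \<Longrightarrow> face_lattice (face_at p) \<subseteq> M"
  shows "orbit_space W M = {orbit M p x |p x. p \<in> W}"
proof -
  have cl: "orbit_rel W M `` {(p, coset M x)} = orbit M p x" if p: "p \<in> W" for p x
  proof -
    let ?L = "face_lattice (face_at p)"
    have pP: "p \<in> P" using p W by auto
    have L0: "0 \<in> ?L" using additive_subgroup_int_span unfolding face_lattice_def additive_subgroup_def by blast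
    have im: "torus_hom M ` coset ?L ` span ?L = coset M ` stab p"
      unfolding span_face_lattice[OF pP] image_image
      using torus_hom_coset[OF M(1) L0 sub[OF p]] by simp
    have r: "((p, coset M x), (p, coset M y)) \<in> orbit_rel W M \<longleftrightarrow> (\<exists>s\<in>stab p. coset M y = coset M (x + s))" for y
    proof -
      have "((p, coset M x), (p, coset M y)) \<in> orbit_rel W M \<longleftrightarrow> coset M (x - y) \<in> coset M ` stab p"
        using p by (simp add: orbit_rel_def im torus_inv[OF M(1)] torus_mult[OF M(1)] torus_carrier M(2))
      also have "\<dots> \<longleftrightarrow> (\<exists>s\<in>stab p. x - y - s \<in> M)" using coset_eq_iff[OF M(1)] by auto
      also have "\<dots> \<longleftrightarrow> (\<exists>s\<in>stab p. coset M y = coset M (x + s))"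
      proof
        assume "\<exists>s\<in>stab p. x - y - s \<in> M"
        then obtain s where s: "s \<in> stab p" "x - y - s \<in> M" by auto
        then have "- (x - y - s) \<in> M" using M(1) unfolding additive_subgroup_def by blast
        then have "coset M y = coset M (x + - s)" using coset_eq_iff[OF M(1)] by (simp add: algebra_simps)
        then show "\<exists>s\<in>stab p. coset M y = coset M (x + s)" using s stab_simps by blast
      next
        assume "\<exists>s\<in>stab p. coset M y = coset M (x + s)"
        then obtain s where s: "s \<in> stab p" "y - (x + s) \<in> M" using coset_eq_iff[OF M(1)] by auto
        then have "- (y - (x + s)) \<in> M" using M(1) unfolding additive_subgroup_def by blast
        then have "x - y - (- s) \<in> M" by (simp add: algebra_simps)
        then show "\<exists>s\<in>stab p. x - y - s \<in> M" using s stab_simps by blast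
      qed
      finally show ?thesis .
    qed
    show ?thesis
    proof (rule Set.set_eqI, clarify)
      fix q t
      show "(q, t) \<in> orbit_rel W M `` {(p, coset M x)} \<longleftrightarrow> (q, t) \<in> orbit M p x"
      proof
        assume a: "(q, t) \<in> orbit_rel W M `` {(p, coset M x)}"
        then have "q = p" "t \<in> carrier (torus M)" by (auto simp: orbit_rel_def)
        then obtain y where "t = coset M y" by (auto simp: torus_carrier)
        then show "(q, t) \<in> orbit M p x" using a r[of y] \<open>q = p\<close> by (auto simp: orbit_def)
      next
        assume "(q, t) \<in> orbit M p x"
        then show "(q, t) \<in> orbit_rel W M `` {(p, coset M x)}" using r by (auto simp: orbit_def)
      qed
    qed
  qed
  show ?thesis
    unfolding orbit_space_def quotient_def torus_carrier M(2) using cl by fastforce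
qed

lemma act_orbit:
  assumes "additive_subgroup M"
  shows "act M (coset M t) (orbit M p x) = orbit M p (t + x)"
proof -
  have "act M (coset M t) (orbit M p x) = {(p, coset M t \<otimes>\<^bsub>torus M\<^esub> coset M (x + s)) |s. s \<in> stab p}"
    unfolding act_def orbit_def Setcompr_eq_image image_image by simp
  then show ?thesis by (simp add: torus_mult[OF assms] orbit_def add.assoc)
qed

lemma base_orbit: "base (orbit M p x) = p"
  unfolding base_def orbit_def using stab_simps(1) by (intro the_equality) auto

lemma \<xi>_orbit:
  assumes "additive_subgroup M" "M \<subseteq> std_lattice"
  shows "\<xi> (orbit M p x) = orbit std_lattice p x"
proof -
  have 0: "0 \<in> M" using assms by (simp add: additive_subgroup_def)
  have "\<xi> (orbit M p x) = {(p, torus_hom std_lattice (coset M (x + s))) |s. s \<in> stab p}"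
    unfolding \<xi>_def orbit_def Setcompr_eq_image image_image by simp
  then show ?thesis
    by (simp add: torus_hom_coset[OF additive_subgroup_std_lattice 0 assms(2)] orbit_def)
qed

lemma stab_interior:
  assumes "p \<in> interior P"
  shows "stab p = {0}"
proof -
  have p: "p \<in> P" using assms interior_subset by blast
  have "p \<notin> E" if "E edge_of P" for E
    using edge_fun_pos_interior[OF that assms] edge_fun_eq_0_iff[OF that p] by simp
  then have "{\<Lambda> E |E. E edge_of P \<and> p \<in> E} = {}" by blast
  then show ?thesis unfolding stab_def by (simp only: span_empty)
qed

lemma \<Lambda>_std_lattice: "E edge_of P \<Longrightarrow> \<Lambda> E \<in> std_lattice"
  using primitive by (auto simp: primitive_vector_def)

lemma act_std_orbit_exists:
  assumes "t \<in> carrier (torus std_lattice)"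
  obtains y where "\<And>p x. act std_lattice t (orbit std_lattice p x) = orbit std_lattice p (y + x)"
proof -
  obtain y where "t = coset std_lattice y" using assms by (auto simp: torus_carrier)
  then show ?thesis using that act_orbit[OF additive_subgroup_std_lattice] by simp
qed

end

section \<open>Angles and chart coordinates\<close>

text \<open>The function is a branch of the angular coordinate that is smooth near \<open>z\<close>, wherever \<open>z\<close> lies
  relative to the cut of the argument.\<close>
lemma has_derivative_angle:
  assumes "z \<noteq> 0"
  shows "((\<lambda>w. (Arg z + Im (Ln (w / z))) / (2 * pi)) has_derivative
     (\<lambda>a. Im (cnj z * a) / (2 * pi * (z \<bullet> z)))) (at z)"
proof -
  have "((\<lambda>w. Ln (w / z)) has_field_derivative (1 / z)) (at z)"
    using assms by (auto intro!: derivative_eq_intros simp: complex_nonpos_Reals_iff)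
  then have "((\<lambda>w. Ln (w / z)) has_derivative (\<lambda>a. 1 / z * a)) (at z)"
    unfolding has_field_derivative_def .
  then have "((\<lambda>w. Im (Ln (w / z))) has_derivative (\<lambda>a. Im (1 / z * a))) (at z)"
    by (rule has_derivative_Im)
  then have "((\<lambda>w. Arg z + Im (Ln (w / z))) has_derivative (\<lambda>a. 0 + Im (1 / z * a))) (at z)"
    by (intro has_derivative_add has_derivative_const)
  from has_derivative_mult_left[OF this, of "1 / (2 * pi)"]
  have "((\<lambda>w. (Arg z + Im (Ln (w / z))) / (2 * pi)) has_derivative
      (\<lambda>a. Im (1 / z * a) / (2 * pi))) (at z)"
    unfolding times_divide_eq_right mult_1_right add_0_left .
  moreover have "Im (1 / z * a) / (2 * pi) = Im (cnj z * a) / (2 * pi * (z \<bullet> z))" for a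
  proof -
    have "1 / z = cnj z / of_real (z \<bullet> z)"
      using assms by (simp add: field_simps complex_norm_square[symmetric] flip: power2_norm_eq_inner)
    then have "1 / z * a = (cnj z * a) / of_real (z \<bullet> z)" by simp
    then show ?thesis by (simp only: Im_divide_of_real divide_divide_eq_left mult.commute)
  qed
  ultimately show ?thesis by (simp only:)
qed

lemma angle_branch:
  assumes "z \<noteq> 0" "w \<noteq> 0"
  shows "w = of_real (cmod w) * cis (2 * pi * ((Arg z + Im (Ln (w / z))) / (2 * pi)))"
proof -
  have "exp (Ln (w / z)) = w / z" using assms by simp
  then have "cis (Im (Ln (w / z))) = sgn (w / z)"
    using assms by (metis Arg_eq_Im_Ln cis_Arg divide_eq_0_iff)
  then have "cis (Arg z + Im (Ln (w / z))) = sgn z * sgn (w / z)"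
    using assms by (simp add: cis_Arg flip: cis_mult)
  also have "z * (w / z) = w" using assms by simp
  then have "sgn z * sgn (w / z) = sgn w" by (metis sgn_mult)
  finally show ?thesis by (simp add: sgn_eq) 
qed

text \<open>Discreteness of the lattice: a continuous map into it is locally constant.\<close>
lemma std_lattice_small_0:
  assumes "x \<in> std_lattice" "norm x < 1"
  shows "x = 0"
proof -
  have "x $ i = 0" for i
    using assms component_le_norm_cart[of x i] Ints_nonzero_abs_less1[of "x $ i"]
    by (auto simp: std_lattice_def)
  then show ?thesis by (simp add: vec_eq_iff)
qed

lemma smooth_on_vec_nth:
  fixes f :: "_ \<Rightarrow> real^'n"
  shows "open S \<Longrightarrow> smooth_on S f \<Longrightarrow> smooth_on S (\<lambda>z. f z $ i)"
  using smooth_on_inner[of S f "\<lambda>z. axis i 1"] by (simp add: smooth_on_const inner_axis)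

lemma smooth_on_cross2:
  "open S \<Longrightarrow> smooth_on S f \<Longrightarrow> smooth_on S g \<Longrightarrow> smooth_on S (\<lambda>z. cross2 (f z) (g z))"
  unfolding cross2_def by (intro smooth_on_intros smooth_on_vec_nth)

context primitive_quasitoric
begin

lemma additive_subgroup_Nv: "additive_subgroup (Nv v)"
  unfolding Nv_def face_lattice_def by (rule additive_subgroup_int_span)

lemma Nv_subset_std_lattice: "Nv v \<subseteq> std_lattice"
  unfolding Nv_def face_lattice_def
  by (rule int_span_minimal[OF _ additive_subgroup_std_lattice]) (auto simp: \<Lambda>_std_lattice)

lemma Nv_eq:
  assumes "v extreme_point_of P"
  shows "Nv v = int_span {\<Lambda> (edge1 v), \<Lambda> (edge2 v)}"
proof -
  have "{\<Lambda> E |E. E edge_of P \<and> {v} \<subseteq> E} = {\<Lambda> (edge1 v), \<Lambda> (edge2 v)}"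
    using vertex_edges[OF assms] vertex_edges_only[OF assms] by blast
  then show ?thesis by (simp add: Nv_def face_lattice_def)
qed

definition comb :: "real^2 \<Rightarrow> real \<Rightarrow> real \<Rightarrow> real^2" where
  "comb v q r = q *\<^sub>R \<Lambda> (edge1 v) + r *\<^sub>R \<Lambda> (edge2 v)"

lemma comb_simps: "comb v q r + comb v q' r' = comb v (q + q') (r + r')"
  "comb v q r - comb v q' r' = comb v (q - q') (r - r')" "s *\<^sub>R comb v q r = comb v (s * q) (s * r)"
  by (auto simp: comb_def algebra_simps)

lemma comb_eq_iff:
  assumes "v extreme_point_of P"
  shows "comb v q r = comb v q' r' \<longleftrightarrow> q = q' \<and> r = r'"
proof
  assume "comb v q r = comb v q' r'"
  then have "comb v (q - q') (r - r') = 0" using comb_simps(2)[of v q r q' r'] by simp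
  then have "cross2 (comb v (q - q') (r - r')) (\<Lambda> (edge2 v)) = 0"
    "cross2 (\<Lambda> (edge1 v)) (comb v (q - q') (r - r')) = 0" by (simp_all add: cross2_simps)
  then have "(q - q') * cross2 (\<Lambda> (edge1 v)) (\<Lambda> (edge2 v)) = 0"
    "(r - r') * cross2 (\<Lambda> (edge1 v)) (\<Lambda> (edge2 v)) = 0"
    unfolding comb_def cross2_simps by simp_all
  then show "q = q' \<and> r = r'" using cross2_\<Lambda>_nz[OF assms] by simp
qed simp

lemma comb_ex:
  assumes "v extreme_point_of P"
  obtains q r where "x = comb v q r"
proof -
  let ?D = "cross2 (\<Lambda> (edge1 v)) (\<Lambda> (edge2 v))"
  have D: "?D \<noteq> 0" by (rule cross2_\<Lambda>_nz[OF assms])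
  have "x = (1 / ?D) *\<^sub>R (?D *\<^sub>R x)" using D by simp
  also have "\<dots> = comb v (cross2 x (\<Lambda> (edge2 v)) / ?D) (cross2 (\<Lambda> (edge1 v)) x / ?D)"
    by (subst cross2_Cramer) (simp add: comb_def scaleR_add_right)
  finally show ?thesis using that by blast
qed

lemma comb_mem_Nv_iff:
  assumes "v extreme_point_of P"
  shows "comb v q r \<in> Nv v \<longleftrightarrow> q \<in> \<int> \<and> r \<in> \<int>"
proof -
  have "comb v q r \<in> Nv v \<longleftrightarrow> (\<exists>k l :: int. comb v q r = comb v (of_int k) (of_int l))"
    unfolding Nv_eq[OF assms] mem_int_span_two comb_def ..
  then show ?thesis unfolding comb_eq_iff[OF assms] by (auto elim!: Ints_cases)
qed

lemma span_Nv:
  assumes "v extreme_point_of P"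
  shows "span (Nv v) = UNIV"
proof -
  have "x \<in> span (Nv v)" for x
  proof -
    obtain q r where "x = comb v q r" using comb_ex[OF assms] .
    then show ?thesis
      unfolding Nv_eq[OF assms] span_int_span comb_def
      by (simp add: span_add span_scale span_base)
  qed
  then show ?thesis by auto
qed

lemma U_subset: "U v \<subseteq> P" by (auto simp: U_def)

lemma mem_U_iff:
  "p \<in> U v \<longleftrightarrow> p \<in> P \<and> (\<forall>F. F edge_of P \<and> v \<notin> F \<longrightarrow> edge_fun F p > 0)"
proof -
  have "p \<in> P \<Longrightarrow> F edge_of P \<Longrightarrow> p \<notin> F \<longleftrightarrow> edge_fun F p > 0" for F
    using edge_fun_nonneg edge_fun_eq_0_iff by (metis less_eq_real_def less_irrefl)
  then show ?thesis unfolding U_def by blast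
qed

lemma edge_in_U: "p \<in> U v \<Longrightarrow> E edge_of P \<Longrightarrow> p \<in> E \<Longrightarrow> v \<in> E"
  by (auto simp: U_def)

text \<open>Over \<open>U v\<close> only the two edges at \<open>v\<close> matter, so an angle \<open>q\<^sub>i\<close> is undetermined exactly where \<open>z\<^sub>i = 0\<close>.\<close>
lemma stab_comb_iff:
  assumes v: "v extreme_point_of P" and p: "p \<in> U v"
  shows "comb v q r \<in> stab p \<longleftrightarrow> (p \<notin> edge1 v \<longrightarrow> q = 0) \<and> (p \<notin> edge2 v \<longrightarrow> r = 0)"
proof
  let ?T = "{x. \<exists>q r. x = comb v q r \<and> (p \<notin> edge1 v \<longrightarrow> q = 0) \<and> (p \<notin> edge2 v \<longrightarrow> r = 0)}"
  have "{\<Lambda> E |E. E edge_of P \<and> p \<in> E} \<subseteq> ?T"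
  proof safe
    fix E assume E: "E edge_of P" "p \<in> E"
    then have "E = edge1 v \<or> E = edge2 v" using vertex_edges_only[OF v] edge_in_U[OF p] by blast
    moreover have "\<Lambda> (edge1 v) = comb v 1 0" "\<Lambda> (edge2 v) = comb v 0 1" by (simp_all add: comb_def)
    ultimately show "\<exists>q r. \<Lambda> E = comb v q r \<and> (p \<notin> edge1 v \<longrightarrow> q = 0) \<and> (p \<notin> edge2 v \<longrightarrow> r = 0)"
      using E by (metis)
  qed
  moreover have "subspace ?T"
  proof (rule subspaceI)
    show "0 \<in> ?T" by (auto intro!: exI[of _ 0] simp: comb_def)
  next
    fix x y assume "x \<in> ?T" "y \<in> ?T"
    then obtain q r q' r' where "x = comb v q r" "p \<notin> edge1 v \<longrightarrow> q = 0" "p \<notin> edge2 v \<longrightarrow> r = 0"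
      "y = comb v q' r'" "p \<notin> edge1 v \<longrightarrow> q' = 0" "p \<notin> edge2 v \<longrightarrow> r' = 0" by blast
    then have "x + y = comb v (q + q') (r + r') \<and> (p \<notin> edge1 v \<longrightarrow> q + q' = 0) \<and> (p \<notin> edge2 v \<longrightarrow> r + r' = 0)"
      by (simp add: comb_simps)
    then show "x + y \<in> ?T" by blast
  next
    fix c x assume "x \<in> ?T"
    then obtain q r where "x = comb v q r" "p \<notin> edge1 v \<longrightarrow> q = 0" "p \<notin> edge2 v \<longrightarrow> r = 0" by blast
    then have "c *\<^sub>R x = comb v (c * q) (c * r) \<and> (p \<notin> edge1 v \<longrightarrow> c * q = 0) \<and> (p \<notin> edge2 v \<longrightarrow> c * r = 0)"
      by (simp add: comb_simps)
    then show "c *\<^sub>R x \<in> ?T" by blast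
  qed
  ultimately have "stab p \<subseteq> ?T" unfolding stab_def by (rule span_minimal)
  then show "comb v q r \<in> stab p \<Longrightarrow> (p \<notin> edge1 v \<longrightarrow> q = 0) \<and> (p \<notin> edge2 v \<longrightarrow> r = 0)"
    using comb_eq_iff[OF v] by auto
next
  assume a: "(p \<notin> edge1 v \<longrightarrow> q = 0) \<and> (p \<notin> edge2 v \<longrightarrow> r = 0)"
  have "q *\<^sub>R \<Lambda> (edge1 v) \<in> stab p"
  proof (cases "p \<in> edge1 v")
    case True
    then show ?thesis unfolding stab_def using vertex_edges(1)[OF v]
      by (intro span_scale span_base) blast
  qed (use a stab_simps in auto)
  moreover have "r *\<^sub>R \<Lambda> (edge2 v) \<in> stab p"
  proof (cases "p \<in> edge2 v")
    case True
    then show ?thesis unfolding stab_def using vertex_edges(2)[OF v]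
      by (intro span_scale span_base) blast
  qed (use a stab_simps in auto)
  ultimately show "comb v q r \<in> stab p" unfolding comb_def by (rule stab_simps)
qed

lemma Xt_eq:
  assumes v: "v extreme_point_of P"
  shows "Xt v = {orbit (Nv v) p x |p x. p \<in> U v}"
  unfolding Xt_def
proof (rule orbit_space_eq[OF additive_subgroup_Nv span_Nv[OF v] U_subset])
  fix p assume p: "p \<in> U v"
  then have "p \<in> P" using U_subset by blast
  then show "face_lattice (face_at p) \<subseteq> Nv v"
    unfolding face_lattice_face_at[OF \<open>p \<in> P\<close>]
    by (intro int_span_minimal[OF _ additive_subgroup_Nv])
      (auto simp: Nv_def face_lattice_def intro!: int_span_base edge_in_U[OF p])
qed

definition chart_pt :: "real^2 \<Rightarrow> real^2 \<Rightarrow> real \<Rightarrow> real \<Rightarrow> C2" where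
  "chart_pt v p q r = (of_real (sqrt (h v (edge1 v) p)) * cis (2 * pi * q),
     of_real (sqrt (h v (edge2 v) p)) * cis (2 * pi * r))"

lemma chart_orbit:
  assumes v: "v extreme_point_of P" and p: "p \<in> U v"
  shows "chart v (orbit (Nv v) p (comb v q r)) = chart_pt v p q r"
  unfolding chart_def
proof (rule the_equality)
  have "(p, coset (Nv v) (comb v q r + 0)) \<in> orbit (Nv v) p (comb v q r)"
    using stab_simps(1) unfolding orbit_def by blast
  moreover have "comb v q r \<in> coset (Nv v) (comb v q r + 0)"
    using additive_subgroup_Nv by (simp add: mem_coset_iff additive_subgroup_def)
  ultimately show "\<exists>p' t q1 q2. (p', t) \<in> orbit (Nv v) p (comb v q r) \<and>
      q1 *\<^sub>R \<Lambda> (edge1 v) + q2 *\<^sub>R \<Lambda> (edge2 v) \<in> t \<and> chart_pt v p q r =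
      (of_real (sqrt (h v (edge1 v) p')) * cis (2 * pi * q1), of_real (sqrt (h v (edge2 v) p')) * cis (2 * pi * q2))"
    unfolding comb_def chart_pt_def by blast
next
  fix z assume "\<exists>p' t q1 q2. (p', t) \<in> orbit (Nv v) p (comb v q r) \<and>
      q1 *\<^sub>R \<Lambda> (edge1 v) + q2 *\<^sub>R \<Lambda> (edge2 v) \<in> t \<and> z =
      (of_real (sqrt (h v (edge1 v) p')) * cis (2 * pi * q1), of_real (sqrt (h v (edge2 v) p')) * cis (2 * pi * q2))"
  then obtain s q1 q2 where s: "s \<in> stab p" and m: "comb v q1 q2 \<in> coset (Nv v) (comb v q r + s)"
    and z: "z = chart_pt v p q1 q2"
    unfolding orbit_def chart_pt_def comb_def[symmetric] by blast
  obtain a b where ab: "s = comb v a b" using comb_ex[OF v] .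
  have int: "q1 - (q + a) \<in> \<int>" "q2 - (r + b) \<in> \<int>"
    using m unfolding mem_coset_iff ab comb_simps comb_mem_Nv_iff[OF v] by auto
  have pP: "p \<in> P" using p U_subset by blast
  have "h v (edge1 v) p = 0 \<or> a = 0" "h v (edge2 v) p = 0 \<or> b = 0"
    using s unfolding ab stab_comb_iff[OF v p]
    using affine[OF v] vertex_edges[OF v] by blast+
  then show "z = chart_pt v p q r"
    using int unfolding z chart_pt_def
    by (auto simp: cis_2pi_eq_iff)
qed

lemma base_pt_chart_pt:
  assumes v: "v extreme_point_of P" and p: "p \<in> P"
  shows "base_pt v (chart_pt v p q r) = p"
proof -
  have nn: "h v (edge1 v) p = chart_scale v (edge1 v) * edge_fun (edge1 v) p"
    "h v (edge2 v) p = chart_scale v (edge2 v) * edge_fun (edge2 v) p"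
    "chart_scale v (edge1 v) > 0" "chart_scale v (edge2 v) > 0"
    "edge_fun (edge1 v) p \<ge> 0" "edge_fun (edge2 v) p \<ge> 0"
    using chart_scale[OF v] vertex_edges[OF v] edge_fun_nonneg p by auto
  have i: "z \<bullet> z = (cmod z)\<^sup>2" for z :: complex by (simp add: power2_norm_eq_inner)
  show ?thesis
    by (rule base_pt_unique[OF v, symmetric])
      (use nn in \<open>simp_all add: chart_pt_def i norm_mult\<close>)
qed

lemma chart_pt_base_pt:
  assumes v: "v extreme_point_of P" and z: "fst z = of_real (cmod (fst z)) * cis (2 * pi * q)"
    "snd z = of_real (cmod (snd z)) * cis (2 * pi * r)"
  shows "chart_pt v (base_pt v z) q r = z"
proof -
  have "h v (edge1 v) (base_pt v z) = (cmod (fst z))\<^sup>2" "h v (edge2 v) (base_pt v z) = (cmod (snd z))\<^sup>2"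
    using chart_scale[OF v] vertex_edges[OF v] edge_fun_base_pt[OF v, of z]
    by (simp_all add: power2_norm_eq_inner less_imp_neq[symmetric])
  then have "chart_pt v (base_pt v z) q r = (fst z, snd z)"
    using z unfolding chart_pt_def by simp
  then show ?thesis by simp
qed

lemma polar_form_ex:
  obtains q where "(z::complex) = of_real (cmod z) * cis (2 * pi * q)"
proof
  show "z = of_real (cmod z) * cis (2 * pi * (Arg z / (2 * pi)))"
    using rcis_cmod_Arg[of z] by (simp add: rcis_def)
qed

lemma chart_inj:
  assumes v: "v extreme_point_of P"
  shows "inj_on (chart v) (Xt v)"
proof (rule inj_onI)
  fix c d assume "c \<in> Xt v" "d \<in> Xt v" and eq: "chart v c = chart v d"
  then obtain p x p' x' where c: "c = orbit (Nv v) p x" "p \<in> U v" and d: "d = orbit (Nv v) p' x'" "p' \<in> U v"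
    unfolding Xt_eq[OF v] by blast
  obtain q r where x: "x = comb v q r" using comb_ex[OF v] .
  obtain q' r' where x': "x' = comb v q' r'" using comb_ex[OF v] .
  have e: "chart_pt v p q r = chart_pt v p' q' r'"
    using eq unfolding c d x x' chart_orbit[OF v c(2)] chart_orbit[OF v d(2)] .
  have pP: "p \<in> P" "p' \<in> P" using c d U_subset by auto
  have "p = p'" using base_pt_chart_pt[OF v pP(1), of q r] base_pt_chart_pt[OF v pP(2), of q' r'] e by simp
  have h0: "h v E p = 0 \<longleftrightarrow> p \<in> E" "h v E p \<ge> 0" if "E edge_of P" "v \<in> E" for E
    using chart_scale[OF v that] edge_fun_eq_0_iff[OF that(1) pP(1)] edge_fun_nonneg[OF that(1) pP(1)] by auto
  have i1: "p \<in> edge1 v \<or> q - q' \<in> \<int>" and i2: "p \<in> edge2 v \<or> r - r' \<in> \<int>"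
    using e h0[of "edge1 v"] h0[of "edge2 v"] vertex_edges[OF v] \<open>p = p'\<close>
    by (auto simp: chart_pt_def cis_2pi_eq_iff)
  define s where "s = comb v (if p \<in> edge1 v then q - q' else 0) (if p \<in> edge2 v then r - r' else 0)"
  have "s \<in> stab p" unfolding s_def stab_comb_iff[OF v c(2)] by auto
  moreover have "x - x' - s \<in> Nv v"
    unfolding s_def x x' comb_simps comb_mem_Nv_iff[OF v] using i1 i2 by auto
  ultimately show "c = d"
    unfolding c d orbit_eq_iff[OF additive_subgroup_Nv] using \<open>p = p'\<close> by blast
qed

lemma V_eq:
  assumes v: "v extreme_point_of P"
  shows "V v A = {z. base_pt v z \<in> U v \<inter> A}"
proof safe
  fix z assume "z \<in> V v A"
  then obtain c where c: "c \<in> Xt v" "base c \<in> A" "z = chart v c" by (auto simp: V_def)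
  then obtain p x where p: "c = orbit (Nv v) p x" "p \<in> U v" unfolding Xt_eq[OF v] by blast
  obtain q r where x: "x = comb v q r" using comb_ex[OF v] .
  have "p \<in> P" using p(2) U_subset by blast
  then have "base_pt v z = p"
    unfolding c(3) p(1) x chart_orbit[OF v p(2)] by (rule base_pt_chart_pt[OF v])
  then show "base_pt v z \<in> U v" "base_pt v z \<in> A" using p c by (auto simp: base_orbit)
next
  fix z assume z: "base_pt v z \<in> U v" "base_pt v z \<in> A"
  obtain q where q: "fst z = of_real (cmod (fst z)) * cis (2 * pi * q)" using polar_form_ex .
  obtain r where r: "snd z = of_real (cmod (snd z)) * cis (2 * pi * r)" using polar_form_ex .
  let ?c = "orbit (Nv v) (base_pt v z) (comb v q r)"
  have "chart v ?c = z" using chart_orbit[OF v z(1)] chart_pt_base_pt[OF v q r] by simp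
  moreover have "?c \<in> Xt v" using z unfolding Xt_eq[OF v] by blast
  moreover have "base ?c \<in> A" using z by (simp add: base_orbit)
  ultimately show "z \<in> V v A" unfolding V_def by force
qed

lemma V_P_iff:
  assumes v: "v extreme_point_of P"
  shows "z \<in> V v P \<longleftrightarrow> (\<forall>F. F edge_of P \<and> v \<notin> F \<longrightarrow> edge_fun F (base_pt v z) > 0)"
proof -
  have e: "edge_fun (edge1 v) (base_pt v z) \<ge> 0" "edge_fun (edge2 v) (base_pt v z) \<ge> 0"
    unfolding edge_fun_base_pt[OF v] using chart_scale(1)[OF v] vertex_edges[OF v]
    by (simp_all add: less_imp_le)
  have "base_pt v z \<in> P" if *: "\<forall>F. F edge_of P \<and> v \<notin> F \<longrightarrow> edge_fun F (base_pt v z) > 0"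
    unfolding mem_P_iff using * e vertex_edges_only[OF v] by (metis less_imp_le)
  then show ?thesis unfolding V_eq[OF v] using U_subset mem_U_iff by blast
qed

lemma V_P_interior:
  assumes v: "v extreme_point_of P" and z: "z \<in> V v P" "fst z \<noteq> 0" "snd z \<noteq> 0"
  shows "base_pt v z \<in> interior P"
proof (rule interiorI)
  show "base_pt v z \<in> P" using z(1) by (simp add: V_eq[OF v])
  have "edge_fun (edge1 v) (base_pt v z) > 0" "edge_fun (edge2 v) (base_pt v z) > 0"
    unfolding edge_fun_base_pt[OF v] using chart_scale(1)[OF v] vertex_edges[OF v] z by simp_all
  then show "edge_fun E (base_pt v z) > 0" if "E edge_of P" for E
    using that z(1) V_P_iff[OF v] vertex_edges_only[OF v] by metis
qed

lemma continuous_base_pt: "continuous_on S (base_pt v)"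
  by (meson has_derivative_base_pt has_derivative_continuous continuous_on_eq_continuous_within)

text \<open>The inequalities of the two edges at \<open>v\<close> hold automatically for \<open>base_pt v z\<close>, and the remaining
  conditions are strict.\<close>
lemma open_V_P:
  assumes v: "v extreme_point_of P"
  shows "open (V v P)"
proof -
  have "V v P = (\<Inter>F\<in>{F. F edge_of P \<and> v \<notin> F}. {z. edge_fun F (base_pt v z) > 0})"
    using V_P_iff[OF v] by auto
  moreover have "open {z. edge_fun F (base_pt v z) > 0}" for F
    by (rule open_Collect_less)
      (auto intro!: continuous_intros continuous_on_compose2[OF continuous_on_edge_fun[of UNIV] continuous_base_pt])
  ultimately show ?thesis using finite_edges by (simp add: open_INT)
qed

lemma V_P_mono: "v extreme_point_of P \<Longrightarrow> V v A \<subseteq> V v P"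
  using V_eq U_subset by blast

lemma chart_inv_eq:
  assumes v: "v extreme_point_of P" and z: "z \<in> V v P"
    and qr: "fst z = of_real (cmod (fst z)) * cis (2 * pi * q)" "snd z = of_real (cmod (snd z)) * cis (2 * pi * r)"
  shows "chart_inv v z = orbit (Nv v) (base_pt v z) (comb v q r)"
proof -
  have p: "base_pt v z \<in> U v" using z by (simp add: V_eq[OF v])
  show ?thesis
    unfolding chart_inv_def
  proof (rule inv_into_f_eq[OF chart_inj[OF v]])
    show "orbit (Nv v) (base_pt v z) (comb v q r) \<in> Xt v" using p unfolding Xt_eq[OF v] by blast
    show "chart v (orbit (Nv v) (base_pt v z) (comb v q r)) = z"
      using chart_orbit[OF v p] chart_pt_base_pt[OF v qr] by simp
  qed
qed

lemma \<xi>_chart_inv: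
  assumes "v extreme_point_of P" "z \<in> V v P"
    "fst z = of_real (cmod (fst z)) * cis (2 * pi * q)" "snd z = of_real (cmod (snd z)) * cis (2 * pi * r)"
  shows "\<xi> (chart_inv v z) = orbit std_lattice (base_pt v z) (comb v q r)"
  unfolding chart_inv_eq[OF assms] by (rule \<xi>_orbit[OF additive_subgroup_Nv Nv_subset_std_lattice])

lemma rot_eq:
  assumes v: "v extreme_point_of P" and t: "t \<in> carrier (torus (Nv v))"
  obtains s s' where "\<And>z. z \<in> V v P \<Longrightarrow> rot v t z = (cis s * fst z, cis s' * snd z)"
proof -
  obtain y where y: "t = coset (Nv v) y" using t by (auto simp: torus_carrier)
  obtain a b where ab: "y = comb v a b" using comb_ex[OF v] .
  have "rot v t z = (cis (2 * pi * a) * fst z, cis (2 * pi * b) * snd z)" if z: "z \<in> V v P" for z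
  proof -
    obtain q where q: "fst z = of_real (cmod (fst z)) * cis (2 * pi * q)" using polar_form_ex .
    obtain r where r: "snd z = of_real (cmod (snd z)) * cis (2 * pi * r)" using polar_form_ex .
    have p: "base_pt v z \<in> U v" using z by (simp add: V_eq[OF v])
    have "rot v t z = chart_pt v (base_pt v z) (a + q) (b + r)"
      unfolding rot_def chart_inv_eq[OF v z q r] y ab act_orbit[OF additive_subgroup_Nv] comb_simps
      by (rule chart_orbit[OF v p])
    also have "\<dots> = (cis (2 * pi * a) * fst (chart_pt v (base_pt v z) q r), cis (2 * pi * b) * snd (chart_pt v (base_pt v z) q r))"
      unfolding chart_pt_def by (simp add: cis_mult ring_distribs)
    finally show ?thesis unfolding chart_pt_base_pt[OF v q r] .
  qed
  then show ?thesis using that by blast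
qed

end

context primitive_quasitoric
begin

section \<open>Invariance and the almost complex structure\<close>

lemma smooth_on_base_pt: "open S \<Longrightarrow> smooth_on S (base_pt v)"
  unfolding base_pt_def[abs_def] divide_inverse
  by (intro smooth_on_intros smooth_on_linear bounded_linear_fst bounded_linear_snd)

lemma smooth_on_base_der: "open S \<Longrightarrow> smooth_on S (\<lambda>z. base_der v z a)"
  unfolding base_der_def[abs_def] divide_inverse
  by (intro smooth_on_intros smooth_on_linear bounded_linear_fst bounded_linear_snd)

lemma smooth_on_edge_fun_base_pt: "open S \<Longrightarrow> smooth_on S (\<lambda>z. edge_fun F (base_pt v z))"
  unfolding edge_fun_def by (intro smooth_on_intros smooth_on_base_pt)

lemma smooth_on_chart_form:
  assumes S: "open S"
  shows "smooth_on S (\<lambda>z. chart_form v z a b)"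
proof -
  have "bounded_linear (\<lambda>z :: C2. Im (cnj (fst z) * c))" "bounded_linear (\<lambda>z :: C2. Im (cnj (snd z) * c))" for c
    by (intro bounded_linear_compose[OF bounded_linear_Im] bounded_linear_mult_const
        bounded_linear_compose[OF bounded_linear_cnj] bounded_linear_fst bounded_linear_snd)+
  then have t: "smooth_on S (\<lambda>z. Im (cnj (fst z) * c))" "smooth_on S (\<lambda>z. Im (cnj (snd z) * c))" for c
    using smooth_on_linear[OF S] by blast+
  show ?thesis
    unfolding chart_form_def Let_def slope_def remainder_def vertex_weight_def all_prod_def other_prod_def divide_inverse
    by (intro smooth_on_intros smooth_on_cross2 smooth_on_edge_fun_base_pt smooth_on_base_der t S)
qed

lemma bilinear_chart_form: "bilinear (chart_form v z)"
proof -
  have b: "base_der v z (a + b) = base_der v z a + base_der v z b"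
    "base_der v z (r *\<^sub>R a) = r *\<^sub>R base_der v z a" for a b r
    by (auto simp: base_der_def inner_add_right algebra_simps add_divide_distrib)
  show ?thesis
    unfolding bilinear_def
  proof (intro allI conjI linearI)
    fix a a' b :: C2 and r :: real
    show "chart_form v z (a + a') b = chart_form v z a b + chart_form v z a' b"
      "chart_form v z b (a + a') = chart_form v z b a + chart_form v z b a'"
      "chart_form v z (r *\<^sub>R a) b = r *\<^sub>R chart_form v z a b"
      "chart_form v z b (r *\<^sub>R a) = r *\<^sub>R chart_form v z b a"
      unfolding chart_form_def Let_def b cross2_simps inner_add_right inner_scaleR_right
      by (simp_all add: algebra_simps add_divide_distrib diff_divide_distrib)
  qed
qed

lemma chart_form_skew: "chart_form v z a b = - chart_form v z b a"
  unfolding chart_form_def Let_def cross2_commute[of "base_der v z b" "base_der v z a"]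
  by (simp add: algebra_simps diff_divide_distrib)

lemma base_rotate:
  assumes "cmod c = 1" "cmod d = 1"
  shows "base_pt v (c * fst z, d * snd z) = base_pt v z"
    "base_der v (c * fst z, d * snd z) (c * fst a, d * snd a) = base_der v z a"
proof -
  have i: "(c * x) \<bullet> (c * y) = x \<bullet> y" if "cmod c = 1" for c x y :: complex
  proof -
    have "Re c * Re c + Im c * Im c = 1"
      using that cmod_power2[of c] by (simp add: power2_eq_square)
    then show ?thesis unfolding inner_complex_def times_complex.sel by algebra
  qed
  show "base_pt v (c * fst z, d * snd z) = base_pt v z"
    "base_der v (c * fst z, d * snd z) (c * fst a, d * snd a) = base_der v z a"
    by (simp_all add: base_pt_def base_der_def i assms)
qed

lemma chart_form_rotate:
  assumes "cmod c = 1" "cmod d = 1"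
  shows "chart_form v (c * fst z, d * snd z) (c * fst a, d * snd a) (c * fst b, d * snd b) = chart_form v z a b"
proof -
  have i: "cnj (c * x) * (c * y) = cnj x * y" if "cmod c = 1" for c x y :: complex
  proof -
    have "cnj c * c = 1" using that by (metis complex_norm_square mult.commute of_real_1 power_one)
    then show ?thesis by (metis complex_cnj_mult mult.assoc mult.commute mult_1)
  qed
  show ?thesis
    unfolding chart_form_def Let_def base_rotate[OF assms] fst_conv snd_conv i[OF assms(1)] i[OF assms(2)] ..
qed

lemma local_lift_has_derivative:
  assumes "local_lift f v w S \<phi>" "z \<in> S"
  shows "(\<phi> has_derivative frechet_derivative \<phi> (at z)) (at z)"
  using assms unfolding local_lift_def open_embedding_on_def
  by (blast intro: smooth_on_has_derivative)

text \<open>A lift of a translation by \<open>y\<close> preserves the base point and shifts the angles by \<open>y\<close> modulo the standard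
  lattice. Along smooth branches of the angles the error is a lattice point and hence locally constant,
  so the lift preserves the differentials of the base point and of the angles, from which the form is built.\<close>
lemma lift_preserves_chart_form_interior:
  assumes v: "v extreme_point_of P" and w: "w extreme_point_of P"
    and lift: "local_lift f v w S \<phi>"
    and f: "\<And>p x. f (orbit std_lattice p x) = orbit std_lattice p (y + x)"
    and z: "z \<in> S" "fst z \<noteq> 0" "snd z \<noteq> 0"
  shows "chart_form w (\<phi> z) (frechet_derivative \<phi> (at z) a) (frechet_derivative \<phi> (at z) b) = chart_form v z a b"
proof -
  let ?D = "frechet_derivative \<phi> (at z)"
  have S: "open S" "S \<subseteq> V v P" "\<And>u. u \<in> S \<Longrightarrow> \<phi> u \<in> V w P"
    and lf: "\<And>u. u \<in> S \<Longrightarrow> \<xi> (chart_inv w (\<phi> u)) = f (\<xi> (chart_inv v u))"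
    using lift unfolding local_lift_def open_embedding_on_def by auto
  have D: "(\<phi> has_derivative ?D) (at z)" by (rule local_lift_has_derivative[OF lift z(1)])
  have key: "base_pt w (\<phi> u) = base_pt v u \<and>
      (\<exists>s\<in>stab (base_pt v u). comb w q' r' - (y + comb v q r) - s \<in> std_lattice)"
    if u: "u \<in> S" and qr: "fst u = of_real (cmod (fst u)) * cis (2 * pi * q)" "snd u = of_real (cmod (snd u)) * cis (2 * pi * r)"
      "fst (\<phi> u) = of_real (cmod (fst (\<phi> u))) * cis (2 * pi * q')" "snd (\<phi> u) = of_real (cmod (snd (\<phi> u))) * cis (2 * pi * r')"
    for u q r q' r'
  proof -
    have "u \<in> V v P" using u S(2) by blast
    have "orbit std_lattice (base_pt w (\<phi> u)) (comb w q' r') = orbit std_lattice (base_pt v u) (y + comb v q r)"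
      using lf[OF u] unfolding \<xi>_chart_inv[OF v \<open>u \<in> V v P\<close> qr(1,2)] \<xi>_chart_inv[OF w S(3)[OF u] qr(3,4)] f .
    then show ?thesis unfolding orbit_eq_iff[OF additive_subgroup_std_lattice] by auto
  qed
  have base: "base_pt w (\<phi> u) = base_pt v u" if "u \<in> S" for u
    using key[OF that] polar_form_ex by metis
  have inner: "base_pt v u \<in> interior P" if "u \<in> S" "fst u \<noteq> 0" "snd u \<noteq> 0" for u
    using V_P_interior[OF v] that S(2) by blast
  have nz: "fst (\<phi> u) \<noteq> 0" "snd (\<phi> u) \<noteq> 0" if u: "u \<in> S" "fst u \<noteq> 0" "snd u \<noteq> 0" for u
    using edge_fun_pos_interior[OF vertex_edges(1)[OF w] inner[OF u]]
      edge_fun_pos_interior[OF vertex_edges(2)[OF w] inner[OF u]]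
    unfolding base[OF u(1), symmetric] edge_fun_base_pt[OF w] by auto
  have "((\<lambda>u. base_pt w (\<phi> u)) has_derivative (\<lambda>a. base_der w (\<phi> z) (?D a))) (at z)"
    using has_derivative_compose[OF D has_derivative_base_pt[of w "\<phi> z" UNIV]] by simp
  then have "(base_pt v has_derivative (\<lambda>a. base_der w (\<phi> z) (?D a))) (at z)"
    by (rule has_derivative_transform_within_open[OF _ S(1) z(1) base])
  then have db: "base_der w (\<phi> z) (?D a) = base_der v z a" for a
    using has_derivative_unique[OF has_derivative_base_pt[of v z UNIV]] by (metis)
  define \<theta> where "\<theta> c u = (Arg c + Im (Ln (u / c))) / (2 * pi)" for c u
  define Q where "Q u = comb v (\<theta> (fst z) (fst u)) (\<theta> (snd z) (snd u))" for u
  define R where "R u = comb w (\<theta> (fst (\<phi> z)) (fst u)) (\<theta> (snd (\<phi> z)) (snd u))" for u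
  have dang: "((\<lambda>x. comb t (\<theta> (fst c) (fst x)) (\<theta> (snd c) (snd x))) has_derivative angle_der t c) (at c)"
    if "fst c \<noteq> 0" "snd c \<noteq> 0" for t c
  proof -
    have 1: "((\<lambda>x. \<theta> (fst c) (fst x)) has_derivative (\<lambda>a. Im (cnj (fst c) * fst a) / (2 * pi * (fst c \<bullet> fst c)))) (at c)"
      unfolding \<theta>_def
      by (rule has_derivative_compose[OF bounded_linear_imp_has_derivative[OF bounded_linear_fst] has_derivative_angle[OF that(1)]])
    have 2: "((\<lambda>x. \<theta> (snd c) (snd x)) has_derivative (\<lambda>a. Im (cnj (snd c) * snd a) / (2 * pi * (snd c \<bullet> snd c)))) (at c)"
      unfolding \<theta>_def
      by (rule has_derivative_compose[OF bounded_linear_imp_has_derivative[OF bounded_linear_snd] has_derivative_angle[OF that(2)]])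
    show ?thesis
      unfolding comb_def angle_der_def
      by (intro has_derivative_add has_derivative_scaleR_left 1 2)
  qed
  have dR: "((\<lambda>u. R (\<phi> u)) has_derivative (\<lambda>a. angle_der w (\<phi> z) (?D a))) (at z)"
    unfolding R_def by (rule has_derivative_compose[OF D dang[OF nz[OF z]]])
  have dQ: "(Q has_derivative angle_der v z) (at z)"
    unfolding Q_def[abs_def] by (rule dang[OF z(2,3)])
  \<comment> \<open>the error: zero if the angles are shifted exactly by \<open>y\<close>, and always a lattice point\<close>
  define E where "E u = R (\<phi> u) - (y + Q u)" for u
  have dE: "(E has_derivative (\<lambda>a. angle_der w (\<phi> z) (?D a) - (0 + angle_der v z a))) (at z)"
    unfolding E_def[abs_def] by (intro has_derivative_diff has_derivative_add has_derivative_const dR dQ)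
  have El: "E u \<in> std_lattice" if u: "u \<in> S" "fst u \<noteq> 0" "snd u \<noteq> 0" for u
  proof -
    have "stab (base_pt v u) = {0}" using stab_interior inner[OF u] by blast
    then show ?thesis
      using key[OF u(1), of "\<theta> (fst z) (fst u)" "\<theta> (snd z) (snd u)" "\<theta> (fst (\<phi> z)) (fst (\<phi> u))" "\<theta> (snd (\<phi> z)) (snd (\<phi> u))"]
        angle_branch[OF z(2) u(2)] angle_branch[OF z(3) u(3)]
        angle_branch[OF nz(1)[OF z] nz(1)[OF u]] angle_branch[OF nz(2)[OF z] nz(2)[OF u]]
      by (simp add: E_def R_def Q_def \<theta>_def)
  qed
  have "open (S \<inter> {u. fst u \<noteq> 0 \<and> snd u \<noteq> 0})"
    by (intro open_Int S(1) open_Collect_conj open_Collect_neq continuous_intros)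
  then have "\<forall>\<^sub>F u in at z. u \<in> S \<inter> {u. fst u \<noteq> 0 \<and> snd u \<noteq> 0}"
    using z by (intro eventually_at_in_open') auto
  moreover have "\<forall>\<^sub>F u in at z. dist (E u) (E z) < 1"
    using has_derivative_continuous[OF dE] by (intro tendstoD) (auto simp: continuous_at)
  ultimately have "\<forall>\<^sub>F u in at z. E u = E z"
  proof eventually_elim
    case (elim u)
    then have "E u - E z \<in> std_lattice"
      using El z by (intro additive_subgroup_diff[OF additive_subgroup_std_lattice]) auto
    then have "E u - E z = 0" using elim by (intro std_lattice_small_0) (simp_all add: dist_norm)
    then show ?case by simp
  qed
  then have "((\<lambda>u. E z) has_derivative (\<lambda>a. angle_der w (\<phi> z) (?D a) - (0 + angle_der v z a))) (at z)"
    by (intro has_derivative_transform_eventually[OF dE]) auto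
  then have dE0: "(\<lambda>a. angle_der w (\<phi> z) (?D a) - (0 + angle_der v z a)) = (\<lambda>a. 0)"
    by (rule has_derivative_unique[OF _ has_derivative_const])
  have da: "angle_der w (\<phi> z) (?D a) = angle_der v z a" for a
    using fun_cong[OF dE0, of a] by (simp only: add_0_left right_minus_eq)
  show ?thesis
    unfolding chart_form_interior[OF v z(2,3)] chart_form_interior[OF w nz[OF z]] base[OF z(1)] db da ..
qed

text \<open>Both sides are continuous in \<open>z\<close>, and the points with \<open>z\<^sub>1 z\<^sub>2 \<noteq> 0\<close> are dense.\<close>
lemma lift_preserves_chart_form:
  assumes v: "v extreme_point_of P" and w: "w extreme_point_of P"
    and lift: "local_lift f v w S \<phi>"
    and f: "\<And>p x. f (orbit std_lattice p x) = orbit std_lattice p (y + x)"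
    and z: "z \<in> S"
  shows "chart_form w (\<phi> z) (frechet_derivative \<phi> (at z) a) (frechet_derivative \<phi> (at z) b) = chart_form v z a b"
proof -
  let ?D = "\<lambda>u. frechet_derivative \<phi> (at u)"
  let ?g = "\<lambda>u. chart_form w (\<phi> u) (?D u a) (?D u b) - chart_form v u a b"
  have S: "open S" "smooth_on S \<phi>" using lift unfolding local_lift_def open_embedding_on_def by auto
  have cont: "continuous_on S ?g"
  proof -
    have c: "continuous_on UNIV (\<lambda>u. chart_form v u i j)" for v i j
      by (intro smooth_on_imp_continuous_on smooth_on_chart_form) simp
    have e: "chart_form w (\<phi> u) (?D u a) (?D u b) =
        (\<Sum>(i, j)\<in>Basis \<times> Basis. (?D u a \<bullet> i) * (?D u b \<bullet> j) * chart_form w (\<phi> u) i j)" for u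
    proof -
      have "chart_form w (\<phi> u) (?D u a) (?D u b) =
          chart_form w (\<phi> u) (\<Sum>i\<in>Basis. (?D u a \<bullet> i) *\<^sub>R i) (\<Sum>j\<in>Basis. (?D u b \<bullet> j) *\<^sub>R j)"
        by (simp only: euclidean_representation)
      also have "\<dots> = (\<Sum>(i, j)\<in>Basis \<times> Basis. chart_form w (\<phi> u) ((?D u a \<bullet> i) *\<^sub>R i) ((?D u b \<bullet> j) *\<^sub>R j))"
        by (rule bilinear_sum[OF bilinear_chart_form])
      finally show ?thesis
        by (simp add: bilinear_lmul[OF bilinear_chart_form] bilinear_rmul[OF bilinear_chart_form] mult.assoc mult.left_commute)
    qed
    show ?thesis
      unfolding e case_prod_unfold
      by (intro continuous_intros smooth_on_derivative_continuous[OF S(2)] continuous_on_subset[OF c]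
          continuous_on_compose2[OF c smooth_on_imp_continuous_on[OF S(2)]]) auto
  qed
  let ?B = "(- {0}) \<times> (- {0}) :: C2 set"
  have "closedin (top_of_set S) {u \<in> S. ?g u = 0}"
    by (rule continuous_closedin_preimage_constant[OF cont])
  then obtain C where C: "closed C" "{u \<in> S. ?g u = 0} = S \<inter> C" by (auto simp: closedin_closed)
  have "closure ?B = UNIV" by (simp add: closure_Times closure_complement)
  then have "z \<in> closure (S \<inter> ?B)" using z open_Int_closure_subset[OF S(1), of ?B] by auto
  moreover have "S \<inter> ?B \<subseteq> C"
  proof
    fix u assume u: "u \<in> S \<inter> ?B"
    then have u': "u \<in> S" "fst u \<noteq> 0" "snd u \<noteq> 0" by auto
    have "?g u = 0"
      using lift_preserves_chart_form_interior[OF v w lift f u', of a b] by simp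
    then show "u \<in> C" using u C(2) by blast
  qed
  ultimately have "z \<in> C" using C(1) closure_minimal by blast
  then show ?thesis using C(2) z by auto
qed

text \<open>\<open>J\<close> is the polar part of \<open>chart_form\<close> with respect to \<open>\<mu>\<close>, chart by chart. Each required invariance of \<open>J\<close>
  is naturality of the polar part, applied to a map that preserves \<open>\<mu>\<close> by hypothesis and the form by
  construction.\<close>
lemma almost_complex_structure_exists:
  assumes pos: positively_omnioriented
    and g: "metric_over P \<mu>"
    and inv: "torus_invariant (preserves_metric \<mu>)"
  shows "\<exists>J. almost_complex_structure J \<and> torus_invariant (preserves_acs J) \<and> orthogonal_acs \<mu> J"
proof -
  have ip: "inner_product_form (\<mu> v z)" if "v extreme_point_of P" "z \<in> V v P" for v z
  proof -
    have "\<forall>z\<in>V v P. bilinear (\<mu> v z) \<and> (\<forall>a b. \<mu> v z a b = \<mu> v z b a) \<and> (\<forall>a. a \<noteq> 0 \<longrightarrow> \<mu> v z a a > 0)"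
      using g that(1) unfolding metric_over_def by blast
    then show ?thesis using that(2) unfolding inner_product_form_def by blast
  qed
  have nd: "nondegenerate (chart_form v z)" if "v extreme_point_of P" "z \<in> V v P" for v z
    using nondegenerate_chart_form_at[OF pos that(1)] that(2) V_eq[OF that(1)] by auto
  have "\<exists>J. (\<forall>z\<in>V v P. polar_part (\<mu> v z) (chart_form v z) (J z)) \<and> (\<forall>a. smooth_on (V v P) (\<lambda>z. J z a))"
    if v: "v extreme_point_of P" for v
  proof (rule smooth_polar_part[OF open_V_P[OF v]])
    have "\<forall>a b. smooth_on (V v P) (\<lambda>z. \<mu> v z a b)" using g v unfolding metric_over_def by blast
    then show "smooth_on (V v P) (\<lambda>z. \<mu> v z a b)" for a b by blast
    show "smooth_on (V v P) (\<lambda>z. chart_form v z a b)" for a b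
      by (rule smooth_on_chart_form[OF open_V_P[OF v]])
    show "DIM(C2) = 4" by simp
    show "chart_form v z a b = - chart_form v z b a" for z a b by (rule chart_form_skew)
  qed (simp_all add: ip nd v bilinear_chart_form)
  then obtain J where J: "\<And>v z. v extreme_point_of P \<Longrightarrow> z \<in> V v P \<Longrightarrow> polar_part (\<mu> v z) (chart_form v z) (J v z)"
    and Js: "\<And>v a. v extreme_point_of P \<Longrightarrow> smooth_on (V v P) (\<lambda>z. J v z a)"
    by metis
  have natural: "preserves_acs J v w \<phi> z"
    if v: "v extreme_point_of P" "z \<in> V v P" and w: "w extreme_point_of P" "\<phi> z \<in> V w P"
      and D: "(\<phi> has_derivative D) (at z)"
      and pg: "preserves_metric \<mu> v w \<phi> z"
      and pf: "\<And>a b. chart_form w (\<phi> z) (D a) (D b) = chart_form v z a b" for v w \<phi> z D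
  proof -
    have D': "frechet_derivative \<phi> (at z) = D" by (rule frechet_derivative_at[OF D, symmetric])
    have pg': "\<mu> w (\<phi> z) (D a) (D b) = \<mu> v z a b" for a b
      using pg unfolding preserves_metric_def D' by blast
    show ?thesis
      unfolding preserves_acs_def D'
      using polar_part_natural[OF ip[OF v] nd[OF v] J[OF v] J[OF w] has_derivative_linear[OF D] pg' pf ip[OF w]]
      by blast
  qed
  have lifts: "preserves_acs J v w \<phi> z"
    if v: "v extreme_point_of P" and w: "w extreme_point_of P" and l: "local_lift f v w S \<phi>" and z: "z \<in> S"
      and f: "\<And>p x. f (orbit std_lattice p x) = orbit std_lattice p (y + x)"
      and pg: "preserves_metric \<mu> v w \<phi> z" for v w f S \<phi> z y
  proof (rule natural[OF v _ w _ local_lift_has_derivative[OF l z] pg])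
    show "z \<in> V v P" "\<phi> z \<in> V w P" using l z unfolding local_lift_def by blast+
    show "chart_form w (\<phi> z) (frechet_derivative \<phi> (at z) a) (frechet_derivative \<phi> (at z) b) = chart_form v z a b" for a b
      by (rule lift_preserves_chart_form[OF v w l f z])
  qed
  have "almost_complex_structure J"
    unfolding almost_complex_structure_def
  proof (intro conjI allI impI ballI)
    fix v z a assume "v extreme_point_of P" "z \<in> V v P"
    from J[OF this] show "linear (J v z)" "J v z (J v z a) = - a" unfolding polar_part_def by blast+
  next
    show "chart_compatible P (preserves_acs J)"
      unfolding chart_compatible_def
    proof (intro allI impI ballI)
      fix v w S \<phi> z
      assume a: "v extreme_point_of P \<and> w extreme_point_of P \<and> local_lift id v w S \<phi> \<and> S \<subseteq> V v P" and z: "z \<in> S"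
      then have "preserves_metric \<mu> v w \<phi> z"
        using g unfolding metric_over_def chart_compatible_def by blast
      then show "preserves_acs J v w \<phi> z" using a z by (intro lifts[where f=id and y=0]) auto
    qed
  qed (rule Js)
  moreover have "torus_invariant (preserves_acs J)"
    unfolding torus_invariant_def
  proof (intro conjI allI impI)
    fix v assume v: "v extreme_point_of P"
    obtain B where B: "open B" "v \<in> B"
      and pB: "\<And>t z. t \<in> carrier (torus (Nv v)) \<Longrightarrow> z \<in> V v B \<Longrightarrow> preserves_metric \<mu> v v (rot v t) z"
    proof -
      have "\<forall>v. v extreme_point_of P \<longrightarrow> (\<exists>B. open B \<and> v \<in> B \<and>
          (\<forall>t\<in>carrier (torus (Nv v)). \<forall>z\<in>V v B. preserves_metric \<mu> v v (rot v t) z))"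
        using inv unfolding torus_invariant_def ..
      then show ?thesis using that v by metis
    qed
    have "preserves_acs J v v (rot v t) z" if t: "t \<in> carrier (torus (Nv v))" and z: "z \<in> V v B" for t z
    proof -
      have zP: "z \<in> V v P" using z V_P_mono[OF v] by blast
      obtain s s' where rot: "\<And>z. z \<in> V v P \<Longrightarrow> rot v t z = (cis s * fst z, cis s' * snd z)"
        using rot_eq[OF v t] by blast
      let ?R = "\<lambda>z :: C2. (cis s * fst z, cis s' * snd z)"
      have "bounded_linear ?R"
        by (intro bounded_linear_Pair bounded_linear_const_mult bounded_linear_fst bounded_linear_snd)
      then have "(?R has_derivative ?R) (at z)" by (rule bounded_linear_imp_has_derivative)
      then have D: "(rot v t has_derivative ?R) (at z)"
        by (rule has_derivative_transform_within_open[OF _ open_V_P[OF v] zP]) (simp add: rot)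
      have "rot v t z \<in> V v P" using zP unfolding rot[OF zP] V_eq[OF v] by (simp add: base_rotate)
      then show ?thesis
        by (rule natural[OF v zP v _ D pB[OF t z]]) (simp add: rot[OF zP] chart_form_rotate)
    qed
    then show "\<exists>B. open B \<and> v \<in> B \<and> (\<forall>t\<in>carrier (torus (Nv v)). \<forall>z\<in>V v B. preserves_acs J v v (rot v t) z)"
      using B by blast
  next
    show "TN_invariant_on_reg P (preserves_acs J)"
      unfolding TN_invariant_on_reg_def
    proof (intro ballI allI impI)
      fix t v w S \<phi> z
      assume t: "t \<in> carrier (torus std_lattice)" and z: "z \<in> S"
        and a: "v extreme_point_of P \<and> w extreme_point_of P \<and> local_lift (act std_lattice t) v w S \<phi> \<and>
          S \<subseteq> V v P \<and> \<xi> ` chart_inv v ` S \<subseteq> X_reg"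
      obtain y where "\<And>p x. act std_lattice t (orbit std_lattice p x) = orbit std_lattice p (y + x)"
        using act_std_orbit_exists[OF t] by blast
      moreover have "preserves_metric \<mu> v w \<phi> z"
      proof -
        have "TN_invariant_on_reg P (preserves_metric \<mu>)" using inv unfolding torus_invariant_def ..
        then show ?thesis
          by (rule TN_invariant_on_reg_def[THEN iffD1, rule_format, OF _ t a z])
      qed
      ultimately show "preserves_acs J v w \<phi> z"
        using a z by (intro lifts[where f="act std_lattice t"]) auto
    qed
  qed
  moreover have "orthogonal_acs \<mu> J"
    unfolding orthogonal_acs_def
  proof (intro allI impI ballI)
    fix v z a b assume v: "v extreme_point_of P" "z \<in> V v P"
    show "\<mu> v z (J v z a) (J v z b) = \<mu> v z a b"
      by (rule polar_part_orthogonal[OF ip[OF v] nd[OF v] chart_form_skew J[OF v]])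
  qed
  ultimately show ?thesis by blast
qed

end

theorem theorem3p1:
  fixes P :: "(real^2) set"
    and \<Lambda> :: "(real^2) set \<Rightarrow> real^2"
    and h :: "real^2 \<Rightarrow> (real^2) set \<Rightarrow> real^2 \<Rightarrow> real"
    and \<mu> :: "metric_family"
  assumes "primitive_quasitoric P \<Lambda> h"
    and "primitive_quasitoric.positively_omnioriented P \<Lambda>"
    and "primitive_quasitoric.metric_over P \<Lambda> h P \<mu>"
    and "primitive_quasitoric.torus_invariant P \<Lambda> h (preserves_metric \<mu>)"
    and "primitive_quasitoric.glued_metric P \<Lambda> h \<mu>"
  shows "\<exists>J :: acs_family.
           primitive_quasitoric.almost_complex_structure P \<Lambda> h J \<and>
           primitive_quasitoric.torus_invariant P \<Lambda> h (preserves_acs J) \<and>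
           primitive_quasitoric.orthogonal_acs P \<Lambda> h \<mu> J"
  using primitive_quasitoric.almost_complex_structure_exists[OF assms(1-4)] .

end
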